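(* Let $\Omega$ be an open bounded subset of a complete finite-dimensional Riemannian manifold $M$, let $F:\mathcal{X}\to\mathbb{R}$ be proper and continuous, let $f:\partial\Omega\to\mathbb{R}$, and consider the Dirichlet problem $$F(x,u,du,d^2u)=0\ \text{ in }\Omega,\qquad u=f\ \text{ on }\partial\Omega.\qquad(DP)$$ Let comparison hold for $(DP)$, i.e., if $w$ is a subsolution of $(DP)$ and $v$ is a supersolution of $(DP)$, then $w\le v$. Suppose also that there exist a subsolution $\underline u$ and a supersolution $\overline u$ of $(DP)$ that satisfy the boundary condition $\underline u_*(x)=\overline u^*(x)=f(x)$ for $x\in\partial\Omega$. Then $$W(x)=\sup\{w(x):\underline u\le w\le\overline u\text{ and }w\text{ is a subsolution of }(DP)\}$$ is a (viscosity) solution of $(DP)$.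
   Context: $TM_x$ and $TM_x^*$ are identified via the metric; $\mathcal{L}^2_s(TM_x)$ is the space of symmetric bilinear forms on $TM_x$, ordered as quadratic forms. $\mathcal{X}=\{(x,r,\zeta,A):x\in M,\ r\in\mathbb{R},\ \zeta\in TM_x,\ A\in\mathcal{L}^2_s(TM_x)\}$. $F:\mathcal{X}\to\mathbb{R}$ is degenerate elliptic if $A\le B$ implies $F(x,r,\zeta,B)\le F(x,r,\zeta,A)$; it is proper if it is degenerate elliptic and nondecreasing in $r$. Superjet and subjet: $J^{2,+}u(x)$ (resp. $J^{2,-}u(x)$) is the set of $(d\varphi(x),d^2\varphi(x))$ with $\varphi$ of class $C^2$ near $x$ and $u-\varphi$ having a local maximum (resp. minimum) at $x$; $d^2\varphi$ is the Riemannian Hessian. A viscosity subsolution of $F=0$ in $\Omega$ satisfies $F(x,u(x),\zeta,A)\le0$ for all $x\in\Omega$, $(\zeta,A)\in J^{2,+}u(x)$; a viscosity supersolution satisfies $F(x,u(x),\zeta,A)\ge0$ for all $x\in\Omega$, $(\zeta,A)\in J^{2,-}u(x)$. A subsolution of $(DP)$ is a real-valued upper semicontinuous function on $\overline\Omega$ that is a viscosity subsolution of $F=0$ in $\Omega$ and is $\le f$ on $\partial\Omega$; a supersolution of $(DP)$ is a real-valued lower semicontinuous function on $\overline\Omega$ that is a viscosity supersolution of $F=0$ in $\Omega$ and is $\ge f$ on $\partial\Omega$; a solution of $(DP)$ is both. Envelopes: with $d$ the Riemannian distance, $$u^*(x)=\lim_{r\downarrow0}\sup\{u(y):y\in\Omega,\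 d(y,x)\le r\},\qquad u_*(x)=\lim_{r\downarrow0}\inf\{u(y):y\in\Omega,\ d(y,x)\le r\}.$$ *)

theory Defs
  imports "HOL-Analysis.Analysis"
begin

section \<open>Smooth manifolds\<close>

text \<open>\<open>C_k_on k f S\<close> is meant for open \<open>S\<close>: all iterated directional derivatives up to order \<open>k\<close>
  exist on \<open>S\<close>, those of order \<open><k\<close> are differentiable and those of order \<open>k\<close> are continuous.\<close>

primrec C_k_on :: "nat \<Rightarrow> ('a::euclidean_space \<Rightarrow> 'b::real_normed_vector) \<Rightarrow> 'a set \<Rightarrow> bool" where
  "C_k_on 0 f S \<longleftrightarrow> continuous_on S f"
| "C_k_on (Suc k) f S \<longleftrightarrow>
     (\<forall>p\<in>S. f differentiable (at p)) \<and> (\<forall>v. C_k_on k (\<lambda>p. frechet_derivative f (at p) v) S)"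

definition smooth_on :: "'a::euclidean_space set \<Rightarrow> ('a \<Rightarrow> 'b::real_normed_vector) \<Rightarrow> bool" where
  "smooth_on S f \<longleftrightarrow> (\<forall>k. C_k_on k f S)"

text \<open>The manifold is the whole of a Hausdorff, second countable type \<open>'m\<close>, modelled on the Euclidean
  space \<open>'a\<close>. A chart is a pair of its domain and its coordinate map.\<close>

type_synonym ('m, 'a) chart = "'m set \<times> ('m \<Rightarrow> 'a)"

abbreviation chart_inv :: "('m, 'a) chart \<Rightarrow> 'a \<Rightarrow> 'm" where
  "chart_inv c \<equiv> inv_into (fst c) (snd c)"

abbreviation chart_image :: "('m, 'a) chart \<Rightarrow> 'a set" where
  "chart_image c \<equiv> snd c ` fst c"

definition is_chart :: "('m::topological_space, 'a::euclidean_space) chart \<Rightarrow> bool" where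
  "is_chart c \<longleftrightarrow> open (fst c) \<and> open (chart_image c) \<and>
     homeomorphism (fst c) (chart_image c) (snd c) (chart_inv c)"

definition transition :: "('m, 'a) chart \<Rightarrow> ('m, 'a) chart \<Rightarrow> 'a \<Rightarrow> 'a" where
  "transition c d = snd d \<circ> chart_inv c"

definition smooth_atlas ::
  "('m::{t2_space,second_countable_topology}, 'a::euclidean_space) chart set \<Rightarrow> bool" where
  "smooth_atlas \<A> \<longleftrightarrow> (\<forall>c\<in>\<A>. is_chart c) \<and> (\<Union>c\<in>\<A>. fst c) = UNIV \<and>
     (\<forall>c\<in>\<A>. \<forall>d\<in>\<A>. smooth_on (snd c ` (fst c \<inter> fst d)) (transition c d))"


section \<open>Tangent spaces and symmetric bilinear forms\<close>

text \<open>A tangent vector at \<open>x\<close> is given by its coordinate vectors in all charts around \<open>x\<close>, related by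
  the derivatives of the transition maps. Outside these charts it is set to 0, so that equality of
  tangent vectors is equality of functions. The vector space operations are pointwise.\<close>

type_synonym ('m, 'a) tvec = "('m, 'a) chart \<Rightarrow> 'a"

definition tangent_space ::
  "('m, 'a::euclidean_space) chart set \<Rightarrow> 'm \<Rightarrow> ('m, 'a) tvec set" where
  "tangent_space \<A> x = {\<xi>.
     (\<forall>c\<in>\<A>. \<forall>d\<in>\<A>. x \<in> fst c \<inter> fst d \<longrightarrow>
        \<xi> d = frechet_derivative (transition c d) (at (snd c x)) (\<xi> c)) \<and>
     (\<forall>c. \<not> (c \<in> \<A> \<and> x \<in> fst c) \<longrightarrow> \<xi> c = 0)}"

text \<open>The tangent vector at \<open>x\<close> with coordinate vector \<open>v\<close> in the chart \<open>c\<close>.\<close>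

definition tangent_vector ::
  "('m, 'a::euclidean_space) chart set \<Rightarrow> ('m, 'a) chart \<Rightarrow> 'm \<Rightarrow> 'a \<Rightarrow> ('m, 'a) tvec" where
  "tangent_vector \<A> c x v =
     (\<lambda>d. if d \<in> \<A> \<and> x \<in> fst d then frechet_derivative (transition c d) (at (snd c x)) v else 0)"

type_synonym ('m, 'a) form = "('m, 'a) tvec \<Rightarrow> ('m, 'a) tvec \<Rightarrow> real"

text \<open>Forms are extended by 0 outside the tangent space, again to make equality extensional.\<close>

definition sym_forms :: "('m, 'a::euclidean_space) chart set \<Rightarrow> 'm \<Rightarrow> ('m, 'a) form set" where
  "sym_forms \<A> x = {A.
     (\<forall>\<xi>\<in>tangent_space \<A> x. \<forall>\<eta>\<in>tangent_space \<A> x. A \<xi> \<eta> = A \<eta> \<xi>) \<and>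
     (\<forall>\<xi>\<in>tangent_space \<A> x. \<forall>\<eta>\<in>tangent_space \<A> x. \<forall>\<theta>\<in>tangent_space \<A> x. \<forall>a b.
        A (\<lambda>c. a *\<^sub>R \<xi> c + b *\<^sub>R \<eta> c) \<theta> = a * A \<xi> \<theta> + b * A \<eta> \<theta>) \<and>
     (\<forall>\<xi> \<eta>. \<not> (\<xi> \<in> tangent_space \<A> x \<and> \<eta> \<in> tangent_space \<A> x) \<longrightarrow> A \<xi> \<eta> = 0)}"

definition form_le ::
  "('m, 'a::euclidean_space) chart set \<Rightarrow> 'm \<Rightarrow> ('m, 'a) form \<Rightarrow> ('m, 'a) form \<Rightarrow> bool" where
  "form_le \<A> x A B \<longleftrightarrow> (\<forall>\<xi>\<in>tangent_space \<A> x. A \<xi> \<xi> \<le> B \<xi> \<xi>)"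


section \<open>Riemannian metrics, distance and Hessian\<close>

type_synonym ('m, 'a) metric = "'m \<Rightarrow> ('m, 'a) form"

definition metric_coord :: "('m, 'a::euclidean_space) chart set \<Rightarrow> ('m, 'a) metric \<Rightarrow>
    ('m, 'a) chart \<Rightarrow> 'a \<Rightarrow> 'a \<Rightarrow> 'a \<Rightarrow> real" where
  "metric_coord \<A> g c p v w =
     g (chart_inv c p) (tangent_vector \<A> c (chart_inv c p) v) (tangent_vector \<A> c (chart_inv c p) w)"

definition riemannian_manifold ::
  "('m::{t2_space,second_countable_topology}, 'a::euclidean_space) chart set \<Rightarrow>
   ('m, 'a) metric \<Rightarrow> bool" where
  "riemannian_manifold \<A> g \<longleftrightarrow> smooth_atlas \<A> \<and>
     (\<forall>x. g x \<in> sym_forms \<A> x \<and> (\<forall>\<xi>\<in>tangent_space \<A> x. \<xi> \<noteq> (\<lambda>c. 0) \<longrightarrow> 0 < g x \<xi> \<xi>)) \<and>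
     (\<forall>c\<in>\<A>. \<forall>v w. smooth_on (chart_image c) (\<lambda>p. metric_coord \<A> g c p v w))"

definition C1_curve_on :: "('m, 'a::euclidean_space) chart set \<Rightarrow> real \<Rightarrow> real \<Rightarrow> (real \<Rightarrow> 'm) \<Rightarrow> bool"
  where
  "C1_curve_on \<A> a b \<gamma> \<longleftrightarrow> (\<forall>c\<in>\<A>. \<exists>D. continuous_on {t\<in>{a..b}. \<gamma> t \<in> fst c} D \<and>
     (\<forall>t\<in>{a..b}. \<gamma> t \<in> fst c \<longrightarrow> (snd c \<circ> \<gamma> has_vector_derivative D t) (at t within {a..b})))"

definition piecewise_C1_path ::
  "('m::topological_space, 'a::euclidean_space) chart set \<Rightarrow> (real \<Rightarrow> 'm) \<Rightarrow> bool" where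
  "piecewise_C1_path \<A> \<gamma> \<longleftrightarrow> path \<gamma> \<and>
     (\<exists>S. finite S \<and> {0, 1} \<subseteq> S \<and> S \<subseteq> {0..1} \<and>
        (\<forall>a\<in>S. \<forall>b\<in>S. a < b \<and> S \<inter> {a<..<b} = {} \<longrightarrow> C1_curve_on \<A> a b \<gamma>))"

definition velocity ::
  "('m, 'a::euclidean_space) chart set \<Rightarrow> (real \<Rightarrow> 'm) \<Rightarrow> real \<Rightarrow> ('m, 'a) tvec" where
  "velocity \<A> \<gamma> t =
     (\<lambda>c. if c \<in> \<A> \<and> \<gamma> t \<in> fst c then vector_derivative (snd c \<circ> \<gamma>) (at t) else 0)"

definition path_len ::
  "('m, 'a::euclidean_space) chart set \<Rightarrow> ('m, 'a) metric \<Rightarrow> (real \<Rightarrow> 'm) \<Rightarrow> real" where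
  "path_len \<A> g \<gamma> = integral {0..1} (\<lambda>t. sqrt (g (\<gamma> t) (velocity \<A> \<gamma> t) (velocity \<A> \<gamma> t)))"

text \<open>The distance takes the value \<open>\<infinity>\<close> exactly between different connected components.\<close>

definition riem_dist :: "('m::topological_space, 'a::euclidean_space) chart set \<Rightarrow>
    ('m, 'a) metric \<Rightarrow> 'm \<Rightarrow> 'm \<Rightarrow> ereal" where
  "riem_dist \<A> g x y =
     (INF \<gamma>\<in>{\<gamma>. piecewise_C1_path \<A> \<gamma> \<and> pathstart \<gamma> = x \<and> pathfinish \<gamma> = y}. ereal (path_len \<A> g \<gamma>))"

definition complete_riemannian :: "('m::topological_space, 'a::euclidean_space) chart set \<Rightarrow>
    ('m, 'a) metric \<Rightarrow> bool" where
  "complete_riemannian \<A> g \<longleftrightarrow> (\<forall>X :: nat \<Rightarrow> 'm.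
     (\<forall>e>0. \<exists>N. \<forall>m\<ge>N. \<forall>n\<ge>N. riem_dist \<A> g (X m) (X n) < ereal e) \<longrightarrow>
     (\<exists>x. (\<lambda>n. riem_dist \<A> g (X n) x) \<longlonglongrightarrow> 0))"

definition riem_bounded :: "('m::topological_space, 'a::euclidean_space) chart set \<Rightarrow>
    ('m, 'a) metric \<Rightarrow> 'm set \<Rightarrow> bool" where
  "riem_bounded \<A> g S \<longleftrightarrow> (\<exists>K::real. \<forall>x\<in>S. \<forall>y\<in>S. riem_dist \<A> g x y \<le> ereal K)"

definition C2_near :: "('m::topological_space, 'a::euclidean_space) chart set \<Rightarrow>
    'm \<Rightarrow> ('m \<Rightarrow> real) \<Rightarrow> bool" where
  "C2_near \<A> x \<phi> \<longleftrightarrow> (\<exists>N. open N \<and> x \<in> N \<and>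
     (\<forall>c\<in>\<A>. C_k_on 2 (\<phi> \<circ> chart_inv c) (snd c ` (fst c \<inter> N))))"

text \<open>Differential and Hessian are computed in some chart around \<open>x\<close>; the result does not depend on
  the choice, for \<open>\<phi>\<close> of class \<open>C\<^sup>2\<close> near \<open>x\<close>.\<close>

definition some_chart :: "('m, 'a) chart set \<Rightarrow> 'm \<Rightarrow> ('m, 'a) chart" where
  "some_chart \<A> x = (SOME c. c \<in> \<A> \<and> x \<in> fst c)"

definition differential ::
  "('m, 'a::euclidean_space) chart set \<Rightarrow> ('m \<Rightarrow> real) \<Rightarrow> 'm \<Rightarrow> ('m, 'a) tvec \<Rightarrow> real" where
  "differential \<A> \<phi> x \<xi> =
     (let c = some_chart \<A> x in frechet_derivative (\<phi> \<circ> chart_inv c) (at (snd c x)) (\<xi> c))"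

text \<open>\<open>christoffel \<A> g c p v w\<close> is the vector with components
  \<open>\<Gamma>\<^sup>k\<^sub>i\<^sub>j v\<^sup>i w\<^sup>j\<close>, where \<open>g\<^sub>k\<^sub>l \<Gamma>\<^sup>k\<^sub>i\<^sub>j = (\<partial>\<^sub>i g\<^sub>j\<^sub>l + \<partial>\<^sub>j g\<^sub>i\<^sub>l - \<partial>\<^sub>l g\<^sub>i\<^sub>j) / 2\<close>.\<close>

definition christoffel :: "('m, 'a::euclidean_space) chart set \<Rightarrow> ('m, 'a) metric \<Rightarrow>
    ('m, 'a) chart \<Rightarrow> 'a \<Rightarrow> 'a \<Rightarrow> 'a \<Rightarrow> 'a" where
  "christoffel \<A> g c p v w = (THE z. \<forall>u. metric_coord \<A> g c p z u =
     (frechet_derivative (\<lambda>q. metric_coord \<A> g c q w u) (at p) v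
      + frechet_derivative (\<lambda>q. metric_coord \<A> g c q v u) (at p) w
      - frechet_derivative (\<lambda>q. metric_coord \<A> g c q v w) (at p) u) / 2)"

text \<open>In coordinates, \<open>d\<^sup>2\<phi>(\<xi>,\<eta>) = (\<partial>\<^sub>i\<partial>\<^sub>j\<phi> - \<Gamma>\<^sup>k\<^sub>i\<^sub>j \<partial>\<^sub>k\<phi>) \<xi>\<^sup>i \<eta>\<^sup>j\<close>.\<close>

definition hessian :: "('m, 'a::euclidean_space) chart set \<Rightarrow> ('m, 'a) metric \<Rightarrow>
    ('m \<Rightarrow> real) \<Rightarrow> 'm \<Rightarrow> ('m, 'a) form" where
  "hessian \<A> g \<phi> x \<xi> \<eta> =
     (if \<xi> \<in> tangent_space \<A> x \<and> \<eta> \<in> tangent_space \<A> x then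
        let c = some_chart \<A> x; p = snd c x; h = \<phi> \<circ> chart_inv c in
        frechet_derivative (\<lambda>q. frechet_derivative h (at q) (\<eta> c)) (at p) (\<xi> c)
        - frechet_derivative h (at p) (christoffel \<A> g c p (\<xi> c) (\<eta> c))
      else 0)"


section \<open>The domain of second-order equations\<close>

type_synonym ('m, 'a) jet = "'m \<times> real \<times> ('m, 'a) tvec \<times> ('m, 'a) form"

definition jet_space :: "('m, 'a::euclidean_space) chart set \<Rightarrow> ('m, 'a) jet set" where
  "jet_space \<A> = {(x, r, \<zeta>, A). \<zeta> \<in> tangent_space \<A> x \<and> A \<in> sym_forms \<A> x}"

text \<open>\<open>jet_space\<close> is a vector bundle over the product of the manifold with the real line. It has the
  bundle topology, in which the local trivialisations given by the charts are homeomorphisms onto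
  open subsets.\<close>

definition triv_dom :: "('m, 'a::euclidean_space) chart \<Rightarrow>
    ('a \<times> real \<times> 'a \<times> ('a \<Rightarrow>\<^sub>L 'a \<Rightarrow>\<^sub>L real)) set" where
  "triv_dom c = {(p, r, z, B). p \<in> chart_image c \<and>
     (\<forall>v w. blinfun_apply (blinfun_apply B v) w = blinfun_apply (blinfun_apply B w) v)}"

definition triv :: "('m, 'a::euclidean_space) chart set \<Rightarrow> ('m, 'a) chart \<Rightarrow>
    'a \<times> real \<times> 'a \<times> ('a \<Rightarrow>\<^sub>L 'a \<Rightarrow>\<^sub>L real) \<Rightarrow> ('m, 'a) jet" where
  "triv \<A> c = (\<lambda>(p, r, z, B).
     (chart_inv c p, r, tangent_vector \<A> c (chart_inv c p) z,
      \<lambda>\<xi> \<eta>. if \<xi> \<in> tangent_space \<A> (chart_inv c p) \<and> \<eta> \<in> tangent_space \<A> (chart_inv c p)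
            then blinfun_apply (blinfun_apply B (\<xi> c)) (\<eta> c) else 0))"

definition jet_topology :: "('m, 'a::euclidean_space) chart set \<Rightarrow> ('m, 'a) jet topology" where
  "jet_topology \<A> = topology (\<lambda>S. S \<subseteq> jet_space \<A> \<and>
     (\<forall>c\<in>\<A>. openin (top_of_set (triv_dom c)) (triv_dom c \<inter> triv \<A> c -` S)))"

lemma openin_jet_topology:
  "openin (jet_topology \<A>) S \<longleftrightarrow> S \<subseteq> jet_space \<A> \<and>
     (\<forall>c\<in>\<A>. openin (top_of_set (triv_dom c)) (triv_dom c \<inter> triv \<A> c -` S))"
proof -
  have eq: "triv_dom c \<inter> triv \<A> c -` \<Union>K = (\<Union>T\<in>K. triv_dom c \<inter> triv \<A> c -` T)"
    for c :: "('a, 'b) chart" and K by auto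
  have eq2: "triv_dom c \<inter> triv \<A> c -` (S \<inter> T)
      = (triv_dom c \<inter> triv \<A> c -` S) \<inter> (triv_dom c \<inter> triv \<A> c -` T)"
    for c :: "('a, 'b) chart" and S T by auto
  have "istopology (\<lambda>S. S \<subseteq> jet_space \<A> \<and>
     (\<forall>c\<in>\<A>. openin (top_of_set (triv_dom c)) (triv_dom c \<inter> triv \<A> c -` S)))"
    unfolding istopology_def eq eq2 by (blast intro: openin_Int openin_Union)
  then show ?thesis
    by (simp add: jet_topology_def)
qed

definition degenerate_elliptic ::
  "('m, 'a::euclidean_space) chart set \<Rightarrow> (('m, 'a) jet \<Rightarrow> real) \<Rightarrow> bool" where
  "degenerate_elliptic \<A> F \<longleftrightarrow>
     (\<forall>x r. \<forall>\<zeta>\<in>tangent_space \<A> x. \<forall>A\<in>sym_forms \<A> x. \<forall>B\<in>sym_forms \<A> x.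
        form_le \<A> x A B \<longrightarrow> F (x, r, \<zeta>, B) \<le> F (x, r, \<zeta>, A))"

definition proper_operator ::
  "('m, 'a::euclidean_space) chart set \<Rightarrow> (('m, 'a) jet \<Rightarrow> real) \<Rightarrow> bool" where
  "proper_operator \<A> F \<longleftrightarrow> degenerate_elliptic \<A> F \<and>
     (\<forall>x r s. \<forall>\<zeta>\<in>tangent_space \<A> x. \<forall>A\<in>sym_forms \<A> x.
        r \<le> s \<longrightarrow> F (x, r, \<zeta>, A) \<le> F (x, s, \<zeta>, A))"


section \<open>Viscosity solutions\<close>

text \<open>The differential of \<open>\<phi>\<close> enters as the tangent vector \<open>\<zeta>\<close> that represents it via the metric.
  The jets at a point of an open set \<open>\<Omega>\<close> only depend on the restriction of \<open>u\<close> to \<open>\<Omega>\<close>.\<close>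

definition superjet :: "('m::topological_space, 'a::euclidean_space) chart set \<Rightarrow>
    ('m, 'a) metric \<Rightarrow> ('m \<Rightarrow> real) \<Rightarrow> 'm \<Rightarrow> (('m, 'a) tvec \<times> ('m, 'a) form) set" where
  "superjet \<A> g u x = {(\<zeta>, A). \<exists>\<phi>. C2_near \<A> x \<phi> \<and>
     (\<forall>\<^sub>F y in nhds x. u y - \<phi> y \<le> u x - \<phi> x) \<and>
     \<zeta> \<in> tangent_space \<A> x \<and> (\<forall>\<xi>\<in>tangent_space \<A> x. g x \<zeta> \<xi> = differential \<A> \<phi> x \<xi>) \<and>
     A = hessian \<A> g \<phi> x}"

definition subjet :: "('m::topological_space, 'a::euclidean_space) chart set \<Rightarrow>
    ('m, 'a) metric \<Rightarrow> ('m \<Rightarrow> real) \<Rightarrow> 'm \<Rightarrow> (('m, 'a) tvec \<times> ('m, 'a) form) set" where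
  "subjet \<A> g u x = {(\<zeta>, A). \<exists>\<phi>. C2_near \<A> x \<phi> \<and>
     (\<forall>\<^sub>F y in nhds x. u x - \<phi> x \<le> u y - \<phi> y) \<and>
     \<zeta> \<in> tangent_space \<A> x \<and> (\<forall>\<xi>\<in>tangent_space \<A> x. g x \<zeta> \<xi> = differential \<A> \<phi> x \<xi>) \<and>
     A = hessian \<A> g \<phi> x}"

definition viscosity_subsolution :: "('m::topological_space, 'a::euclidean_space) chart set \<Rightarrow>
    ('m, 'a) metric \<Rightarrow> (('m, 'a) jet \<Rightarrow> real) \<Rightarrow> 'm set \<Rightarrow> ('m \<Rightarrow> real) \<Rightarrow> bool" where
  "viscosity_subsolution \<A> g F \<Omega> u \<longleftrightarrow>
     (\<forall>x\<in>\<Omega>. \<forall>(\<zeta>, A)\<in>superjet \<A> g u x. F (x, u x, \<zeta>, A) \<le> 0)"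

definition viscosity_supersolution :: "('m::topological_space, 'a::euclidean_space) chart set \<Rightarrow>
    ('m, 'a) metric \<Rightarrow> (('m, 'a) jet \<Rightarrow> real) \<Rightarrow> 'm set \<Rightarrow> ('m \<Rightarrow> real) \<Rightarrow> bool" where
  "viscosity_supersolution \<A> g F \<Omega> u \<longleftrightarrow>
     (\<forall>x\<in>\<Omega>. \<forall>(\<zeta>, A)\<in>subjet \<A> g u x. 0 \<le> F (x, u x, \<zeta>, A))"

definition usc_on :: "'m::topological_space set \<Rightarrow> ('m \<Rightarrow> real) \<Rightarrow> bool" where
  "usc_on S u \<longleftrightarrow> (\<forall>x\<in>S. \<forall>a>u x. \<forall>\<^sub>F y in at x within S. u y < a)"

definition lsc_on :: "'m::topological_space set \<Rightarrow> ('m \<Rightarrow> real) \<Rightarrow> bool" where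
  "lsc_on S u \<longleftrightarrow> (\<forall>x\<in>S. \<forall>a<u x. \<forall>\<^sub>F y in at x within S. a < u y)"

definition DP_subsolution :: "('m::topological_space, 'a::euclidean_space) chart set \<Rightarrow>
    ('m, 'a) metric \<Rightarrow> (('m, 'a) jet \<Rightarrow> real) \<Rightarrow> 'm set \<Rightarrow> ('m \<Rightarrow> real) \<Rightarrow> ('m \<Rightarrow> real) \<Rightarrow> bool" where
  "DP_subsolution \<A> g F \<Omega> f w \<longleftrightarrow>
     usc_on (closure \<Omega>) w \<and> viscosity_subsolution \<A> g F \<Omega> w \<and> (\<forall>x\<in>frontier \<Omega>. w x \<le> f x)"

definition DP_supersolution :: "('m::topological_space, 'a::euclidean_space) chart set \<Rightarrow>
    ('m, 'a) metric \<Rightarrow> (('m, 'a) jet \<Rightarrow> real) \<Rightarrow> 'm set \<Rightarrow> ('m \<Rightarrow> real) \<Rightarrow> ('m \<Rightarrow> real) \<Rightarrow> bool" where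
  "DP_supersolution \<A> g F \<Omega> f v \<longleftrightarrow>
     lsc_on (closure \<Omega>) v \<and> viscosity_supersolution \<A> g F \<Omega> v \<and> (\<forall>x\<in>frontier \<Omega>. f x \<le> v x)"

definition DP_solution :: "('m::topological_space, 'a::euclidean_space) chart set \<Rightarrow>
    ('m, 'a) metric \<Rightarrow> (('m, 'a) jet \<Rightarrow> real) \<Rightarrow> 'm set \<Rightarrow> ('m \<Rightarrow> real) \<Rightarrow> ('m \<Rightarrow> real) \<Rightarrow> bool" where
  "DP_solution \<A> g F \<Omega> f u \<longleftrightarrow> DP_subsolution \<A> g F \<Omega> f u \<and> DP_supersolution \<A> g F \<Omega> f u"

text \<open>The envelopes are extended-real valued, since \<open>u\<close> need not be locally bounded.\<close>

definition upper_envelope :: "('m::topological_space, 'a::euclidean_space) chart set \<Rightarrow>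
    ('m, 'a) metric \<Rightarrow> 'm set \<Rightarrow> ('m \<Rightarrow> real) \<Rightarrow> 'm \<Rightarrow> ereal" where
  "upper_envelope \<A> g \<Omega> u x =
     Lim (at_right (0::real)) (\<lambda>r. SUP y\<in>{y\<in>\<Omega>. riem_dist \<A> g y x \<le> ereal r}. ereal (u y))"

definition lower_envelope :: "('m::topological_space, 'a::euclidean_space) chart set \<Rightarrow>
    ('m, 'a) metric \<Rightarrow> 'm set \<Rightarrow> ('m \<Rightarrow> real) \<Rightarrow> 'm \<Rightarrow> ereal" where
  "lower_envelope \<A> g \<Omega> u x =
     Lim (at_right (0::real)) (\<lambda>r. INF y\<in>{y\<in>\<Omega>. riem_dist \<A> g y x \<le> ereal r}. ereal (u y))"

end

theory Submission
  imports Defs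
begin

text \<open>By comparison, \<open>W\<close> coincides with any solution of the Dirichlet problem, so it suffices to construct
  one, and this is done by Perron's method. Comparison functions are only semicontinuous and may be
  unbounded near interior points, so neither envelope of \<open>W\<close> is obviously finite. Therefore Perron's
  method is run between the barriers \<open>max u_low (-n)\<close> and \<open>min u_up n\<close>; its output \<open>P n\<close> has a
  subsolution as upper envelope where that exceeds \<open>-n\<close> and a supersolution as lower envelope where
  that is below \<open>n\<close>. If the upper envelope reached \<open>n\<close> for arbitrarily large \<open>n\<close>, the relaxed limits of
  \<open>P n - n + R\<close>, glued to \<open>u_low\<close>, would be subsolutions with arbitrarily large values at one point,
  against comparison. This needs \<open>closure \<Omega>\<close> to be compact, which is the Hopf-Rinow theorem. The case of
  the lower envelope is dual, and for large \<open>n\<close> comparison gives that \<open>P n\<close> is a solution.\<close>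

section \<open>Semicontinuous envelopes\<close>

text \<open>Comparison speaks only about real-valued functions, which shapes every limit taken here.
  Truncation makes all envelopes finite, at the price that the truncated barriers satisfy their
  inequalities only on one side of the level; all later statements therefore carry such a threshold.
  A relaxed limit of the shifted functions would be -infinity wherever they stay bounded; its
  maximum with \<open>u_low\<close> is real. The shift by \<open>n - R\<close> is downward for large
  \<open>n\<close>, so it respects subsolutions exactly because \<open>F\<close> is nondecreasing in
  its value argument. The envelope conditions on the frontier are what bound all \<open>P n\<close>
  near it independently of \<open>n\<close>: there the relaxed limit lies below
  \<open>u_low\<close>, so the glued function keeps the boundary values \<open>f\<close> and is
  admissible in comparison. Stability under such limits needs strict extrema. They are produced by
  the fourth power of a coordinate distance, which leaves value, gradient and Hessian at the centre
  unchanged.\<close>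

definition usc_at :: "('m::topological_space \<Rightarrow> real) \<Rightarrow> 'm \<Rightarrow> bool" where
  "usc_at u x \<longleftrightarrow> (\<forall>a>u x. \<forall>\<^sub>F y in nhds x. u y < a)"

text \<open>Upper semicontinuous regularization, phrased with neighbourhoods so that no distance
  enters. Each neighbourhood contains \<open>x\<close> itself, hence \<open>h x\<close> is a lower
  bound of the set. Without a local upper bound the set is empty and its real \<open>Inf\<close>
  says nothing, which is why many lemmas below assume a global bound \<open>B\<close>.\<close>

definition usc_env :: "('m::topological_space \<Rightarrow> real) \<Rightarrow> 'm \<Rightarrow> real" where
  "usc_env h x = Inf {a. \<forall>\<^sub>F y in nhds x. h y \<le> a}"

definition lsc_env :: "('m::topological_space \<Rightarrow> real) \<Rightarrow> 'm \<Rightarrow> real" where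
  "lsc_env h x = - usc_env (\<lambda>y. - h y) x"

lemma usc_atD: "usc_at u x \<Longrightarrow> u x < a \<Longrightarrow> \<forall>\<^sub>F y in nhds x. u y < a"
  by (auto simp: usc_at_def)

text \<open>The definitions of semicontinuity use the punctured filter. Passing to
  \<open>nhds\<close> lets them combine with open neighbourhoods and with
  \<open>eventually_eventually\<close>.\<close>

lemma eventually_nhds_within_iff:
  "(\<forall>\<^sub>F y in at x within S. Q y) \<and> (x \<in> S \<longrightarrow> Q x) \<longleftrightarrow> (\<forall>\<^sub>F y in nhds x. y \<in> S \<longrightarrow> Q y)"
proof (cases "x \<in> S")
  case True
  have "(\<forall>\<^sub>F y in nhds x. y \<in> S \<longrightarrow> Q y)" if "\<forall>\<^sub>F y in nhds x. y \<noteq> x \<longrightarrow> y \<in> S \<longrightarrow> Q y" "Q x"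
    using that(1) by (rule eventually_mono) (use that(2) in blast)
  moreover have "\<forall>\<^sub>F y in nhds x. y \<noteq> x \<longrightarrow> y \<in> S \<longrightarrow> Q y" if "\<forall>\<^sub>F y in nhds x. y \<in> S \<longrightarrow> Q y"
    using that by (rule eventually_mono) blast
  ultimately show ?thesis
    using True eventually_nhds_x_imp_x[of "\<lambda>y. y \<in> S \<longrightarrow> Q y" x] by (auto simp: eventually_at_filter)
next
  case False
  then have "(y \<noteq> x \<longrightarrow> y \<in> S \<longrightarrow> Q y) \<longleftrightarrow> (y \<in> S \<longrightarrow> Q y)" for y by auto
  with False show ?thesis by (simp add: eventually_at_filter)
qed

lemma usc_on_iff: "usc_on S u \<longleftrightarrow> (\<forall>x\<in>S. \<forall>a>u x. \<forall>\<^sub>F y in nhds x. y \<in> S \<longrightarrow> u y < a)"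
  unfolding usc_on_def
  by (auto simp: eventually_nhds_within_iff[symmetric])

lemma lsc_on_iff: "lsc_on S u \<longleftrightarrow> usc_on S (\<lambda>y. - u y)"
proof -
  have "(\<forall>a<u x. \<forall>\<^sub>F y in at x within S. a < u y)
      \<longleftrightarrow> (\<forall>a>- u x. \<forall>\<^sub>F y in at x within S. - u y < a)" (is "?L \<longleftrightarrow> ?R") for x
  proof
    assume L: ?L
    show ?R
    proof (intro allI impI)
      fix a assume "- u x < a"
      then have "- a < u x" by simp
      with L have "\<forall>\<^sub>F y in at x within S. - a < u y" by blast
      then show "\<forall>\<^sub>F y in at x within S. - u y < a" by eventually_elim simp
    qed
  next
    assume R: ?R
    show ?L
    proof (intro allI impI)
      fix a assume "a < u x"
      then have "- u x < - a" by simp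
      with R have "\<forall>\<^sub>F y in at x within S. - u y < - a" by blast
      then show "\<forall>\<^sub>F y in at x within S. a < u y" by eventually_elim simp
    qed
  qed
  then show ?thesis by (simp add: usc_on_def lsc_on_def)
qed

lemma usc_on_imp_usc_at:
  assumes "usc_on S u" "open V" "x \<in> V" "V \<subseteq> S"
  shows "usc_at u x"
  unfolding usc_at_def
proof (intro allI impI)
  fix a assume "u x < a"
  then have "\<forall>\<^sub>F y in nhds x. y \<in> S \<longrightarrow> u y < a" using assms by (auto simp: usc_on_iff)
  moreover have "\<forall>\<^sub>F y in nhds x. y \<in> V" using assms by (simp add: eventually_nhds_in_open)
  ultimately show "\<forall>\<^sub>F y in nhds x. u y < a"
    by eventually_elim (use assms in auto)
qed

lemma usc_env_le:
  assumes "\<forall>\<^sub>F y in nhds x. h y \<le> a"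
  shows "usc_env h x \<le> a"
  unfolding usc_env_def
proof (rule cInf_lower)
  show "bdd_below {a. \<forall>\<^sub>F y in nhds x. h y \<le> a}"
    by (rule bdd_belowI[of _ "h x"]) (auto dest: eventually_nhds_x_imp_x)
qed (use assms in simp)

lemma usc_env_lessD:
  assumes "\<And>y. h y \<le> B" "usc_env h x < a"
  shows "\<forall>\<^sub>F y in nhds x. h y < a"
proof -
  have "{a. \<forall>\<^sub>F y in nhds x. h y \<le> a} \<noteq> {}" using assms by (auto intro!: exI[of _ B])
  from cInf_lessD[OF this assms(2)[unfolded usc_env_def]] obtain b
    where "\<forall>\<^sub>F y in nhds x. h y \<le> b" "b < a" by auto
  then show ?thesis by (auto elim: eventually_mono)
qed

lemma usc_env_upper:
  assumes "\<And>y. h y \<le> B"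
  shows "h x \<le> usc_env h x"
proof (rule ccontr)
  assume "\<not> ?thesis"
  then have "\<forall>\<^sub>F y in nhds x. h y < h x" using usc_env_lessD[of h B x "h x"] assms by auto
  then show False by (auto dest: eventually_nhds_x_imp_x)
qed

lemma usc_at_usc_env:
  assumes "\<And>y. h y \<le> B"
  shows "usc_at (usc_env h) x"
  unfolding usc_at_def
proof (intro allI impI)
  fix a assume "usc_env h x < a"
  then obtain b where b: "usc_env h x < b" "b < a" using dense by blast
  have "\<forall>\<^sub>F y in nhds x. \<forall>\<^sub>F z in nhds y. h z < b"
    using usc_env_lessD[of h B, OF assms b(1)] by (simp add: eventually_eventually)
  then show "\<forall>\<^sub>F y in nhds x. usc_env h y < a"
  proof (rule eventually_mono)
    fix y assume "\<forall>\<^sub>F z in nhds y. h z < b"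
    then have "usc_env h y \<le> b" by (intro usc_env_le) (auto elim: eventually_mono)
    then show "usc_env h y < a" using b by simp
  qed
qed

lemma usc_env_greaterD: "a < usc_env h x \<Longrightarrow> \<exists>\<^sub>F y in nhds x. a < h y"
  using usc_env_le[of h a x] by (auto simp: frequently_def not_less)

lemma usc_env_cong: "\<forall>\<^sub>F y in nhds x. h y = k y \<Longrightarrow> usc_env h x = usc_env k x"
  unfolding usc_env_def
  by (rule arg_cong[where f = Inf], rule Collect_cong, rule eventually_cong)
     (auto elim: eventually_mono)

lemma usc_env_mono:
  assumes "\<And>y. k y \<le> B" "\<forall>\<^sub>F y in nhds x. h y \<le> k y"
  shows "usc_env h x \<le> usc_env k x"
proof (rule dense_ge)
  fix a assume "usc_env k x < a"
  from usc_env_lessD[OF assms(1) this] assms(2) show "usc_env h x \<le> a"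
    by (intro usc_env_le) (auto elim: eventually_elim2)
qed

lemma usc_env_eq:
  assumes "usc_at h x"
  shows "usc_env h x = h x"
proof (rule antisym)
  show "usc_env h x \<le> h x"
  proof (rule dense_ge)
    fix a assume "h x < a"
    from usc_atD[OF assms this] show "usc_env h x \<le> a"
      by (intro usc_env_le) (auto elim: eventually_mono)
  qed
  have ne: "{a. \<forall>\<^sub>F y in nhds x. h y \<le> a} \<noteq> {}"
    using usc_atD[OF assms, of "h x + 1"] by (auto elim: eventually_mono intro!: exI[of _ "h x + 1"])
  show "h x \<le> usc_env h x"
    unfolding usc_env_def by (rule cInf_greatest[OF ne]) (auto dest: eventually_nhds_x_imp_x)
qed

text \<open>Computes the envelope of a bump inserted into the Perron supremum: the continuous part
  is its own envelope, and the eventual upper bounds of a maximum are the common ones.\<close>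

lemma usc_env_max_continuous:
  assumes "\<And>y. h y \<le> B" "isCont p x" "\<forall>\<^sub>F y in nhds x. U y = max (h y) (p y)"
  shows "usc_env U x = max (usc_env h x) (p x)"
proof (rule antisym)
  show "usc_env U x \<le> max (usc_env h x) (p x)"
  proof (rule dense_ge)
    fix a assume a: "max (usc_env h x) (p x) < a"
    then have "\<forall>\<^sub>F y in nhds x. p y < a"
      using assms(2) by (auto simp: continuous_at tendsto_at_iff_tendsto_nhds dest: order_tendstoD)
    moreover have "\<forall>\<^sub>F y in nhds x. h y < a" using a usc_env_lessD[of h B] assms by auto
    ultimately have "\<forall>\<^sub>F y in nhds x. U y \<le> a" using assms(3) by eventually_elim auto
    then show "usc_env U x \<le> a" by (rule usc_env_le)
  qed
  show "max (usc_env h x) (p x) \<le> usc_env U x"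
  proof (rule dense_ge)
    fix a assume a: "usc_env U x < a"
    \<comment> \<open>\<open>U\<close> has no global bound, so a local one must be found before the
      infimum in \<open>usc_env U x\<close> can be used.\<close>
    have "\<forall>\<^sub>F y in nhds x. p y < p x + 1"
      using assms(2) order_tendstoD(2)[of p "p x" "nhds x" "p x + 1"]
      by (auto simp: continuous_at tendsto_at_iff_tendsto_nhds)
    then have "\<forall>\<^sub>F y in nhds x. U y \<le> max B (p x + 1)"
      using assms(3) by eventually_elim (auto simp: le_max_iff_disj intro: assms(1) order_trans)
    then have ne: "{a. \<forall>\<^sub>F y in nhds x. U y \<le> a} \<noteq> {}" by auto
    obtain b where b: "\<forall>\<^sub>F y in nhds x. U y \<le> b" "b < a"
      using cInf_lessD[OF ne a[unfolded usc_env_def]] by auto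
    have "\<forall>\<^sub>F y in nhds x. h y \<le> b" using b(1) assms(3) by eventually_elim auto
    then have "usc_env h x \<le> b" by (rule usc_env_le)
    moreover have "\<forall>\<^sub>F y in nhds x. p y \<le> b" using b(1) assms(3) by eventually_elim auto
    then have "p x \<le> b" by (rule eventually_nhds_x_imp_x)
    ultimately show "max (usc_env h x) (p x) \<le> a" using b by auto
  qed
qed

text \<open>If no point were a maximum, every \<open>x\<close> would have a better point
  \<open>s x\<close>, and the sets where \<open>u\<close> stays below \<open>u (s x)\<close> would
  cover \<open>K\<close>. In a finite subcover the best of the points \<open>s x\<close> would
  itself be beaten.\<close>

lemma usc_attains_max:
  assumes "compact K" "K \<noteq> {}" "usc_on K u"
  shows "\<exists>x\<in>K. \<forall>y\<in>K. u y \<le> u x"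
proof (rule ccontr)
  assume neg: "\<not> ?thesis"
  have "\<forall>x\<in>K. \<exists>y\<in>K. u x < u y" using neg by (meson not_le)
  then obtain s where s: "\<And>x. x \<in> K \<Longrightarrow> s x \<in> K \<and> u x < u (s x)" by metis
  have "\<forall>x\<in>K. \<exists>V. open V \<and> x \<in> V \<and> (\<forall>y\<in>V \<inter> K. u y < u (s x))"
  proof
    fix x assume x: "x \<in> K"
    then have "\<forall>\<^sub>F y in nhds x. y \<in> K \<longrightarrow> u y < u (s x)" using s assms(3) by (simp add: usc_on_iff)
    then show "\<exists>V. open V \<and> x \<in> V \<and> (\<forall>y\<in>V \<inter> K. u y < u (s x))" unfolding eventually_nhds by blast
  qed
  then obtain V where V: "\<And>x. x \<in> K \<Longrightarrow> open (V x) \<and> x \<in> V x \<and> (\<forall>y\<in>V x \<inter> K. u y < u (s x))"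
    by metis
  obtain C where C: "C \<subseteq> K" "finite C" "K \<subseteq> (\<Union>x\<in>C. V x)"
    using compactE_image[OF assms(1), of K V] V by blast
  have "C \<noteq> {}" using C assms(2) by auto
  with C(2) have "Max ((\<lambda>x. u (s x)) ` C) \<in> (\<lambda>x. u (s x)) ` C" by auto
  then obtain c where "c \<in> C" "u (s c) = Max ((\<lambda>x. u (s x)) ` C)" by force
  with C(2) have c: "c \<in> C" "\<And>x. x \<in> C \<Longrightarrow> u (s x) \<le> u (s c)" by auto
  have sc: "s c \<in> K" using s c C by auto
  then obtain d where "d \<in> C" "s c \<in> V d" using C by auto
  then have "u (s c) < u (s d)" using V C sc by auto
  then show False using c \<open>d \<in> C\<close> by force
qed

lemma usc_on_compact_bounded_above: "compact K \<Longrightarrow> usc_on K u \<Longrightarrow> \<exists>B. \<forall>x\<in>K. u x \<le> B"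
  using usc_attains_max[of K u] by (cases "K = {}") auto

text \<open>Compactness turns positivity of the penalty away from its zero into a uniform gap
  outside a neighbourhood.\<close>

lemma positive_lower_bound:
  fixes \<theta> :: "'m::t2_space \<Rightarrow> real"
  assumes "compact K" "continuous_on K \<theta>" "open V" "x \<in> V" "\<And>y. y \<in> K - {x} \<Longrightarrow> 0 < \<theta> y"
  shows "\<exists>\<delta>>0. \<forall>y\<in>K - V. \<delta> \<le> \<theta> y"
proof (cases "K - V = {}")
  case False
  have "compact (K - V)" using assms by (simp add: compact_diff)
  from continuous_attains_inf[OF this False continuous_on_subset[OF assms(2)]]
  obtain z where z: "z \<in> K - V" "\<forall>y\<in>K - V. \<theta> z \<le> \<theta> y" by auto
  then have "0 < \<theta> z" using assms by auto
  with z show ?thesis by blast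
qed (auto intro: exI[of _ 1])

section \<open>Perron's method for abstract test functions\<close>

text \<open>\<open>T x \<phi>\<close> means that \<open>\<phi>\<close> is an admissible test function at \<open>x\<close>, and \<open>G \<phi> x r\<close> is the value of the
  operator at \<open>(x, r, d\<phi>(x), d\<^sup>2\<phi>(x))\<close>. This makes the passage from sub- to supersolutions a formal
  duality.\<close>

locale elliptic_test =
  fixes T :: "'m::t2_space \<Rightarrow> ('m \<Rightarrow> real) \<Rightarrow> bool"
    and G :: "('m \<Rightarrow> real) \<Rightarrow> 'm \<Rightarrow> real \<Rightarrow> real"
  assumes T_uminus: "T x \<phi> \<Longrightarrow> T x (\<lambda>y. - \<phi> y)"
    and T_nhds: "T x \<phi> \<Longrightarrow> \<forall>\<^sub>F y in nhds x. T y \<phi>"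
    and T_isCont: "T x \<phi> \<Longrightarrow> isCont \<phi> x"
    and G_tendsto: "T x \<phi> \<Longrightarrow> ((\<lambda>(y, s). G \<phi> y s) \<longlongrightarrow> G \<phi> x r) (nhds x \<times>\<^sub>F nhds r)"
    and G_elliptic: "T x \<phi> \<Longrightarrow> T x \<psi> \<Longrightarrow> \<forall>\<^sub>F y in nhds x. \<phi> y - \<psi> y \<le> \<phi> x - \<psi> x \<Longrightarrow> G \<psi> x r \<le> G \<phi> x r"
    and G_mono: "T x \<phi> \<Longrightarrow> r \<le> s \<Longrightarrow> G \<phi> x r \<le> G \<phi> x s"
    and penalty: "open N \<Longrightarrow> x \<in> N \<Longrightarrow> \<exists>\<theta> K. compact K \<and> K \<subseteq> N \<and> x \<in> interior K \<and>
      continuous_on K \<theta> \<and> \<theta> x = 0 \<and> (\<forall>y\<in>K - {x}. 0 < \<theta> y) \<and>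
      (\<forall>\<phi> s. T x \<phi> \<longrightarrow> T x (\<lambda>y. \<phi> y + s * \<theta> y) \<and> (\<forall>r. G (\<lambda>y. \<phi> y + s * \<theta> y) x r = G \<phi> x r))"
begin

definition sub_at :: "('m \<Rightarrow> real) \<Rightarrow> 'm \<Rightarrow> bool" where
  "sub_at u x \<longleftrightarrow>
     (\<forall>\<phi>. T x \<phi> \<longrightarrow> (\<forall>\<^sub>F y in nhds x. u y - \<phi> y \<le> u x - \<phi> x) \<longrightarrow> G \<phi> x (u x) \<le> 0)"

definition super_at :: "('m \<Rightarrow> real) \<Rightarrow> 'm \<Rightarrow> bool" where
  "super_at u x \<longleftrightarrow>
     (\<forall>\<phi>. T x \<phi> \<longrightarrow> (\<forall>\<^sub>F y in nhds x. u x - \<phi> x \<le> u y - \<phi> y) \<longrightarrow> 0 \<le> G \<phi> x (u x))"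

text \<open>Negating functions exchanges maxima and minima, and the negations in the operator
  compensate each other in both monotonicity properties, so all axioms survive; the penalty axiom is
  applied with \<open>-s\<close>. Every result on subsolutions thus has a version for
  supersolutions.\<close>

lemma dual: "elliptic_test T (\<lambda>\<phi> x r. - G (\<lambda>y. - \<phi> y) x (- r))"
proof (unfold_locales, goal_cases)
  case (4 x \<phi> r)
  have "filterlim (\<lambda>p. (fst p, - snd p)) (nhds x \<times>\<^sub>F nhds (- r)) (nhds x \<times>\<^sub>F nhds r)"
    by (intro filterlim_Pair filterlim_fst) (intro tendsto_minus filterlim_snd)
  from filterlim_compose[OF G_tendsto[OF T_uminus[OF 4]] this]
  show ?case by (auto dest!: tendsto_minus simp: case_prod_unfold)
next
  case (5 x \<phi> \<psi> r)
  have "\<forall>\<^sub>F y in nhds x. - \<psi> y - (- \<phi> y) \<le> - \<psi> x - (- \<phi> x)" using 5(3) by eventually_elim auto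
  from G_elliptic[OF T_uminus[OF 5(2)] T_uminus[OF 5(1)] this] show ?case by simp
next
  case (6 x \<phi> r s)
  then show ?case using G_mono[OF T_uminus] by simp
next
  case (7 N x)
  from penalty[OF this] obtain \<theta> K where K: "compact K" "K \<subseteq> N" "x \<in> interior K"
      "continuous_on K \<theta>" "\<theta> x = 0" "\<forall>y\<in>K - {x}. 0 < \<theta> y" and
      *: "\<And>\<phi> s. T x \<phi> \<Longrightarrow> T x (\<lambda>y. \<phi> y + s * \<theta> y) \<and> (\<forall>r. G (\<lambda>y. \<phi> y + s * \<theta> y) x r = G \<phi> x r)"
    by blast
  have "- G (\<lambda>y. - (\<phi> y + s * \<theta> y)) x (- r) = - G (\<lambda>y. - \<phi> y) x (- r)" if "T x \<phi>" for \<phi> s r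
    using *[OF T_uminus[OF that], of "- s"] by simp
  then show ?case
    by (intro exI[of _ \<theta>] exI[of _ K] conjI K allI impI) (auto dest: *)
qed (auto intro: T_uminus T_nhds T_isCont)

lemma sub_at_cong:
  assumes "\<forall>\<^sub>F y in nhds x. u y = v y" "sub_at v x"
  shows "sub_at u x"
  unfolding sub_at_def
proof (intro allI impI)
  fix \<phi> assume \<phi>: "T x \<phi>" "\<forall>\<^sub>F y in nhds x. u y - \<phi> y \<le> u x - \<phi> x"
  have uv: "u x = v x" using assms(1) by (rule eventually_nhds_x_imp_x)
  have "\<forall>\<^sub>F y in nhds x. v y - \<phi> y \<le> v x - \<phi> x"
    using \<phi>(2) assms(1) by eventually_elim (simp add: uv)
  then show "G \<phi> x (u x) \<le> 0" using assms(2) \<phi> uv by (auto simp: sub_at_def)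
qed

text \<open>A test function touching the larger \<open>u\<close> from above also touches
  \<open>v\<close>, because the two values at \<open>x\<close> agree.\<close>

lemma sub_at_dominating:
  assumes "\<forall>\<^sub>F y in nhds x. v y \<le> u y" "u x = v x" "sub_at v x"
  shows "sub_at u x"
  unfolding sub_at_def
proof (intro allI impI)
  fix \<phi> assume \<phi>: "T x \<phi>" "\<forall>\<^sub>F y in nhds x. u y - \<phi> y \<le> u x - \<phi> x"
  have "\<forall>\<^sub>F y in nhds x. v y - \<phi> y \<le> v x - \<phi> x"
    using \<phi>(2) assms(1) by eventually_elim (simp add: assms(2))
  then show "G \<phi> x (u x) \<le> 0" using assms \<phi> by (auto simp: sub_at_def)
qed

text \<open>Monotonicity in the value enters here: subsolutions may be shifted down, but in general
  not up.\<close>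

lemma sub_at_minus_const:
  assumes "sub_at u x" "0 \<le> c"
  shows "sub_at (\<lambda>y. u y - c) x"
  unfolding sub_at_def
proof (intro allI impI)
  fix \<phi> assume \<phi>: "T x \<phi>" "\<forall>\<^sub>F y in nhds x. u y - c - \<phi> y \<le> u x - c - \<phi> x"
  have "\<forall>\<^sub>F y in nhds x. u y - \<phi> y \<le> u x - \<phi> x" using \<phi>(2) by eventually_elim simp
  then have "G \<phi> x (u x) \<le> 0" using assms \<phi> by (auto simp: sub_at_def)
  then show "G \<phi> x (u x - c) \<le> 0" using G_mono[OF \<phi>(1), of "u x - c" "u x"] assms(2) by simp
qed

lemma G_negative_nhds:
  assumes "T x \<phi>" "G \<phi> x r < 0"
  shows "\<exists>e>0. \<forall>\<^sub>F y in nhds x. T y \<phi> \<and> (\<forall>s. \<bar>s - r\<bar> < e \<longrightarrow> G \<phi> y s < 0)"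
proof -
  have "\<forall>\<^sub>F p in nhds x \<times>\<^sub>F nhds r. (\<lambda>(y, s). G \<phi> y s) p < 0"
    using order_tendstoD(2)[OF G_tendsto[OF assms(1)] assms(2)] .
  then obtain Pf Pg where P: "\<forall>\<^sub>F y in nhds x. Pf y" "\<forall>\<^sub>F s in nhds r. Pg s"
     "\<And>y s. Pf y \<Longrightarrow> Pg s \<Longrightarrow> G \<phi> y s < 0"
    unfolding eventually_prod_filter by auto
  from P(2) obtain e where "e > 0" "\<And>s. dist s r < e \<Longrightarrow> Pg s"
    unfolding eventually_nhds_metric by auto
  with P T_nhds[OF assms(1)] show ?thesis
    by (intro exI[of _ e]) (auto elim: eventually_elim2 simp: dist_real_def)
qed

lemma G_positive_nhds:
  assumes "T x \<phi>" "0 < G \<phi> x r"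
  shows "\<exists>e>0. \<forall>\<^sub>F y in nhds x. T y \<phi> \<and> (\<forall>s. \<bar>s - r\<bar> < e \<longrightarrow> 0 < G \<phi> y s)"
proof -
  interpret dual: elliptic_test T "\<lambda>\<phi> x r. - G (\<lambda>y. - \<phi> y) x (- r)" by (rule dual)
  from dual.G_negative_nhds[OF T_uminus[OF assms(1)], of "- r"] assms(2)
  obtain e where e: "e > 0" "\<forall>\<^sub>F y in nhds x. T y (\<lambda>y. - \<phi> y) \<and> (\<forall>s. \<bar>s - (- r)\<bar> < e \<longrightarrow> - G (\<lambda>y. - (- \<phi> y)) y (- s) < 0)"
    by auto
  have "\<forall>\<^sub>F y in nhds x. T y \<phi> \<and> (\<forall>s. \<bar>s - r\<bar> < e \<longrightarrow> 0 < G \<phi> y s)"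
    using e(2) T_nhds[OF assms(1)]
  proof eventually_elim
    case (elim y)
    have "0 < G \<phi> y s" if "\<bar>s - r\<bar> < e" for s
      using elim(1)[THEN conjunct2, rule_format, of "- s"] that by (simp add: abs_minus_commute)
    with elim show ?case by auto
  qed
  with e(1) show ?thesis by blast
qed

text \<open>The penalty makes the maximum strict without changing the value of the operator, so the maximum
  points of \<open>h - \<phi>'\<close> are close to \<open>x\<close> when \<open>h\<close> is almost below \<open>z\<close> and almost reaches \<open>z x\<close>.\<close>

lemma stability:
  assumes N0: "open N0" "x \<in> N0" and a0: "a0 < z x"
    and \<phi>: "T x \<phi>" and touch: "\<forall>\<^sub>F y in nhds x. z y - \<phi> y \<le> z x - \<phi> x"
    and approx: "\<And>K b a N. compact K \<Longrightarrow> K \<subseteq> N0 \<Longrightarrow> continuous_on K b \<Longrightarrow> (\<And>y. y \<in> K \<Longrightarrow> z y < b y) \<Longrightarrow>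
        a < z x \<Longrightarrow> open N \<Longrightarrow> x \<in> N \<Longrightarrow>
        \<exists>h. (\<exists>y\<in>N. a < h y) \<and> (\<forall>y\<in>K. h y < b y) \<and> (\<forall>y\<in>K. usc_at h y) \<and>
            (\<forall>y\<in>K. a0 < h y \<longrightarrow> sub_at h y)"
  shows "G \<phi> x (z x) \<le> 0"
proof (rule ccontr)
  assume "\<not> ?thesis"
  then have pos: "0 < G \<phi> x (z x)" by simp
  define c where "c = z x - \<phi> x"
  have "\<forall>\<^sub>F y in nhds x. isCont \<phi> y"
    using T_nhds[OF \<phi>] by eventually_elim (rule T_isCont)
  moreover have "\<forall>\<^sub>F y in nhds x. y \<in> N0" using N0 by (simp add: eventually_nhds_in_open)
  ultimately have "\<forall>\<^sub>F y in nhds x. isCont \<phi> y \<and> y \<in> N0 \<and> z y - \<phi> y \<le> z x - \<phi> x"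
    using touch by eventually_elim auto
  then obtain V where V: "open V" "x \<in> V"
      "\<And>y. y \<in> V \<Longrightarrow> isCont \<phi> y \<and> y \<in> N0 \<and> z y - \<phi> y \<le> z x - \<phi> x"
    unfolding eventually_nhds by blast
  obtain \<theta> K where K: "compact K" "K \<subseteq> V" "x \<in> interior K" "continuous_on K \<theta>" "\<theta> x = 0"
      "\<forall>y\<in>K - {x}. 0 < \<theta> y"
    and \<theta>: "\<And>s. T x (\<lambda>y. \<phi> y + s * \<theta> y)" "\<And>s r. G (\<lambda>y. \<phi> y + s * \<theta> y) x r = G \<phi> x r"
    using penalty[OF V(1,2)] \<phi> by blast
  define \<phi>' where "\<phi>' = (\<lambda>y. \<phi> y + \<theta> y)"
  have T': "T x \<phi>'" and G': "0 < G \<phi>' x (z x)" using \<theta>[of 1] pos by (simp_all add: \<phi>'_def)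
  obtain e1 where e1: "e1 > 0" "\<forall>\<^sub>F y in nhds x. T y \<phi>' \<and> (\<forall>s. \<bar>s - z x\<bar> < e1 \<longrightarrow> 0 < G \<phi>' y s)"
    using G_positive_nhds[OF T' G'] by blast
  \<comment> \<open>Values within \<open>e\<close> of \<open>z x\<close> keep the operator positive
    on the test function and stay above \<open>a0\<close>, where the approximating functions are
    known to be subsolutions.\<close>
  define e where "e = min e1 (z x - a0)"
  have e: "e > 0" "e \<le> e1" "a0 \<le> z x - e" using e1 a0 by (auto simp: e_def)
  have "(\<phi>' \<longlongrightarrow> \<phi>' x) (nhds x)"
    using T_isCont[OF T'] by (simp add: continuous_at tendsto_at_iff_tendsto_nhds)
  moreover have "\<phi>' x = \<phi> x" using K(5) by (simp add: \<phi>'_def)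
  ultimately have near: "\<forall>\<^sub>F y in nhds x. \<bar>\<phi>' y - \<phi> x\<bar> < d" if "d > 0" for d
    using that by (auto dest!: tendstoD[of _ _ _ d] simp: dist_real_def)
  have "\<forall>\<^sub>F y in nhds x. y \<in> interior K" using K(3) by (simp add: eventually_nhds_in_open)
  then have "\<forall>\<^sub>F y in nhds x. y \<in> interior K \<and> \<bar>\<phi>' y - \<phi> x\<bar> < e / 2 \<and>
      T y \<phi>' \<and> (\<forall>s. \<bar>s - z x\<bar> < e1 \<longrightarrow> 0 < G \<phi>' y s)"
    using near[of "e / 2"] e(1) e1(2) by (auto elim: eventually_elim2 intro: eventually_conj)
  then obtain N2 where N2: "open N2" "x \<in> N2"
      "\<And>y. y \<in> N2 \<Longrightarrow> y \<in> interior K \<and> \<bar>\<phi>' y - \<phi> x\<bar> < e / 2 \<and> T y \<phi>' \<and>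
         (\<forall>s. \<bar>s - z x\<bar> < e1 \<longrightarrow> 0 < G \<phi>' y s)"
    unfolding eventually_nhds by blast
  obtain \<delta> where \<delta>: "\<delta> > 0" "\<And>y. y \<in> K - N2 \<Longrightarrow> \<delta> \<le> \<theta> y"
    using positive_lower_bound[OF K(1,4) N2(1,2)] K(6) by blast
  \<comment> \<open>Chosen so that a maximum point of \<open>h - \<phi>'\<close> has penalty below
    \<open>3 * \<epsilon> < \<delta>\<close>, which forces it into \<open>N2\<close>, and so that
    the error \<open>2 * \<epsilon>\<close> in the maximum plus the variation \<open>e / 2\<close>
    of the test function is at most \<open>e\<close>.\<close>
  define \<epsilon> where "\<epsilon> = min \<delta> e / 4"
  have \<epsilon>: "\<epsilon> > 0" "3 * \<epsilon> < \<delta>" "2 * \<epsilon> \<le> e / 2" using \<delta> e by (auto simp: \<epsilon>_def)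
  obtain N where N: "open N" "x \<in> N" "\<And>y. y \<in> N \<Longrightarrow> y \<in> N2 \<and> \<bar>\<phi>' y - \<phi> x\<bar> < \<epsilon>"
  proof -
    have "\<forall>\<^sub>F y in nhds x. y \<in> N2 \<and> \<bar>\<phi>' y - \<phi> x\<bar> < \<epsilon>"
      using near[OF \<epsilon>(1)] N2(1,2) by (auto intro: eventually_conj simp: eventually_nhds_in_open)
    then show ?thesis unfolding eventually_nhds using that by blast
  qed
  have KN0: "K \<subseteq> N0" using K(2) V(3) by blast
  have cont: "continuous_on K (\<lambda>y. \<phi> y + c + \<epsilon>)"
    using K(2) V(3) by (intro continuous_intros continuous_at_imp_continuous_on) blast
  have "z y < \<phi> y + c + \<epsilon>" if "y \<in> K" for y
    using V(3)[of y] K(2) that \<epsilon>(1) by (auto simp: c_def)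
  from approx[OF K(1) KN0 cont this, of "z x - \<epsilon>" N] N \<epsilon>(1)
  obtain h y0 where h: "y0 \<in> N" "z x - \<epsilon> < h y0" "\<And>y. y \<in> K \<Longrightarrow> h y < \<phi> y + c + \<epsilon>"
      "\<And>y. y \<in> K \<Longrightarrow> usc_at h y" "\<And>y. y \<in> K \<Longrightarrow> a0 < h y \<Longrightarrow> sub_at h y"
    by auto
  have y0: "y0 \<in> K" using N(3)[OF h(1)] N2(3) interior_subset by blast
  have T'cont: "continuous_on K \<phi>'"
    unfolding \<phi>'_def using K(2) V(3)
    by (intro continuous_intros K(4) continuous_at_imp_continuous_on) blast
  have "usc_on K (\<lambda>w. h w - \<phi>' w)"
    unfolding usc_on_iff
  proof (intro ballI allI impI)
    fix y a assume y: "y \<in> K" and a: "h y - \<phi>' y < a"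
    define d where "d = (a - (h y - \<phi>' y)) / 2"
    have d: "d > 0" using a by (simp add: d_def)
    have "\<forall>\<^sub>F w in nhds y. h w < h y + d" using usc_atD[OF h(4)[OF y]] d by simp
    moreover have "\<forall>\<^sub>F w in nhds y. w \<in> K \<longrightarrow> \<phi>' y - d < \<phi>' w"
      using T'cont y d unfolding continuous_on_def
      by (auto dest!: bspec order_tendstoD(1)[of _ _ _ "\<phi>' y - d"]
          simp: eventually_nhds_within_iff[symmetric])
    ultimately show "\<forall>\<^sub>F w in nhds y. w \<in> K \<longrightarrow> h w - \<phi>' w < a"
      by eventually_elim (auto simp: d_def field_simps)
  qed
  with K(1) y0 have "\<exists>y\<in>K. \<forall>w\<in>K. h w - \<phi>' w \<le> h y - \<phi>' y"
    by (intro usc_attains_max) auto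
  then obtain y where y: "y \<in> K" "\<And>w. w \<in> K \<Longrightarrow> h w - \<phi>' w \<le> h y - \<phi>' y" by blast
  have "c - 2 * \<epsilon> < h y0 - \<phi>' y0" using h(2) N(3)[OF h(1)] by (auto simp: c_def)
  with y(2)[OF y0] have lo: "c - 2 * \<epsilon> < h y - \<phi>' y" by simp
  with h(3)[OF y(1)] have "\<theta> y < 3 * \<epsilon>" by (simp add: \<phi>'_def)
  with \<epsilon>(2) \<delta>(2)[of y] y(1) have yN2: "y \<in> N2" by force
  have "0 \<le> \<theta> y" using K(5) K(6)[rule_format, of y] y(1) by (cases "y = x") auto
  with h(3)[OF y(1)] have hi: "h y - \<phi>' y < c + \<epsilon>" by (simp add: \<phi>'_def)
  have "\<bar>\<phi>' y - \<phi> x\<bar> < e / 2" using N2(3)[OF yN2] by blast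
  with lo hi \<epsilon> have hy: "\<bar>h y - z x\<bar> < e" unfolding c_def by linarith
  have "\<forall>\<^sub>F w in nhds y. w \<in> interior K" using N2(3)[OF yN2] by (simp add: eventually_nhds_in_open)
  then have max: "\<forall>\<^sub>F w in nhds y. h w - \<phi>' w \<le> h y - \<phi>' y"
    by eventually_elim (use y(2) interior_subset in blast)
  have "a0 < h y" using hy e(3) by linarith
  then have "G \<phi>' y (h y) \<le> 0" using h(5)[OF y(1)] max N2(3)[OF yN2] by (auto simp: sub_at_def)
  moreover have "0 < G \<phi>' y (h y)" using N2(3)[OF yN2] hy e(2) by force
  ultimately show False by simp
qed

text \<open>Any value below the envelope of \<open>P\<close> is exceeded at a nearby point by a
  single member \<open>h\<close>, whose own envelope lies below that of \<open>P\<close>; this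
  envelope is the approximation that \<open>stability\<close> asks for.\<close>

lemma sub_at_usc_env_Sup:
  assumes "open \<Omega>" "x \<in> \<Omega>" and ne: "S \<noteq> {}" and bd: "\<And>h y. h \<in> S \<Longrightarrow> h y \<le> B"
    and sub: "\<And>h y. h \<in> S \<Longrightarrow> y \<in> \<Omega> \<Longrightarrow> m < usc_env h y \<Longrightarrow> sub_at (usc_env h) y"
    and P: "P = (\<lambda>y. SUP h\<in>S. h y)" and x: "m < usc_env P x"
  shows "sub_at (usc_env P) x"
  unfolding sub_at_def
proof (intro allI impI)
  fix \<phi> assume \<phi>: "T x \<phi>" and touch: "\<forall>\<^sub>F y in nhds x. usc_env P y - \<phi> y \<le> usc_env P x - \<phi> x"
  have bdP: "P y \<le> B" for y unfolding P using ne bd by (intro cSUP_least) auto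
  have leP: "h y \<le> P y" if "h \<in> S" for h y
    unfolding P using that bd by (intro cSUP_upper) (auto intro!: bdd_aboveI[of _ B])
  show "G \<phi> x (usc_env P x) \<le> 0"
  proof (rule stability[OF assms(1,2) x \<phi> touch], goal_cases)
    case (1 K b a N)
    have "\<exists>\<^sub>F y in nhds x. a < P y" using 1(5) by (rule usc_env_greaterD)
    moreover have "\<forall>\<^sub>F y in nhds x. y \<in> N" using 1 by (simp add: eventually_nhds_in_open)
    ultimately have "\<exists>\<^sub>F y in nhds x. a < P y \<and> y \<in> N" by (rule frequently_eventually_conj[THEN frequently_elim1]) auto
    then obtain y where y: "y \<in> N" "a < P y" by (auto dest: frequently_ex)
    have "bdd_above ((\<lambda>h. h y) ` S)" using bd by (auto intro!: bdd_aboveI[of _ B])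
    from y(2)[unfolded P less_cSUP_iff[OF ne this]] obtain h where h: "h \<in> S" "a < h y" by blast
    have "usc_env h w \<le> usc_env P w" for w by (rule usc_env_mono[of P B]) (use bdP leP h in auto)
    moreover have "h y \<le> usc_env h y" using usc_env_upper[of h B] bd h by auto
    moreover have "usc_at (usc_env h) w" for w using usc_at_usc_env[of h B] bd h by auto
    moreover have "sub_at (usc_env h) w" if "w \<in> K" "m < usc_env h w" for w
      using sub[OF h(1)] that 1(2) by blast
    ultimately show ?case
      using y h 1(4) by (intro exI[of _ "usc_env h"]) (force intro: le_less_trans less_le_trans)
  qed
qed

text \<open>Perron's bump argument. Where the supersolution test fails, the test function, slightly
  raised and cut off, is a strict subsolution; its maximum with \<open>P\<close> is again in
  \<open>S\<close> and exceeds \<open>P\<close> somewhere, contradicting maximality. The strict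
  inequality \<open>lsc_env P x < u x\<close> leaves room below the upper barrier.\<close>

lemma super_at_lsc_env_maximal:
  assumes \<Omega>: "open \<Omega>" "x \<in> \<Omega>"
    and S: "S = {h. (\<forall>y. l y \<le> h y \<and> h y \<le> u y) \<and> (\<forall>y\<in>\<Omega>. m < usc_env h y \<longrightarrow> sub_at (usc_env h) y)}"
    and u: "\<And>y. u y \<le> B" and l: "\<And>y. A \<le> l y"
    and P: "P \<in> S" "\<And>h y. h \<in> S \<Longrightarrow> h y \<le> P y"
    and x: "\<And>a. a < u x \<Longrightarrow> \<forall>\<^sub>F y in nhds x. a < u y" "lsc_env P x < u x"
  shows "super_at (lsc_env P) x"
  unfolding super_at_def
proof (intro allI impI)
  fix \<phi> assume \<phi>: "T x \<phi>" and touch: "\<forall>\<^sub>F y in nhds x. lsc_env P x - \<phi> x \<le> lsc_env P y - \<phi> y"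
  define L where "L = lsc_env P"
  have Pl: "l y \<le> P y" "P y \<le> u y" for y using P(1) by (auto simp: S)
  have PB: "P y \<le> B" for y using Pl(2)[of y] u[of y] by simp
  have "- P y \<le> - A" for y using Pl(1)[of y] l[of y] by simp
  from usc_env_upper[of "\<lambda>y. - P y", OF this] have LP: "L y \<le> P y" for y
    unfolding L_def lsc_env_def by (simp add: minus_le_iff)
  show "0 \<le> G \<phi> x (lsc_env P x)"
  proof (rule ccontr)
    assume "\<not> ?thesis"
    then have neg: "G \<phi> x (L x) < 0" by (simp add: L_def)
    define c where "c = L x - \<phi> x"
    have "\<forall>\<^sub>F y in nhds x. y \<in> \<Omega>" using \<Omega> by (simp add: eventually_nhds_in_open)
    then have "\<forall>\<^sub>F y in nhds x. y \<in> \<Omega> \<and> \<phi> y + c \<le> L y"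
      using touch by eventually_elim (auto simp: c_def L_def)
    then obtain V where V: "open V" "x \<in> V" "\<And>y. y \<in> V \<Longrightarrow> y \<in> \<Omega> \<and> \<phi> y + c \<le> L y"
      unfolding eventually_nhds by blast
    obtain \<theta> K where K: "compact K" "K \<subseteq> V" "x \<in> interior K" "continuous_on K \<theta>" "\<theta> x = 0"
        "\<forall>y\<in>K - {x}. 0 < \<theta> y"
      and \<theta>: "\<And>s. T x (\<lambda>y. \<phi> y + s * \<theta> y)" "\<And>s r. G (\<lambda>y. \<phi> y + s * \<theta> y) x r = G \<phi> x r"
      using penalty[OF V(1,2)] \<phi> by blast
    \<comment> \<open>Subtracting the penalty makes the raised function drop below \<open>P\<close>
      away from \<open>x\<close>.\<close>
    define \<phi>' where "\<phi>' = (\<lambda>y. \<phi> y - \<theta> y)"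
    have T': "T x \<phi>'" and G': "G \<phi>' x (L x) < 0" using \<theta>[of "-1"] neg by (simp_all add: \<phi>'_def)
    obtain e1 where e1: "e1 > 0" "\<forall>\<^sub>F y in nhds x. T y \<phi>' \<and> (\<forall>s. \<bar>s - L x\<bar> < e1 \<longrightarrow> G \<phi>' y s < 0)"
      using G_negative_nhds[OF T' G'] by blast
    define e where "e = min e1 ((u x - L x) / 2)"
    have e: "e > 0" "e \<le> e1" "L x + e < u x" using e1 x(2) by (auto simp: e_def L_def min_def field_simps)
    have "(\<phi>' \<longlongrightarrow> \<phi>' x) (nhds x)"
      using T_isCont[OF T'] by (simp add: continuous_at tendsto_at_iff_tendsto_nhds)
    moreover have "\<phi>' x = \<phi> x" using K(5) by (simp add: \<phi>'_def)
  ultimately have near: "\<forall>\<^sub>F y in nhds x. \<bar>\<phi>' y - \<phi> x\<bar> < d" if "d > 0" for d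
      using that by (auto dest!: tendstoD[of _ _ _ d] simp: dist_real_def)
    have "\<forall>\<^sub>F y in nhds x. y \<in> interior K" using K(3) by (simp add: eventually_nhds_in_open)
    moreover have "\<forall>\<^sub>F y in nhds x. \<bar>\<phi>' y - \<phi> x\<bar> < e / 2" using near[of "e / 2"] e(1) by simp
    ultimately have "\<forall>\<^sub>F y in nhds x. y \<in> interior K \<and> \<bar>\<phi>' y - \<phi> x\<bar> < e / 2 \<and>
        T y \<phi>' \<and> (\<forall>s. \<bar>s - L x\<bar> < e1 \<longrightarrow> G \<phi>' y s < 0) \<and> L x + e < u y"
      using e1(2) x(1)[OF e(3)] by eventually_elim blast
    then obtain N2 where N2: "open N2" "x \<in> N2"
        "\<And>y. y \<in> N2 \<Longrightarrow> y \<in> interior K \<and> \<bar>\<phi>' y - \<phi> x\<bar> < e / 2 \<and> T y \<phi>' \<and>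
           (\<forall>s. \<bar>s - L x\<bar> < e1 \<longrightarrow> G \<phi>' y s < 0) \<and> L x + e < u y"
      unfolding eventually_nhds by blast
    obtain \<delta> where \<delta>: "\<delta> > 0" "\<And>y. y \<in> K - N2 \<Longrightarrow> \<delta> \<le> \<theta> y"
      using positive_lower_bound[OF K(1,4) N2(1,2)] K(6) by blast
    \<comment> \<open>\<open>\<eta> < \<delta> / 2\<close> puts the bump \<open>\<psi>\<close>
      strictly below \<open>P\<close> at the points of \<open>K\<close> whose penalty exceeds
      \<open>\<delta> / 2\<close>; \<open>\<eta> \<le> e / 4\<close> keeps it within
      \<open>e\<close> of \<open>L x\<close> on \<open>N2\<close>, hence below the upper barrier and
      in the range where the operator is negative.\<close>
    define \<eta> where "\<eta> = min \<delta> e / 4"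
    have \<eta>: "\<eta> > 0" "\<eta> < \<delta> / 2" "\<eta> \<le> e / 4" using \<delta> e by (auto simp: \<eta>_def)
    define \<psi> where "\<psi> = (\<lambda>y. \<phi>' y + c + \<eta>)"
    define C where "C = {y \<in> K. \<theta> y \<le> \<delta> / 2}"
    have "closed (K \<inter> \<theta> -` {..\<delta> / 2})"
      using K(1,4) by (intro continuous_closed_preimage) (auto intro: compact_imp_closed)
    also have "K \<inter> \<theta> -` {..\<delta> / 2} = C" by (auto simp: C_def)
    finally have "closed C" .
    have CN2: "C \<subseteq> N2" using \<delta> by (force simp: C_def)
    \<comment> \<open>The cut is made at the closed set \<open>C\<close> inside \<open>N2\<close>,
      so that off \<open>N2\<close> the function agrees with \<open>P\<close> near each point. On
      \<open>N2\<close> it is still the full maximum, because \<open>\<psi>\<close> is below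
      \<open>P\<close> on \<open>N2\<close> outside \<open>C\<close>.\<close>
    define U where "U = (\<lambda>y. if y \<in> C then max (P y) (\<psi> y) else P y)"
    have U_N2: "U y = max (P y) (\<psi> y)" if "y \<in> N2" for y
    proof (cases "y \<in> C")
      case False
      have yK: "y \<in> K" using N2(3)[OF that] interior_subset by blast
      then have "\<delta> / 2 < \<theta> y" using False by (auto simp: C_def)
      then have "\<psi> y < \<phi> y + c" using \<eta> by (simp add: \<psi>_def \<phi>'_def)
      also have "\<dots> \<le> P y" using V(3)[of y] K(2) yK LP[of y] by force
      finally show ?thesis using False by (simp add: U_def)
    qed (simp add: U_def)
    have \<psi>L: "\<bar>\<psi> y - L x\<bar> < e" if "y \<in> N2" for y
    proof -
      have "\<bar>\<phi>' y - \<phi> x\<bar> < e / 2" using N2(3)[OF that] by blast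
      then show ?thesis using \<eta> e unfolding \<psi>_def c_def by linarith
    qed
    have \<psi>u: "\<psi> y < u y" if "y \<in> N2" for y using \<psi>L[OF that] N2(3)[OF that] by force
    have \<psi>sub: "G \<phi>' y (\<psi> y) < 0" if "y \<in> N2" for y using \<psi>L[OF that] N2(3)[OF that] e by force
    have env_N2: "usc_env U y = max (usc_env P y) (\<psi> y)" if "y \<in> N2" for y
    proof (rule usc_env_max_continuous[OF PB])
      show "isCont \<psi> y" unfolding \<psi>_def using T_isCont N2(3)[OF that] by (intro continuous_intros) auto
      have "\<forall>\<^sub>F w in nhds y. w \<in> N2" using that N2(1) by (simp add: eventually_nhds_in_open)
      then show "\<forall>\<^sub>F w in nhds y. U w = max (P w) (\<psi> w)" by eventually_elim (rule U_N2)
    qed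
    have sub_P: "sub_at (usc_env P) y" if "y \<in> \<Omega>" "m < usc_env P y" for y using P(1) that by (auto simp: S)
    have "sub_at (usc_env U) y" if y: "y \<in> \<Omega>" "m < usc_env U y" for y
    proof (cases "y \<in> N2")
      case False
      then have "y \<in> - C" using CN2 by auto
      then have "\<forall>\<^sub>F w in nhds y. w \<in> - C" using \<open>closed C\<close> by (intro eventually_nhds_in_open) auto
      then have "\<forall>\<^sub>F w in nhds y. \<forall>\<^sub>F v in nhds w. v \<in> - C" by (simp add: eventually_eventually)
      then have ev: "\<forall>\<^sub>F w in nhds y. usc_env U w = usc_env P w"
        by eventually_elim (rule usc_env_cong, auto simp: U_def elim: eventually_mono)
      then have "usc_env U y = usc_env P y" by (rule eventually_nhds_x_imp_x)
      with sub_P[OF y(1)] y(2) ev show ?thesis by (auto intro: sub_at_cong)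
    next
      case True
      then have evN2: "\<forall>\<^sub>F w in nhds y. w \<in> N2" using N2(1) by (simp add: eventually_nhds_in_open)
      show ?thesis
      proof (cases "\<psi> y \<le> usc_env P y")
        case le: True
        then have eq: "usc_env U y = usc_env P y" using env_N2[OF True] by simp
        moreover have "\<forall>\<^sub>F w in nhds y. usc_env P w \<le> usc_env U w"
          using evN2 by eventually_elim (simp add: env_N2)
        ultimately show ?thesis using sub_P[OF y(1)] y(2) by (auto intro: sub_at_dominating)
      next
        case False
        then have eq: "usc_env U y = \<psi> y" using env_N2[OF True] by simp
        show ?thesis
          unfolding sub_at_def
        proof (intro allI impI)
          fix \<omega> assume \<omega>: "T y \<omega>" "\<forall>\<^sub>F w in nhds y. usc_env U w - \<omega> w \<le> usc_env U y - \<omega> y"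
          \<comment> \<open>The envelope of \<open>U\<close> lies above \<open>\<psi>\<close> and
            equals it at \<open>y\<close>, so \<open>\<omega>\<close> touches \<open>\<phi>'\<close>
            from above up to a constant; ellipticity then carries the negative sign over to
            \<open>\<omega>\<close>.\<close>
          have "\<forall>\<^sub>F w in nhds y. \<phi>' w - \<omega> w \<le> \<phi>' y - \<omega> y"
            using \<omega>(2) evN2 by eventually_elim (use eq in \<open>simp add: env_N2 \<psi>_def\<close>)
          from G_elliptic[OF _ \<omega>(1) this, of "\<psi> y"] N2(3)[OF True] \<psi>sub[OF True]
          show "G \<omega> y (usc_env U y) \<le> 0" by (simp add: eq)
        qed
      qed
    qed
    moreover have "l y \<le> U y \<and> U y \<le> u y" for y
      using Pl[of y] \<psi>u[of y] CN2 by (auto simp: U_def)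
    ultimately have "U \<in> S" by (simp add: S)
    then have UP: "U y \<le> P y" for y using P(2) by blast
    \<comment> \<open>By definition of the lower envelope, \<open>P\<close> is below
      \<open>L x + \<eta> / 2\<close> at points arbitrarily near \<open>x\<close>, where the bump is
      higher than that.\<close>
    have freq: "\<exists>\<^sub>F y in nhds x. - L x - \<eta> / 2 < - P y"
      using \<eta>(1) by (intro usc_env_greaterD) (simp add: L_def lsc_env_def)
    have "\<forall>\<^sub>F y in nhds x. y \<in> N2 \<and> L x + \<eta> / 2 < \<psi> y"
    proof -
      have "\<forall>\<^sub>F y in nhds x. \<bar>\<phi>' y - \<phi> x\<bar> < \<eta> / 2" using near[of "\<eta> / 2"] \<eta>(1) by simp
      then show ?thesis
        using eventually_nhds_in_open[OF N2(1,2)]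
      proof eventually_elim
        case (elim y)
        have "L x + \<eta> / 2 < \<psi> y" using elim(1) unfolding \<psi>_def c_def by linarith
        with elim(2) show ?case by simp
      qed
    qed
    from frequently_ex[OF frequently_eventually_conj[OF freq this]]
    obtain y where y: "y \<in> N2" "L x + \<eta> / 2 < \<psi> y" "- L x - \<eta> / 2 < - P y" by blast
    have "\<psi> y \<le> P y" using UP[of y] U_N2[OF y(1)] by simp
    with y(2,3) show False by linarith
  qed
qed

end

section \<open>Escape to infinity, and Perron's method with truncation\<close>

lemma compact_cluster_point:
  assumes "compact K" "\<And>k. xx k \<in> K"
  shows "\<exists>x\<in>K. \<forall>Q. eventually Q (nhds x) \<longrightarrow> (\<exists>\<^sub>F k in sequentially. Q (xx k))"
proof -
  \<comment> \<open>Compactness is used through filters: in a general topological space it need not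
    yield convergent subsequences, only cluster points.\<close>
  have "filtermap xx sequentially \<noteq> bot" by (simp add: filtermap_bot_iff)
  moreover have "eventually (\<lambda>x. x \<in> K) (filtermap xx sequentially)"
    using assms(2) by (simp add: eventually_filtermap)
  ultimately obtain x where x: "x \<in> K" "inf (nhds x) (filtermap xx sequentially) \<noteq> bot"
    using assms(1) unfolding compact_filter by blast
  have "\<exists>\<^sub>F k in sequentially. Q (xx k)" if "eventually Q (nhds x)" for Q
  proof (rule ccontr)
    assume "\<not> ?thesis"
    then have "eventually (\<lambda>y. \<not> Q y) (filtermap xx sequentially)"
      by (simp add: frequently_def eventually_filtermap)
    with that have "eventually (\<lambda>_. False) (inf (nhds x) (filtermap xx sequentially))"
      unfolding eventually_inf by blast
    with x(2) show False by (simp add: trivial_limit_def)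
  qed
  with x(1) show ?thesis by blast
qed

context elliptic_test
begin

lemma usc_at_add_const:
  assumes "usc_at u x"
  shows "usc_at (\<lambda>y. u y + c) x"
  unfolding usc_at_def
proof (intro allI impI)
  fix a assume "u x + c < a"
  then have "\<forall>\<^sub>F y in nhds x. u y < a - c" using usc_atD[OF assms, of "a - c"] by simp
  then show "\<forall>\<^sub>F y in nhds x. u y + c < a" by eventually_elim simp
qed

text \<open>If the truncated problems keep touching the level \<open>n\<close>, then the relaxed upper limit of
  \<open>h n - n + R\<close> is a subsolution which equals \<open>-\<infinity>\<close> where the \<open>h n\<close> stay bounded, so that gluing it to \<open>ul\<close>
  gives subsolutions with arbitrarily large values at one point. This uses that \<open>F\<close> is
  nondecreasing in \<open>r\<close>.\<close>

lemma escaping_subsolutions: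
  assumes \<Omega>: "open \<Omega>" "compact (closure \<Omega>)"
    and ul: "usc_on (closure \<Omega>) ul" "\<And>y. y \<in> \<Omega> \<Longrightarrow> sub_at ul y"
    and h_le: "\<And>n y. n \<ge> n1 \<Longrightarrow> h n y \<le> real n"
    and h_usc: "\<And>n y. n \<ge> n1 \<Longrightarrow> usc_at (h n) y"
    and h_sub: "\<And>n y. n \<ge> n1 \<Longrightarrow> y \<in> \<Omega> \<Longrightarrow> - real n < h n y \<Longrightarrow> sub_at (h n) y"
    and bdry: "\<And>x. x \<in> frontier \<Omega> \<Longrightarrow> \<exists>B. \<forall>\<^sub>F y in nhds x. y \<in> \<Omega> \<longrightarrow> (\<forall>n\<ge>n1. h n y \<le> B)"
    and esc: "\<And>N. \<exists>n\<ge>N. \<exists>x\<in>\<Omega>. real n \<le> h n x"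
  shows "\<exists>x\<in>\<Omega>. \<forall>R. \<exists>z. usc_on (closure \<Omega>) z \<and> (\<forall>y\<in>\<Omega>. sub_at z y) \<and>
    (\<forall>y\<in>frontier \<Omega>. z y = ul y) \<and> R \<le> z x"
proof -
  have "\<exists>n x. n \<ge> N \<and> x \<in> \<Omega> \<and> real n \<le> h n x" for N using esc[of N] by blast
  then obtain nn xx where seq: "\<And>N. nn N \<ge> N" "\<And>N. xx N \<in> \<Omega>" "\<And>N. real (nn N) \<le> h (nn N) (xx N)"
    by metis
  \<comment> \<open>The escape points accumulate at \<open>x0\<close>; it is selected before
    \<open>R\<close>, so the same point serves for every height.\<close>
  obtain x0 where x0: "x0 \<in> closure \<Omega>"
      "\<And>Q. eventually Q (nhds x0) \<Longrightarrow> \<exists>\<^sub>F k in sequentially. Q (xx k)"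
    using compact_cluster_point[OF \<Omega>(2), of xx] seq(2) closure_subset by blast
  \<comment> \<open>Near the frontier all \<open>h n\<close> share a bound, whereas
    \<open>h (nn k) (xx k)\<close> is at least \<open>nn k\<close>.\<close>
  have "x0 \<notin> frontier \<Omega>"
  proof
    assume "x0 \<in> frontier \<Omega>"
    from bdry[OF this] obtain B where B: "\<forall>\<^sub>F y in nhds x0. y \<in> \<Omega> \<longrightarrow> (\<forall>n\<ge>n1. h n y \<le> B)" by blast
    obtain k0 where "B < real k0" using reals_Archimedean2 by blast
    have "\<exists>\<^sub>F k in sequentially. xx k \<in> \<Omega> \<longrightarrow> (\<forall>n\<ge>n1. h n (xx k) \<le> B)"
      by (rule x0(2)[OF B])
    then obtain k where k: "k \<ge> max n1 k0" "xx k \<in> \<Omega> \<longrightarrow> (\<forall>n\<ge>n1. h n (xx k) \<le> B)"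
      unfolding frequently_sequentially by blast
    have "nn k \<ge> n1" "k0 \<le> nn k" using k(1) seq(1)[of k] by auto
    then have "real (nn k) \<le> B" using k(2) seq(2,3)[of k] by force
    with \<open>B < real k0\<close> \<open>k0 \<le> nn k\<close> show False by linarith
  qed
  with x0(1) have x0\<Omega>: "x0 \<in> \<Omega>" using \<Omega>(1) by (simp add: frontier_def interior_open)
  have "\<exists>z. usc_on (closure \<Omega>) z \<and> (\<forall>y\<in>\<Omega>. sub_at z y) \<and> (\<forall>y\<in>frontier \<Omega>. z y = ul y) \<and> R \<le> z x0" for R
  proof -
    \<comment> \<open>\<open>Q x a\<close> says that \<open>a\<close> bounds the relaxed upper limit
      of \<open>h n - n + R\<close> at \<open>x\<close>, with one neighbourhood for all large
      \<open>n\<close>. The lower bound \<open>ul x\<close> in \<open>Z x\<close> makes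
      \<open>z\<close> the maximum of \<open>ul\<close> and this limit, real even where the limit is
      -infinity.\<close>
    define Q where "Q = (\<lambda>x a. \<exists>n0\<ge>n1. \<forall>\<^sub>F y in nhds x. \<forall>n\<ge>n0. h n y - real n + R \<le> a)"
    define Z where "Z = (\<lambda>x. {a. ul x \<le> a \<and> Q x a})"
    define z where "z = (\<lambda>x. if x \<in> \<Omega> then Inf (Z x) else ul x)"
    have Z_bdd: "bdd_below (Z x)" for x by (rule bdd_belowI[of _ "ul x"]) (simp add: Z_def)
    have "max (ul x) R \<in> Z x" for x
      unfolding Z_def Q_def using h_le
      by (auto intro!: exI[of _ n1] always_eventually simp: le_max_iff_disj)
    then have Z_ne: "Z x \<noteq> {}" for x by blast
    have Q_mono: "Q x a \<Longrightarrow> a \<le> b \<Longrightarrow> Q x b" for x a b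
      unfolding Q_def by (fast elim: eventually_mono intro: order_trans)
    have z_le: "z x \<le> a" if "x \<in> \<Omega>" "ul x \<le> a" "Q x a" for x a
      using that Z_bdd[of x] by (auto simp: z_def Z_def intro: cInf_lower)
    have z_less: "\<exists>b<a. ul x \<le> b \<and> Q x b" if "x \<in> \<Omega>" "z x < a" for x a
      using cInf_lessD[OF Z_ne, of x a] that by (auto simp: z_def Z_def)
    have ul_z: "ul x \<le> z x" for x
      using Z_ne[of x] by (auto simp: z_def Z_def intro: cInf_greatest)
    have evQ: "\<forall>\<^sub>F y in nhds x. Q y a" if q: "Q x a" for x a
    proof -
      obtain n0 where n0: "n0 \<ge> n1" "\<forall>\<^sub>F y in nhds x. \<forall>n\<ge>n0. h n y - real n + R \<le> a"
        using q unfolding Q_def by blast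
      then have "\<forall>\<^sub>F y in nhds x. \<forall>\<^sub>F y in nhds y. \<forall>n\<ge>n0. h n y - real n + R \<le> a"
        by (simp add: eventually_eventually)
      then show ?thesis unfolding Q_def by eventually_elim (use n0(1) in blast)
    qed
    have ul_usc: "usc_at ul x" if "x \<in> \<Omega>" for x
      using usc_on_imp_usc_at[OF ul(1) \<Omega>(1) that closure_subset] .
    have z_usc: "usc_at z x" if x: "x \<in> \<Omega>" for x
      unfolding usc_at_def
    proof (intro allI impI)
      fix a assume "z x < a"
      from z_less[OF x this] obtain b where b: "b < a" "ul x \<le> b" "Q x b" by blast
      obtain d where d: "b < d" "d < a" using dense[OF b(1)] by blast
      have "\<forall>\<^sub>F y in nhds x. ul y < d" using usc_atD[OF ul_usc[OF x]] b d by simp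
      moreover have "\<forall>\<^sub>F y in nhds x. Q y b" by (rule evQ[OF b(3)])
      moreover have "\<forall>\<^sub>F y in nhds x. y \<in> \<Omega>" using \<Omega>(1) x by (simp add: eventually_nhds_in_open)
      ultimately show "\<forall>\<^sub>F y in nhds x. z y < a"
      proof eventually_elim
        case (elim y)
        then have "z y \<le> d" using d by (intro z_le) (auto intro: Q_mono)
        with d show ?case by simp
      qed
    qed
    \<comment> \<open>A bound for the \<open>h n\<close> independent of \<open>n\<close> sends
      \<open>h n - n + R\<close> below \<open>ul\<close>, so \<open>z\<close> and \<open>ul\<close>
      coincide near the frontier.\<close>
    have z_bdry: "\<forall>\<^sub>F y in nhds x. z y = ul y" if x: "x \<in> frontier \<Omega>" for x
    proof -
      obtain B where B: "\<forall>\<^sub>F y in nhds x. y \<in> \<Omega> \<longrightarrow> (\<forall>n\<ge>n1. h n y \<le> B)" using bdry[OF x] by blast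
      then have "\<forall>\<^sub>F y in nhds x. \<forall>\<^sub>F w in nhds y. w \<in> \<Omega> \<longrightarrow> (\<forall>n\<ge>n1. h n w \<le> B)"
        by (simp add: eventually_eventually)
      then show ?thesis
      proof eventually_elim
        case (elim y)
        show ?case
        proof (cases "y \<in> \<Omega>")
          case True
          then have "\<forall>\<^sub>F w in nhds y. w \<in> \<Omega>" using \<Omega>(1) by (simp add: eventually_nhds_in_open)
          with elim have ev: "\<forall>\<^sub>F w in nhds y. \<forall>n\<ge>n1. h n w \<le> B" by eventually_elim blast
          obtain k where k: "B + R - ul y < real k" using reals_Archimedean2 by blast
          have "\<forall>\<^sub>F w in nhds y. \<forall>n\<ge>max n1 k. h n w - real n + R \<le> ul y"
            using ev
          proof eventually_elim
            case (elim w)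
            show ?case
            proof (intro allI impI)
              fix n assume n: "n \<ge> max n1 k"
              then have "h n w \<le> B" using elim by simp
              moreover have "real k \<le> real n" using n by simp
              ultimately show "h n w - real n + R \<le> ul y" using k by linarith
            qed
          qed
          then have "Q y (ul y)" unfolding Q_def by (intro exI[of _ "max n1 k"]) auto
          then show ?thesis using z_le[OF True, of "ul y"] ul_z[of y] by simp
        qed (simp add: z_def)
      qed
    qed
    have "usc_on (closure \<Omega>) z"
      unfolding usc_on_iff
    proof (intro ballI allI impI)
      fix x a assume x: "x \<in> closure \<Omega>" "z x < a"
      show "\<forall>\<^sub>F y in nhds x. y \<in> closure \<Omega> \<longrightarrow> z y < a"
      proof (cases "x \<in> \<Omega>")
        case True
        from usc_atD[OF z_usc[OF this] x(2)] show ?thesis by eventually_elim simp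
      next
        case False
        then have fr: "x \<in> frontier \<Omega>" using x(1) \<Omega>(1) by (simp add: frontier_def interior_open)
        have "ul x < a" using x(2) False by (simp add: z_def)
        then have "\<forall>\<^sub>F y in nhds x. y \<in> closure \<Omega> \<longrightarrow> ul y < a"
          using ul(1) x(1) unfolding usc_on_iff by blast
        with z_bdry[OF fr] show ?thesis by eventually_elim simp
      qed
    qed
    moreover have "R \<le> z x0"
    proof -
      have "R \<le> a" if "a \<in> Z x0" for a
      proof -
        obtain n0 where n0: "n0 \<ge> n1" "\<forall>\<^sub>F y in nhds x0. \<forall>n\<ge>n0. h n y - real n + R \<le> a"
          using \<open>a \<in> Z x0\<close> unfolding Z_def Q_def by blast
        have "\<exists>\<^sub>F k in sequentially. \<forall>n\<ge>n0. h n (xx k) - real n + R \<le> a"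
          by (rule x0(2)[OF n0(2)])
        then obtain k where k: "k \<ge> n0" "\<forall>n\<ge>n0. h n (xx k) - real n + R \<le> a"
          unfolding frequently_sequentially by blast
        have "h (nn k) (xx k) - real (nn k) + R \<le> a" using k seq(1)[of k] by simp
        then show "R \<le> a" using seq(3)[of k] by linarith
      qed
      then show ?thesis using x0\<Omega> Z_ne by (auto simp: z_def intro: cInf_greatest)
    qed
    moreover have "z y = ul y" if "y \<in> frontier \<Omega>" for y
      using that \<Omega>(1) by (simp add: z_def frontier_def interior_open)
    moreover have "sub_at z x" if x: "x \<in> \<Omega>" for x
    proof (cases "z x \<le> ul x")
      case True
      then show ?thesis
        using ul_z by (intro sub_at_dominating[OF _ _ ul(2)[OF x]] always_eventually) (auto intro: antisym)
    next
      case False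
      then have zx: "ul x < z x" by simp
      show ?thesis
        unfolding sub_at_def
      proof (intro allI impI)
        fix \<phi> assume \<phi>: "T x \<phi>" and touch: "\<forall>\<^sub>F y in nhds x. z y - \<phi> y \<le> z x - \<phi> x"
        \<comment> \<open>Where \<open>z\<close> exceeds \<open>ul\<close> it is a relaxed limit, so
          the shifted \<open>h n\<close> serve as approximations in \<open>stability\<close>; the
          level \<open>z x - 1\<close> keeps them in the range where they are subsolutions.\<close>
        show "G \<phi> x (z x) \<le> 0"
        proof (rule stability[where z = z and ?a0.0 = "z x - 1", OF \<Omega>(1) x _ \<phi> touch], goal_cases)
          case (2 K b a N)
          \<comment> \<open>Each point of \<open>K\<close> has its own threshold \<open>n\<close>
            and neighbourhood; a finite subcover yields a single threshold for the bound
            \<open>b\<close> on all of \<open>K\<close>.\<close>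
          have "\<exists>n W. n \<ge> n1 \<and> open W \<and> y \<in> W \<and> (\<forall>w\<in>W \<inter> K. \<forall>m\<ge>n. h m w - real m + R < b w)" if y: "y \<in> K" for y
          proof -
            have y\<Omega>: "y \<in> \<Omega>" using y 2(2) by blast
            obtain c where c: "c < b y" "Q y c" using z_less[OF y\<Omega> 2(4)[OF y]] by blast
            then obtain n0 where n0: "n0 \<ge> n1" "\<forall>\<^sub>F w in nhds y. \<forall>n\<ge>n0. h n w - real n + R \<le> c"
              unfolding Q_def by blast
            have "(b \<longlongrightarrow> b y) (at y within K)" using 2(3) y by (simp add: continuous_on_def)
            from order_tendstoD(1)[OF this c(1)]
            have "\<forall>\<^sub>F w in nhds y. w \<in> K \<longrightarrow> c < b w"
              using c(1) eventually_nhds_within_iff[of "\<lambda>w. c < b w" y K] by blast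
            with n0(2) have "\<forall>\<^sub>F w in nhds y. w \<in> K \<longrightarrow> (\<forall>m\<ge>n0. h m w - real m + R < b w)"
              by eventually_elim (auto intro: le_less_trans)
            then show ?thesis using n0(1) unfolding eventually_nhds by blast
          qed
          then obtain nK W where W: "\<And>y. y \<in> K \<Longrightarrow> nK y \<ge> n1 \<and> open (W y) \<and> y \<in> W y \<and>
              (\<forall>w\<in>W y \<inter> K. \<forall>m\<ge>nK y. h m w - real m + R < b w)" by metis
          obtain C where C: "C \<subseteq> K" "finite C" "K \<subseteq> (\<Union>y\<in>C. W y)"
            using compactE_image[OF 2(1), of K W] W by blast
          \<comment> \<open>Beyond \<open>k\<close> the shift by \<open>n - R\<close> is downward,
            and shifted values above \<open>z x - 1\<close> come from values of \<open>h n\<close>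
            above \<open>-n\<close>.\<close>
          obtain k where k: "\<bar>R\<bar> + \<bar>z x\<bar> + 1 < real k" using reals_Archimedean2 by blast
          define n0 where "n0 = n1 + k + sum nK C"
          have n0: "n0 \<ge> n1" "n0 \<ge> k" "\<And>y. y \<in> C \<Longrightarrow> n0 \<ge> nK y" 
            using C(2) by (auto simp: n0_def intro: member_le_sum[of _ C nK] order_trans trans_le_add2)
          \<comment> \<open>With \<open>a'\<close> at least \<open>ul x\<close>, the only way for
            \<open>a'\<close> to lie below \<open>z x\<close> is that \<open>Q x a'\<close> fails,
            and this failure supplies an index and a point where the shifted function is
            large.\<close>
          define a' where "a' = max a (ul x)"
          have a': "a' < z x" "ul x \<le> a'" "a \<le> a'" using zx 2(5) by (auto simp: a'_def)
          have "\<not> Q x a'" using z_le[OF x a'(2)] a'(1) by auto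
          then have "\<not> (\<forall>\<^sub>F y in nhds x. \<forall>n\<ge>n0. h n y - real n + R \<le> a')"
            using n0(1) by (auto simp: Q_def)
          then have "\<not> (\<forall>y\<in>N. \<forall>n\<ge>n0. h n y - real n + R \<le> a')"
            using 2(6,7) unfolding eventually_nhds by blast
          then obtain y n where y: "y \<in> N" "n \<ge> n0" "a' < h n y - real n + R" by (auto simp: not_le)
          have n: "n \<ge> n1" "n \<ge> k" using y(2) n0 by auto
          have kn: "\<bar>R\<bar> + \<bar>z x\<bar> + 1 < real n" using k n(2) by linarith
          have sub': "sub_at (\<lambda>y. h n y - real n + R) w" if w: "w \<in> K" "z x - 1 < h n w - real n + R" for w
          proof -
            have "- real n < h n w" using w(2) kn by linarith
            then have "sub_at (h n) w" using h_sub[OF n(1)] w(1) 2(2) by blast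
            from sub_at_minus_const[OF this, of "real n - R"] kn show ?thesis by (simp add: algebra_simps)
          qed
          have lt: "h n w - real n + R < b w" if w: "w \<in> K" for w
          proof -
            obtain y where y': "y \<in> C" "w \<in> W y" using C(3) w by blast
            have "nK y \<le> n" using n0(3)[OF y'(1)] y(2) by simp
            then show ?thesis using W[of y] y' C(1) w by blast
          qed
          have usc': "usc_at (\<lambda>y. h n y - real n + R) w" for w
            using usc_at_add_const[OF h_usc[OF n(1)], where c = "R - real n"] by (simp add: algebra_simps)
          show ?case
            using y a'(3) by (intro exI[of _ "\<lambda>y. h n y - real n + R"])
              (auto intro: lt sub' usc' intro!: bexI[of _ y])
        qed simp
      qed
    qed
    ultimately show ?thesis by blast
  qed
  with x0\<Omega> show ?thesis by blast
qed

lemma super_at_dominated: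
  assumes "\<forall>\<^sub>F y in nhds x. u y \<le> v y" "u x = v x" "super_at v x"
  shows "super_at u x"
  unfolding super_at_def
proof (intro allI impI)
  fix \<phi> assume \<phi>: "T x \<phi>" "\<forall>\<^sub>F y in nhds x. u x - \<phi> x \<le> u y - \<phi> y"
  have "\<forall>\<^sub>F y in nhds x. v x - \<phi> x \<le> v y - \<phi> y"
    using \<phi>(2) assms(1) by eventually_elim (simp add: assms(2))
  then show "0 \<le> G \<phi> x (u x)" using assms \<phi> by (auto simp: super_at_def)
qed

lemma super_at_cong:
  assumes "\<forall>\<^sub>F y in nhds x. u y = v y" "super_at v x"
  shows "super_at u x"
proof (rule super_at_dominated[OF _ _ assms(2)])
  show "\<forall>\<^sub>F y in nhds x. u y \<le> v y" using assms(1) by eventually_elim simp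
  show "u x = v x" using assms(1) by (rule eventually_nhds_x_imp_x)
qed

text \<open>Dictionary for using \<open>escaping_subsolutions\<close> in the dual locale: test
  functions correspond under negation.\<close>

lemma dual_sub_at:
  "elliptic_test.sub_at T (\<lambda>\<phi> x r. - G (\<lambda>y. - \<phi> y) x (- r)) u x \<longleftrightarrow> super_at (\<lambda>y. - u y) x"
proof -
  interpret dual: elliptic_test T "\<lambda>\<phi> x r. - G (\<lambda>y. - \<phi> y) x (- r)" by (rule dual)
  have *: "(\<forall>\<^sub>F y in nhds x. - u x - \<phi> x \<le> - u y - \<phi> y)
      \<longleftrightarrow> (\<forall>\<^sub>F y in nhds x. u y - (- \<phi> y) \<le> u x - (- \<phi> x))" for \<phi>
    by (rule arg_cong[where f = "\<lambda>Q. eventually Q (nhds x)"]) auto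
  show ?thesis
  proof
    assume sub: "dual.sub_at u x"
    show "super_at (\<lambda>y. - u y) x"
      unfolding super_at_def *
    proof (intro allI impI)
      fix \<phi> assume \<phi>: "T x \<phi>" "\<forall>\<^sub>F y in nhds x. u y - (- \<phi> y) \<le> u x - (- \<phi> x)"
      have "- G (\<lambda>y. - (- \<phi> y)) x (- u x) \<le> 0"
        using sub[unfolded dual.sub_at_def, rule_format, OF T_uminus[OF \<phi>(1)] \<phi>(2)] .
      then show "0 \<le> G \<phi> x (- u x)" by simp
    qed
  next
    assume super: "super_at (\<lambda>y. - u y) x"
    show "dual.sub_at u x"
      unfolding dual.sub_at_def
    proof (intro allI impI)
      fix \<phi> assume \<phi>: "T x \<phi>" "\<forall>\<^sub>F y in nhds x. u y - \<phi> y \<le> u x - \<phi> x"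
      then have "\<forall>\<^sub>F y in nhds x. u y - (- (- \<phi> y)) \<le> u x - (- (- \<phi> x))" by simp
      from super[unfolded super_at_def *, rule_format, OF T_uminus[OF \<phi>(1)] this]
      show "- G (\<lambda>y. - \<phi> y) x (- u x) \<le> 0" by simp
    qed
  qed
qed

text \<open>The sub- and supersolution need not be locally bounded, so Perron's method is applied to the
  problems truncated at the levels \<open>-n\<close> and \<open>n\<close>. For large \<open>n\<close> the truncation is not active.\<close>

theorem perron:
  assumes \<Omega>: "open \<Omega>" "compact (closure \<Omega>)"
    and ul: "usc_on (closure \<Omega>) ul" "\<And>y. y \<in> \<Omega> \<Longrightarrow> sub_at ul y"
    and uu: "lsc_on (closure \<Omega>) uu" "\<And>y. y \<in> \<Omega> \<Longrightarrow> super_at uu y"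
    and bd: "\<And>y. y \<in> frontier \<Omega> \<Longrightarrow> ul y = f y \<and> uu y = f y"
    and ul_bd: "\<And>x a. x \<in> frontier \<Omega> \<Longrightarrow> a < f x \<Longrightarrow> \<forall>\<^sub>F y in nhds x. y \<in> \<Omega> \<longrightarrow> a < ul y"
    and uu_bd: "\<And>x a. x \<in> frontier \<Omega> \<Longrightarrow> f x < a \<Longrightarrow> \<forall>\<^sub>F y in nhds x. y \<in> \<Omega> \<longrightarrow> uu y < a"
    and comparison: "\<And>w v. usc_on (closure \<Omega>) w \<Longrightarrow> (\<And>y. y \<in> \<Omega> \<Longrightarrow> sub_at w y) \<Longrightarrow>
      (\<And>y. y \<in> frontier \<Omega> \<Longrightarrow> w y \<le> f y) \<Longrightarrow> lsc_on (closure \<Omega>) v \<Longrightarrow>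
      (\<And>y. y \<in> \<Omega> \<Longrightarrow> super_at v y) \<Longrightarrow> (\<And>y. y \<in> frontier \<Omega> \<Longrightarrow> f y \<le> v y) \<Longrightarrow> \<forall>x\<in>closure \<Omega>. w x \<le> v x"
  shows "\<exists>U. usc_on (closure \<Omega>) U \<and> lsc_on (closure \<Omega>) U \<and>
    (\<forall>y\<in>\<Omega>. sub_at U y \<and> super_at U y) \<and> (\<forall>y\<in>frontier \<Omega>. U y = f y)"
proof -
  interpret dual: elliptic_test T "\<lambda>\<phi> x r. - G (\<lambda>y. - \<phi> y) x (- r)" by (rule dual)
  have nhds_\<Omega>: "\<forall>\<^sub>F y in nhds x. y \<in> \<Omega>" if "x \<in> \<Omega>" for x
    using that \<Omega>(1) by (simp add: eventually_nhds_in_open)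
  have fr: "x \<in> closure \<Omega> \<longleftrightarrow> x \<in> \<Omega> \<or> x \<in> frontier \<Omega>" "x \<in> frontier \<Omega> \<Longrightarrow> x \<notin> \<Omega>" for x
    using \<Omega>(1) closure_subset[of \<Omega>] by (auto simp: frontier_def interior_open)
  have le: "ul x \<le> uu x" if "x \<in> closure \<Omega>" for x
    using comparison[OF ul _ uu] bd that by auto
  have uu': "usc_on (closure \<Omega>) (\<lambda>x. - uu x)" using uu(1) by (simp add: lsc_on_iff)
  obtain B1 where B1: "\<And>x. x \<in> closure \<Omega> \<Longrightarrow> ul x \<le> B1"
    using usc_on_compact_bounded_above[OF \<Omega>(2) ul(1)] by blast
  obtain B2 where B2: "\<And>x. x \<in> closure \<Omega> \<Longrightarrow> - uu x \<le> B2"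
    using usc_on_compact_bounded_above[OF \<Omega>(2) uu'] by blast
  \<comment> \<open>Beyond the upper bounds of \<open>ul\<close> and \<open>- uu\<close>, the
    truncated barriers remain ordered.\<close>
  obtain n1 :: nat where n1: "max (max B1 B2) 0 < real n1" using reals_Archimedean2 by blast
  \<comment> \<open>The value 0 outside \<open>\<Omega>\<close> keeps both barriers between
    \<open>-n\<close> and \<open>n\<close> everywhere, as the envelope lemmas demand;
    \<open>\<Omega>\<close> is open, so nothing inside is affected.\<close>
  define l where "l = (\<lambda>n x. if x \<in> \<Omega> then max (ul x) (- real n) else 0)"
  define u where "u = (\<lambda>n x. if x \<in> \<Omega> then min (uu x) (real n) else 0)"
  \<comment> \<open>The subsolution property is asked only above \<open>-n\<close>, since the
    constant part of \<open>l n\<close> need not satisfy it.\<close>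
  define S where "S = (\<lambda>n. {h. (\<forall>y. l n y \<le> h y \<and> h y \<le> u n y) \<and>
      (\<forall>y\<in>\<Omega>. - real n < usc_env h y \<longrightarrow> sub_at (usc_env h) y)})"
  define P where "P = (\<lambda>n y. SUP h\<in>S n. h y)"
  have lu: "l n y \<le> u n y" "- real n \<le> l n y" "u n y \<le> real n" if n: "n \<ge> n1" for n y
  proof -
    have "real n1 \<le> real n" using n by simp
    then show "l n y \<le> u n y" using le[of y] B1[of y] B2[of y] n1 closure_subset[of \<Omega>]
      by (auto simp: l_def u_def)
  qed (auto simp: l_def u_def)
  have ul_at: "usc_at ul x" and uu_at: "usc_at (\<lambda>x. - uu x) x" if "x \<in> \<Omega>" for x
    using usc_on_imp_usc_at[OF ul(1) \<Omega>(1) that closure_subset]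
      usc_on_imp_usc_at[OF uu' \<Omega>(1) that closure_subset] by auto
  have l_usc: "usc_at (l n) x" if x: "x \<in> \<Omega>" for n x
    unfolding usc_at_def
  proof (intro allI impI)
    fix a assume a: "l n x < a"
    then have "\<forall>\<^sub>F y in nhds x. ul y < a" using usc_atD[OF ul_at[OF x]] x by (simp add: l_def)
    with nhds_\<Omega>[OF x] show "\<forall>\<^sub>F y in nhds x. l n y < a"
      by eventually_elim (use a x in \<open>simp add: l_def\<close>)
  qed
  have u_lsc: "\<forall>\<^sub>F y in nhds x. a < u n y" if x: "x \<in> \<Omega>" "a < u n x" for n x a
  proof -
    have "\<forall>\<^sub>F y in nhds x. - uu y < - a" using usc_atD[OF uu_at[OF x(1)], of "- a"] x by (simp add: u_def)
    with nhds_\<Omega>[OF x(1)] show ?thesis by eventually_elim (use x in \<open>simp add: u_def\<close>)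
  qed
  have l_in: "l n \<in> S n" if n: "n \<ge> n1" for n
  proof -
    have "sub_at (usc_env (l n)) y" if y: "y \<in> \<Omega>" "- real n < usc_env (l n) y" for y
    proof (rule sub_at_cong)
      show "\<forall>\<^sub>F y in nhds y. usc_env (l n) y = l n y"
        using nhds_\<Omega>[OF y(1)] by eventually_elim (rule usc_env_eq[OF l_usc])
      have "l n y = ul y" using y usc_env_eq[OF l_usc[OF y(1)], of n] by (auto simp: l_def)
      moreover have "\<forall>\<^sub>F w in nhds y. ul w \<le> l n w"
        using nhds_\<Omega>[OF y(1)] by eventually_elim (simp add: l_def)
      ultimately show "sub_at (l n) y" using sub_at_dominating[OF _ _ ul(2)[OF y(1)]] by blast
    qed
    then show ?thesis using lu[OF n] by (auto simp: S_def)
  qed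
  have S_bd: "h y \<le> real n" if "h \<in> S n" "n \<ge> n1" for h y n
  proof -
    have "h y \<le> u n y" using that(1) by (simp add: S_def)
    with lu(3)[OF that(2), of y] show ?thesis by simp
  qed
  have P_upper: "h y \<le> P n y" if "h \<in> S n" "n \<ge> n1" for h y n
    unfolding P_def using that S_bd by (intro cSUP_upper) (auto intro!: bdd_aboveI[of _ "real n"])
  have P_le_u: "P n y \<le> u n y" if "n \<ge> n1" for n y
    unfolding P_def using that l_in by (intro cSUP_least) (auto simp: S_def)
  have P_ge_l: "l n y \<le> P n y" if "n \<ge> n1" for n y using P_upper[OF l_in] that by blast
  have P_bd: "P n y \<le> real n" "- P n y \<le> real n" if "n \<ge> n1" for n y
    using P_le_u[OF that, of y] P_ge_l[OF that, of y] lu(2,3)[OF that, of y] by linarith+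
  have P_sub: "sub_at (usc_env (P n)) y" if n: "n \<ge> n1" and y: "y \<in> \<Omega>" "- real n < usc_env (P n) y" for n y
  proof (rule sub_at_usc_env_Sup[OF \<Omega>(1) y(1), where S = "S n" and m = "- real n"])
    show "S n \<noteq> {}" using l_in[OF n] by blast
    show "h y \<le> real n" if "h \<in> S n" for h y using S_bd[OF that n] .
    show "sub_at (usc_env h) w" if "h \<in> S n" "w \<in> \<Omega>" "- real n < usc_env h w" for h w
      using that by (auto simp: S_def)
  qed (use y in \<open>auto simp: P_def\<close>)
  have P_in: "P n \<in> S n" if "n \<ge> n1" for n
    using P_sub[OF that] P_le_u[OF that] P_ge_l[OF that] by (auto simp: S_def)
  have env_up: "P n y \<le> usc_env (P n) y" "usc_env (P n) y \<le> real n" if n: "n \<ge> n1" for n y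
    using usc_env_upper[of "P n" "real n" y] usc_env_le[of "P n" "real n" y] P_bd(1)[OF n] by auto
  have env_lo: "lsc_env (P n) y \<le> P n y" "- real n \<le> lsc_env (P n) y" if n: "n \<ge> n1" for n y
    using usc_env_upper[of "\<lambda>y. - P n y" "real n" y] usc_env_le[of "\<lambda>y. - P n y" "real n" y] P_bd(2)[OF n]
    by (auto simp: lsc_env_def)
  \<comment> \<open>Strictly below the barrier there is room for a bump. At contact with the
    barrier, a value below \<open>n\<close> means contact with \<open>uu\<close>, which lies above
    and is a supersolution.\<close>
  have P_super: "super_at (lsc_env (P n)) x" if n: "n \<ge> n1" and x: "x \<in> \<Omega>" "lsc_env (P n) x < real n" for n x
  proof (cases "lsc_env (P n) x < u n x")
    case True
    show ?thesis
    proof (rule super_at_lsc_env_maximal[where l = "l n" and u = "u n" and S = "S n" and m = "- real n",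
        OF \<Omega>(1) x(1)])
      show "S n = {h. (\<forall>y. l n y \<le> h y \<and> h y \<le> u n y) \<and>
          (\<forall>y\<in>\<Omega>. - real n < usc_env h y \<longrightarrow> sub_at (usc_env h) y)}" by (simp add: S_def)
    qed (use lu[OF n] P_in[OF n] P_upper[OF _ n] u_lsc[OF x(1)] True in blast)+
  next
    case False
    have "lsc_env (P n) x \<le> u n x" using env_lo(1)[OF n, of x] P_le_u[OF n, of x] by simp
    with False x have eq: "lsc_env (P n) x = uu x" by (auto simp: u_def)
    have "\<forall>\<^sub>F y in nhds x. lsc_env (P n) y \<le> uu y"
      using nhds_\<Omega>[OF x(1)]
    proof eventually_elim
      case (elim y)
      have "u n y \<le> uu y" using elim by (simp add: u_def)
      then show ?case using env_lo(1)[OF n, of y] P_le_u[OF n, of y] by linarith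
    qed
    from super_at_dominated[OF this eq uu(2)[OF x(1)]] show ?thesis .
  qed
  \<comment> \<open>Inside \<open>\<Omega>\<close> every \<open>P n\<close> lies below
    \<open>uu\<close>, so the boundary control of \<open>uu\<close> holds for all \<open>n\<close>
    at once.\<close>
  have env_bd_up: "\<forall>\<^sub>F y in nhds x. y \<in> \<Omega> \<longrightarrow> (\<forall>n\<ge>n1. usc_env (P n) y \<le> a)" if x: "x \<in> frontier \<Omega>" "f x < a" for x a
  proof -
    have "\<forall>\<^sub>F y in nhds x. \<forall>\<^sub>F w in nhds y. w \<in> \<Omega> \<longrightarrow> uu w < a"
      using uu_bd[OF x] by (simp add: eventually_eventually)
    then show ?thesis
    proof eventually_elim
      case (elim y)
      show ?case
      proof (intro impI allI usc_env_le)
        fix n assume "y \<in> \<Omega>" "n1 \<le> n"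
        from nhds_\<Omega>[OF this(1)] elim show "\<forall>\<^sub>F w in nhds y. P n w \<le> a"
        proof eventually_elim
          case (elim w)
          then show ?case using P_le_u[OF \<open>n1 \<le> n\<close>, of w] by (auto simp: u_def)
        qed
      qed
    qed
  qed
  have env_bd_lo: "\<forall>\<^sub>F y in nhds x. y \<in> \<Omega> \<longrightarrow> (\<forall>n\<ge>n1. a \<le> lsc_env (P n) y)" if x: "x \<in> frontier \<Omega>" "a < f x" for x a
  proof -
    have "\<forall>\<^sub>F y in nhds x. \<forall>\<^sub>F w in nhds y. w \<in> \<Omega> \<longrightarrow> a < ul w"
      using ul_bd[OF x] by (simp add: eventually_eventually)
    then show ?thesis
    proof eventually_elim
      case (elim y)
      have "usc_env (\<lambda>y. - P n y) y \<le> - a" if "y \<in> \<Omega>" "n1 \<le> n" for n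
      proof (rule usc_env_le)
        from nhds_\<Omega>[OF that(1)] elim show "\<forall>\<^sub>F w in nhds y. - P n w \<le> - a"
        proof eventually_elim
          case (elim w)
          then show ?case using P_ge_l[OF \<open>n1 \<le> n\<close>, of w] by (auto simp: l_def)
        qed
      qed
      then show ?case by (force simp: lsc_env_def)
    qed
  qed
  have "\<exists>N. \<forall>n\<ge>N. \<forall>x\<in>\<Omega>. usc_env (P n) x < real n"
  proof (rule ccontr)
    assume "\<not> ?thesis"
    then have esc: "\<exists>n\<ge>N. \<exists>x\<in>\<Omega>. real n \<le> usc_env (P n) x" for N by (meson not_le)
    have bdry: "\<exists>B. \<forall>\<^sub>F y in nhds x. y \<in> \<Omega> \<longrightarrow> (\<forall>n\<ge>n1. usc_env (P n) y \<le> B)" if "x \<in> frontier \<Omega>" for x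
      using env_bd_up[OF that, of "f x + 1"] by auto
    obtain x where x: "x \<in> \<Omega>" "\<And>R. \<exists>z. usc_on (closure \<Omega>) z \<and> (\<forall>y\<in>\<Omega>. sub_at z y) \<and>
        (\<forall>y\<in>frontier \<Omega>. z y = ul y) \<and> R \<le> z x"
      using escaping_subsolutions[OF \<Omega> ul env_up(2) usc_at_usc_env[OF P_bd(1)] P_sub bdry esc] by blast
    \<comment> \<open>On the frontier \<open>z\<close> equals \<open>ul\<close>, hence
      \<open>f\<close>, so it is an admissible subsolution and comparison forbids it to exceed
      \<open>uu x\<close>.\<close>
    obtain z where z: "usc_on (closure \<Omega>) z" "\<And>y. y \<in> \<Omega> \<Longrightarrow> sub_at z y"
        "\<And>y. y \<in> frontier \<Omega> \<Longrightarrow> z y = ul y" "uu x + 1 \<le> z x" using x(2)[of "uu x + 1"] by blast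
    have "z x \<le> uu x" using comparison[OF z(1,2) _ uu] z(3) bd x(1) fr(1) by auto
    with z(4) show False by simp
  qed
  then obtain n2 where n2: "\<And>n x. n \<ge> n2 \<Longrightarrow> x \<in> \<Omega> \<Longrightarrow> usc_env (P n) x < real n" by blast
  have "\<exists>N. \<forall>n\<ge>N. \<forall>x\<in>\<Omega>. - real n < lsc_env (P n) x"
  proof (rule ccontr)
    assume "\<not> ?thesis"
    then have "\<exists>n\<ge>N. \<exists>x\<in>\<Omega>. lsc_env (P n) x \<le> - real n" for N by (meson not_le)
    then have esc: "\<exists>n\<ge>N. \<exists>x\<in>\<Omega>. real n \<le> - lsc_env (P n) x" for N
      by (metis minus_le_iff le_minus_iff)
    have bdry: "\<exists>B. \<forall>\<^sub>F y in nhds x. y \<in> \<Omega> \<longrightarrow> (\<forall>n\<ge>n1. - lsc_env (P n) y \<le> B)" if "x \<in> frontier \<Omega>" for x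
      using env_bd_lo[OF that, of "f x - 1"]
      by (intro exI[of _ "- (f x - 1)"]) (auto elim!: eventually_mono)
    \<comment> \<open>At the lower level it is \<open>- lsc_env (P n)\<close> that escapes, in the
      dual locale, and \<open>- uu\<close> is the function glued in.\<close>
    have ge: "- lsc_env (P n) y \<le> real n" if "n \<ge> n1" for n y using env_lo(2)[OF that, of y] by simp
    have usc: "usc_at (\<lambda>y. - lsc_env (P n) y) y" if "n \<ge> n1" for n y
      using usc_at_usc_env[of "\<lambda>y. - P n y", OF P_bd(2)[OF that]] by (simp add: lsc_env_def)
    have sub: "dual.sub_at (\<lambda>y. - lsc_env (P n) y) y" if "n \<ge> n1" "y \<in> \<Omega>" "- real n < - lsc_env (P n) y" for n y
      using P_super[OF that(1,2)] that(3) by (simp add: dual_sub_at)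
    have uu_dual: "dual.sub_at (\<lambda>y. - uu y) y" if "y \<in> \<Omega>" for y using uu(2)[OF that] by (simp add: dual_sub_at)
    obtain x where x: "x \<in> \<Omega>" "\<And>R. \<exists>z. usc_on (closure \<Omega>) z \<and> (\<forall>y\<in>\<Omega>. dual.sub_at z y) \<and>
        (\<forall>y\<in>frontier \<Omega>. z y = - uu y) \<and> R \<le> z x"
      using dual.escaping_subsolutions[OF \<Omega> uu' uu_dual ge usc sub bdry esc] by blast
    obtain z where z: "usc_on (closure \<Omega>) z" "\<And>y. y \<in> \<Omega> \<Longrightarrow> dual.sub_at z y"
        "\<And>y. y \<in> frontier \<Omega> \<Longrightarrow> z y = - uu y" "- ul x + 1 \<le> z x" using x(2)[of "- ul x + 1"] by blast
    have "lsc_on (closure \<Omega>) (\<lambda>y. - z y)" using z(1) by (simp add: lsc_on_iff)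
    moreover have "super_at (\<lambda>y. - z y) y" if "y \<in> \<Omega>" for y using z(2)[OF that] by (simp add: dual_sub_at)
    ultimately have "ul x \<le> - z x" using comparison[OF ul, of "\<lambda>y. - z y"] z(3) bd x(1) fr(1) by auto
    with z(4) show False by simp
  qed
  then obtain n3 where n3: "\<And>n x. n \<ge> n3 \<Longrightarrow> x \<in> \<Omega> \<Longrightarrow> - real n < lsc_env (P n) x" by blast
  define n where "n = max n1 (max n2 n3)"
  have n: "n \<ge> n1" "n \<ge> n2" "n \<ge> n3" by (auto simp: n_def)
  \<comment> \<open>For this \<open>n\<close> neither truncation level is reached, so both envelopes
    pass their tests throughout \<open>\<Omega>\<close>; \<open>f\<close> completes them on the
    frontier.\<close>
  define w where "w = (\<lambda>x. if x \<in> \<Omega> then usc_env (P n) x else f x)"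
  define v where "v = (\<lambda>x. if x \<in> \<Omega> then lsc_env (P n) x else f x)"
  have vw: "v x \<le> w x" for x using env_lo(1)[OF n(1), of x] env_up(1)[OF n(1), of x] by (simp add: v_def w_def)
  have w_sub: "sub_at w x" if x: "x \<in> \<Omega>" for x
  proof (rule sub_at_cong)
    show "\<forall>\<^sub>F y in nhds x. w y = usc_env (P n) y" using nhds_\<Omega>[OF x] by eventually_elim (simp add: w_def)
    have "- real n < usc_env (P n) x"
      using n3[OF n(3) x] env_lo(1)[OF n(1), of x] env_up(1)[OF n(1), of x] by linarith
    then show "sub_at (usc_env (P n)) x" by (rule P_sub[OF n(1) x])
  qed
  have v_super: "super_at v x" if x: "x \<in> \<Omega>" for x
  proof (rule super_at_cong)
    show "\<forall>\<^sub>F y in nhds x. v y = lsc_env (P n) y" using nhds_\<Omega>[OF x] by eventually_elim (simp add: v_def)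
    have "lsc_env (P n) x < real n"
      using n2[OF n(2) x] env_lo(1)[OF n(1), of x] env_up(1)[OF n(1), of x] by linarith
    then show "super_at (lsc_env (P n)) x" by (rule P_super[OF n(1) x])
  qed
  \<comment> \<open>\<open>f\<close> inherits upper semicontinuity on the frontier from
    \<open>ul\<close> and lower semicontinuity from \<open>uu\<close>, since both equal it
    there.\<close>
  have f_usc: "\<forall>\<^sub>F y in nhds x. y \<in> frontier \<Omega> \<longrightarrow> f y < a" if "x \<in> frontier \<Omega>" "f x < a" for x a
  proof -
    have "\<forall>\<^sub>F y in nhds x. y \<in> closure \<Omega> \<longrightarrow> ul y < a"
      using ul(1) that bd[of x] fr unfolding usc_on_iff by auto
    then show ?thesis by eventually_elim (use bd fr in auto)
  qed
  have f_lsc: "\<forall>\<^sub>F y in nhds x. y \<in> frontier \<Omega> \<longrightarrow> - f y < a" if "x \<in> frontier \<Omega>" "- f x < a" for x a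
  proof -
    have "\<forall>\<^sub>F y in nhds x. y \<in> closure \<Omega> \<longrightarrow> - uu y < a"
      using uu' that bd[of x] fr unfolding usc_on_iff by auto
    then show ?thesis by eventually_elim (use bd fr in auto)
  qed
  have w_usc: "usc_on (closure \<Omega>) w"
    unfolding usc_on_iff
  proof (intro ballI allI impI)
    fix x a assume x: "x \<in> closure \<Omega>" "w x < a"
    show "\<forall>\<^sub>F y in nhds x. y \<in> closure \<Omega> \<longrightarrow> w y < a"
    proof (cases "x \<in> \<Omega>")
      case True
      then have "\<forall>\<^sub>F y in nhds x. usc_env (P n) y < a"
        using usc_atD[OF usc_at_usc_env[of "P n", OF P_bd(1)[OF n(1)]]] x(2) by (simp add: w_def)
      with nhds_\<Omega>[OF True] show ?thesis by eventually_elim (simp add: w_def)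
    next
      case False
      then have xf: "x \<in> frontier \<Omega>" "f x < a" using x fr by (auto simp: w_def)
      obtain b where b: "f x < b" "b < a" using dense[OF xf(2)] by blast
      from f_usc[OF xf] env_bd_up[OF xf(1) b(1)] show ?thesis
        by eventually_elim (use b(2) n(1) fr in \<open>auto simp: w_def intro: le_less_trans\<close>)
    qed
  qed
  have v_lsc: "lsc_on (closure \<Omega>) v"
    unfolding lsc_on_iff usc_on_iff
  proof (intro ballI allI impI)
    fix x a assume x: "x \<in> closure \<Omega>" "- v x < a"
    show "\<forall>\<^sub>F y in nhds x. y \<in> closure \<Omega> \<longrightarrow> - v y < a"
    proof (cases "x \<in> \<Omega>")
      case True
      then have "\<forall>\<^sub>F y in nhds x. - lsc_env (P n) y < a"
        using usc_atD[OF usc_at_usc_env[of "\<lambda>y. - P n y", OF P_bd(2)[OF n(1)]]] x(2)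
        by (simp add: v_def lsc_env_def)
      with nhds_\<Omega>[OF True] show ?thesis by eventually_elim (simp add: v_def)
    next
      case False
      then have xf: "x \<in> frontier \<Omega>" "- f x < a" using x fr by (auto simp: v_def)
      obtain b where b: "- f x < b" "b < a" using dense[OF xf(2)] by blast
      from b(1) have "- b < f x" by simp
      from f_lsc[OF xf] env_bd_lo[OF xf(1) this] show ?thesis
        by eventually_elim (use b(2) n(1) fr in \<open>force simp: v_def\<close>)
    qed
  qed
  have wv: "w x \<le> v x" if "x \<in> closure \<Omega>" for x
    using comparison[OF w_usc w_sub _ v_lsc v_super] fr that by (auto simp: w_def v_def)
  have "w x = v x" for x
  proof (cases "x \<in> closure \<Omega>")
    case True
    from antisym[OF wv[OF this] vw] show ?thesis .
  next
    case False
    then show ?thesis using fr by (simp add: w_def v_def)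
  qed
  then have "w = v" by blast
  moreover have "\<forall>y\<in>frontier \<Omega>. w y = f y" using fr by (auto simp: w_def)
  ultimately show ?thesis using w_usc v_lsc w_sub v_super by metis
qed

end

section \<open>Calculus of functions of class C1 and C2\<close>

abbreviation fd :: "('a::euclidean_space \<Rightarrow> 'b::real_normed_vector) \<Rightarrow> 'a \<Rightarrow> 'a \<Rightarrow> 'b" where
  "fd f p \<equiv> frechet_derivative f (at p)"

definition C1_on :: "('a::euclidean_space \<Rightarrow> 'b::real_normed_vector) \<Rightarrow> 'a set \<Rightarrow> bool" where
  "C1_on f S \<longleftrightarrow> C_k_on 1 f S"

definition C2_on :: "('a::euclidean_space \<Rightarrow> 'b::real_normed_vector) \<Rightarrow> 'a set \<Rightarrow> bool" where
  "C2_on f S \<longleftrightarrow> C_k_on 2 f S"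

lemma C1_on_iff:
  "C1_on f S \<longleftrightarrow> (\<forall>p\<in>S. f differentiable (at p)) \<and> (\<forall>v. continuous_on S (\<lambda>p. fd f p v))"
  by (simp add: C1_on_def)

lemma C2_on_iff:
  "C2_on f S \<longleftrightarrow> (\<forall>p\<in>S. f differentiable (at p)) \<and> (\<forall>v. C1_on (\<lambda>p. fd f p v) S)"
  by (simp add: C1_on_def C2_on_def numeral_2_eq_2)

lemma C1_onD: "C1_on f S \<Longrightarrow> p \<in> S \<Longrightarrow> (f has_derivative fd f p) (at p)"
  by (auto simp: C1_on_iff frechet_derivative_works)

lemma C1_on_continuous: "C1_on f S \<Longrightarrow> continuous_on S f"
  by (auto simp: C1_on_iff intro!: continuous_at_imp_continuous_on differentiable_imp_continuous_within)

lemma C1_on_continuous_fd: "C1_on f S \<Longrightarrow> continuous_on S (\<lambda>p. fd f p v)"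
  by (simp add: C1_on_iff)

lemma fd_eq: "(f has_derivative f') (at p) \<Longrightarrow> fd f p = f'"
  using frechet_derivative_at by metis

lemma has_derivative_cong_open:
  assumes "open S" "p \<in> S" "\<And>q. q \<in> S \<Longrightarrow> f q = g q"
  shows "(f has_derivative f') (at p) \<longleftrightarrow> (g has_derivative f') (at p)"
  using has_derivative_transform_within_open[OF _ assms(1,2), of f f' UNIV g]
    has_derivative_transform_within_open[OF _ assms(1,2), of g f' UNIV f] assms(3) by auto

lemma fd_cong_open:
  assumes "open S" "p \<in> S" "\<And>q. q \<in> S \<Longrightarrow> f q = g q"
  shows "fd f p = fd g p"
  unfolding frechet_derivative_def using has_derivative_cong_open[OF assms] by simp

lemma C1_onI:
  assumes "\<And>p. p \<in> S \<Longrightarrow> (f has_derivative f' p) (at p)" "\<And>v. continuous_on S (\<lambda>p. f' p v)"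
  shows "C1_on f S"
proof -
  have "continuous_on S (\<lambda>p. fd f p v)" for v
    using assms(2)[of v] by (subst continuous_on_cong[OF refl]) (auto simp: fd_eq[OF assms(1)])
  then show ?thesis using assms(1) by (auto simp: C1_on_iff differentiable_def)
qed

lemma C1_on_cong_open:
  assumes "open S" "C1_on g S" "\<And>q. q \<in> S \<Longrightarrow> f q = g q"
  shows "C1_on f S"
proof (rule C1_onI)
  show "(f has_derivative fd g p) (at p)" if "p \<in> S" for p
    using has_derivative_cong_open[OF assms(1) that, of f g] assms(3) C1_onD[OF assms(2) that] by blast
  show "continuous_on S (\<lambda>p. fd g p v)" for v using assms(2) by (simp add: C1_on_iff)
qed

lemma C2_onI:
  assumes "open S" "\<And>p. p \<in> S \<Longrightarrow> (f has_derivative f' p) (at p)" "\<And>v. C1_on (\<lambda>p. f' p v) S"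
  shows "C2_on f S"
  unfolding C2_on_iff
proof (intro conjI ballI allI)
  show "C1_on (\<lambda>p. fd f p v) S" for v
    using assms(1,3) by (rule C1_on_cong_open) (simp add: fd_eq[OF assms(2)])
qed (use assms(2) in \<open>auto simp: differentiable_def\<close>)

lemma C2_onD: "C2_on f S \<Longrightarrow> p \<in> S \<Longrightarrow> (f has_derivative fd f p) (at p)"
  by (auto simp: C2_on_iff frechet_derivative_works)

lemma C2_on_fd: "C2_on f S \<Longrightarrow> C1_on (\<lambda>p. fd f p v) S"
  by (simp add: C2_on_iff)

lemma C2_on_imp_C1_on: "C2_on f S \<Longrightarrow> C1_on f S"
proof (rule C1_onI)
  assume f: "C2_on f S"
  show "(f has_derivative fd f p) (at p)" if "p \<in> S" for p using C2_onD[OF f that] .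
  show "continuous_on S (\<lambda>p. fd f p v)" for v using C1_on_continuous[OF C2_on_fd[OF f]] .
qed

lemma C1_on_differentiable: "C1_on f S \<Longrightarrow> p \<in> S \<Longrightarrow> f differentiable (at p)"
  by (simp add: C1_on_iff)

lemma C2_on_differentiable: "C2_on f S \<Longrightarrow> p \<in> S \<Longrightarrow> f differentiable (at p)"
  by (simp add: C2_on_iff)

lemma C1_on_subset: "C1_on f S \<Longrightarrow> R \<subseteq> S \<Longrightarrow> C1_on f R"
  by (auto simp: C1_on_iff intro: continuous_on_subset)

lemma C2_on_subset: "C2_on f S \<Longrightarrow> R \<subseteq> S \<Longrightarrow> C2_on f R"
  by (auto simp: C2_on_iff intro: C1_on_subset)

lemma linear_fd: "f differentiable (at p) \<Longrightarrow> linear (fd f p)"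
  by (auto simp: frechet_derivative_works dest: has_derivative_linear)

lemma C1_on_add:
  assumes "C1_on f S" "C1_on g S"
  shows "C1_on (\<lambda>p. f p + g p) S"
proof (rule C1_onI)
  show "((\<lambda>p. f p + g p) has_derivative (\<lambda>v. fd f p v + fd g p v)) (at p)" if "p \<in> S" for p
    by (rule has_derivative_add[OF C1_onD[OF assms(1) that] C1_onD[OF assms(2) that]])
  show "continuous_on S (\<lambda>p. fd f p v + fd g p v)" for v
    by (rule continuous_on_add[OF C1_on_continuous_fd[OF assms(1)] C1_on_continuous_fd[OF assms(2)]])
qed

lemma C1_on_sum:
  assumes "\<And>i. i \<in> I \<Longrightarrow> C1_on (f i) S"
  shows "C1_on (\<lambda>p. \<Sum>i\<in>I. f i p) S"
proof (rule C1_onI)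
  show "((\<lambda>p. \<Sum>i\<in>I. f i p) has_derivative (\<lambda>v. \<Sum>i\<in>I. fd (f i) p v)) (at p)" if "p \<in> S" for p
    by (rule has_derivative_sum, rule C1_onD[OF assms that])
  show "continuous_on S (\<lambda>p. \<Sum>i\<in>I. fd (f i) p v)" for v
    by (rule continuous_on_sum, rule C1_on_continuous_fd[OF assms])
qed

lemma C1_on_scaleR:
  assumes "C1_on f S" "C1_on g S"
  shows "C1_on (\<lambda>p. f p *\<^sub>R g p) S"
proof (rule C1_onI[of _ _ "\<lambda>p v. f p *\<^sub>R fd g p v + fd f p v *\<^sub>R g p"])
  show "continuous_on S (\<lambda>p. f p *\<^sub>R fd g p v + fd f p v *\<^sub>R g p)" for v
    using assms C1_on_continuous[OF assms(1)] C1_on_continuous[OF assms(2)]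
    by (intro continuous_intros) (auto simp: C1_on_iff)
qed (use assms in \<open>auto intro!: has_derivative_scaleR C1_onD\<close>)

lemma C1_on_bounded_linear:
  assumes "bounded_linear L" "C1_on f S"
  shows "C1_on (\<lambda>p. L (f p)) S"
proof (rule C1_onI)
  show "((\<lambda>p. L (f p)) has_derivative (\<lambda>v. L (fd f p v))) (at p)" if "p \<in> S" for p
    by (rule bounded_linear.has_derivative[OF assms(1) C1_onD[OF assms(2) that]])
  show "continuous_on S (\<lambda>p. L (fd f p v))" for v
    by (rule bounded_linear.continuous_on[OF assms(1) C1_on_continuous_fd[OF assms(2)]])
qed

lemma C2_on_add:
  assumes "open S" "C2_on f S" "C2_on g S"
  shows "C2_on (\<lambda>p. f p + g p) S"
proof (rule C2_onI[OF assms(1)])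
  show "((\<lambda>p. f p + g p) has_derivative (\<lambda>v. fd f p v + fd g p v)) (at p)" if "p \<in> S" for p
    by (rule has_derivative_add[OF C2_onD[OF assms(2) that] C2_onD[OF assms(3) that]])
  show "C1_on (\<lambda>p. fd f p v + fd g p v) S" for v
    by (rule C1_on_add[OF C2_on_fd[OF assms(2)] C2_on_fd[OF assms(3)]])
qed

lemma C2_on_bounded_linear:
  assumes "open S" "bounded_linear L" "C2_on f S"
  shows "C2_on (\<lambda>p. L (f p)) S"
proof (rule C2_onI[OF assms(1)])
  show "((\<lambda>p. L (f p)) has_derivative (\<lambda>v. L (fd f p v))) (at p)" if "p \<in> S" for p
    by (rule bounded_linear.has_derivative[OF assms(2) C2_onD[OF assms(3) that]])
  show "C1_on (\<lambda>p. L (fd f p v)) S" for v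
    by (rule C1_on_bounded_linear[OF assms(2) C2_on_fd[OF assms(3)]])
qed

lemma linear_eq_sum_Basis:
  fixes L :: "'a::euclidean_space \<Rightarrow> 'b::real_vector"
  assumes "linear L"
  shows "L v = (\<Sum>i\<in>Basis. (v \<bullet> i) *\<^sub>R L i)"
proof -
  have "L v = L (\<Sum>i\<in>Basis. (v \<bullet> i) *\<^sub>R i)" by (simp add: euclidean_representation)
  also have "\<dots> = (\<Sum>i\<in>Basis. (v \<bullet> i) *\<^sub>R L i)"
    using assms by (simp add: linear_sum linear_scale)
  finally show ?thesis .
qed

text \<open>The maps \<open>L p\<close> are plain functions controlled only vector by vector;
  expanding the argument in the basis reduces their joint behaviour to finitely many of
  these.\<close>

lemma continuous_on_apply_linear:
  fixes L :: "'p::topological_space \<Rightarrow> 'a::euclidean_space \<Rightarrow> 'b::real_normed_vector"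
  assumes "\<And>p. p \<in> S \<Longrightarrow> linear (L p)" "\<And>v. continuous_on S (\<lambda>p. L p v)" "continuous_on S u"
  shows "continuous_on S (\<lambda>p. L p (u p))"
proof -
  have "continuous_on S (\<lambda>p. \<Sum>i\<in>Basis. (u p \<bullet> i) *\<^sub>R L p i)"
    using assms by (intro continuous_intros) auto
  then show ?thesis
    by (subst continuous_on_cong[OF refl]) (auto intro: linear_eq_sum_Basis assms(1))
qed

text \<open>Product rule: the two terms come from varying the map and from varying its
  argument.\<close>

lemma has_derivative_apply_linear:
  fixes L :: "'a::euclidean_space \<Rightarrow> 'c::euclidean_space \<Rightarrow> 'b::real_normed_vector"
  assumes S: "open S" "p \<in> S" and lin: "\<And>q. q \<in> S \<Longrightarrow> linear (L q)"
    and L: "\<And>v. (\<lambda>q. L q v) differentiable (at p)" and u: "u differentiable (at p)"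
  shows "((\<lambda>q. L q (u q)) has_derivative (\<lambda>v. fd (\<lambda>q. L q (u p)) p v + L p (fd u p v))) (at p)"
proof -
  have u': "(u has_derivative fd u p) (at p)" using u by (simp add: frechet_derivative_works)
  have L': "((\<lambda>q. L q w) has_derivative fd (\<lambda>q. L q w) p) (at p)" for w
    using L by (simp add: frechet_derivative_works)
  have "((\<lambda>q. \<Sum>i\<in>Basis. (u q \<bullet> i) *\<^sub>R L q i) has_derivative
      (\<lambda>v. \<Sum>i\<in>Basis. (u p \<bullet> i) *\<^sub>R fd (\<lambda>q. L q i) p v + (fd u p v \<bullet> i) *\<^sub>R L p i)) (at p)"
    by (intro has_derivative_sum has_derivative_scaleR has_derivative_inner_left u' L')
  moreover have "L p (fd u p v) = (\<Sum>i\<in>Basis. (fd u p v \<bullet> i) *\<^sub>R L p i)" for v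
    by (rule linear_eq_sum_Basis[OF lin[OF S(2)]])
  moreover have "fd (\<lambda>q. L q (u p)) p v = (\<Sum>i\<in>Basis. (u p \<bullet> i) *\<^sub>R fd (\<lambda>q. L q i) p v)" for v
  proof -
    have "((\<lambda>q. \<Sum>i\<in>Basis. (u p \<bullet> i) *\<^sub>R L q i) has_derivative
        (\<lambda>v. \<Sum>i\<in>Basis. (u p \<bullet> i) *\<^sub>R fd (\<lambda>q. L q i) p v)) (at p)"
      by (intro has_derivative_sum has_derivative_scaleR_right L')
    moreover have "L q (u p) = (\<Sum>i\<in>Basis. (u p \<bullet> i) *\<^sub>R L q i)" if "q \<in> S" for q
      by (rule linear_eq_sum_Basis[OF lin[OF that]])
    ultimately have "((\<lambda>q. L q (u p)) has_derivative
        (\<lambda>v. \<Sum>i\<in>Basis. (u p \<bullet> i) *\<^sub>R fd (\<lambda>q. L q i) p v)) (at p)"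
      using has_derivative_cong_open[OF S, of "\<lambda>q. L q (u p)" "\<lambda>q. \<Sum>i\<in>Basis. (u p \<bullet> i) *\<^sub>R L q i"] by simp
    from fd_eq[OF this] show ?thesis by simp
  qed
  moreover have "L q (u q) = (\<Sum>i\<in>Basis. (u q \<bullet> i) *\<^sub>R L q i)" if "q \<in> S" for q
    by (rule linear_eq_sum_Basis[OF lin[OF that]])
  ultimately show ?thesis
    using has_derivative_cong_open[OF S, of "\<lambda>q. L q (u q)" "\<lambda>q. \<Sum>i\<in>Basis. (u q \<bullet> i) *\<^sub>R L q i"]
    by (simp add: sum.distrib)
qed

lemma C1_on_apply_linear:
  fixes L :: "'a::euclidean_space \<Rightarrow> 'c::euclidean_space \<Rightarrow> 'b::real_normed_vector"
  assumes "open S" "\<And>q. q \<in> S \<Longrightarrow> linear (L q)" "\<And>v. C1_on (\<lambda>q. L q v) S" "C1_on u S"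
  shows "C1_on (\<lambda>q. L q (u q)) S"
proof -
  have "C1_on (\<lambda>q. \<Sum>i\<in>Basis. (u q \<bullet> i) *\<^sub>R L q i) S"
    using assms by (intro C1_on_sum C1_on_scaleR C1_on_bounded_linear[OF bounded_linear_inner_left]) auto
  then show ?thesis
    by (rule C1_on_cong_open[OF assms(1)]) (auto intro: linear_eq_sum_Basis assms(2))
qed

lemma fd_compose:
  assumes "f differentiable (at (t p))" "t differentiable (at p)"
  shows "((\<lambda>q. f (t q)) has_derivative (\<lambda>v. fd f (t p) (fd t p v))) (at p)"
  using has_derivative_compose[of t "fd t p" p UNIV f "fd f (t p)"] assms
  by (simp add: frechet_derivative_works)

lemma C1_on_compose:
  assumes "C1_on f S" "C1_on t R" "t ` R \<subseteq> S"
  shows "C1_on (\<lambda>q. f (t q)) R"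
proof (rule C1_onI)
  show "((\<lambda>q. f (t q)) has_derivative (\<lambda>v. fd f (t p) (fd t p v))) (at p)" if "p \<in> R" for p
    using assms that by (intro fd_compose) (auto simp: C1_on_iff)
  have "continuous_on R (\<lambda>p. fd f (t p) w)" for w
    using assms continuous_on_compose2[of S "\<lambda>q. fd f q w" R t] C1_on_continuous[OF assms(2)]
    by (auto simp: C1_on_iff)
  then show "continuous_on R (\<lambda>p. fd f (t p) (fd t p v))" for v
  proof (rule continuous_on_apply_linear[where L = "\<lambda>p. fd f (t p)", rotated])
    show "linear (fd f (t p))" if "p \<in> R" for p
      using assms that by (intro linear_fd) (auto simp: C1_on_iff)
    show "continuous_on R (\<lambda>p. fd t p v)" using assms(2) by (rule C1_on_continuous_fd)
  qed
qed

lemma C2_on_compose: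
  assumes "open R" "C2_on f S" "C2_on t R" "t ` R \<subseteq> S"
  shows "C2_on (\<lambda>q. f (t q)) R"
proof (rule C2_onI[OF assms(1)])
  show "((\<lambda>q. f (t q)) has_derivative (\<lambda>v. fd f (t p) (fd t p v))) (at p)" if "p \<in> R" for p
    using assms that by (intro fd_compose) (auto simp: C2_on_iff)
  show "C1_on (\<lambda>p. fd f (t p) (fd t p v)) R" for v
  proof (rule C1_on_apply_linear[OF assms(1)])
    show "linear (fd f (t q))" if "q \<in> R" for q
      using assms that by (intro linear_fd) (auto simp: C2_on_iff)
    show "C1_on (\<lambda>q. fd f (t q) w) R" for w
      using C1_on_compose[OF C2_on_fd[OF assms(2)] C2_on_imp_C1_on[OF assms(3)] assms(4)] .
    show "C1_on (\<lambda>q. fd t q v) R" using assms(3) by (rule C2_on_fd)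
  qed
qed

text \<open>Second-order chain rule. The term with the second derivative of \<open>t\<close> keeps
  second derivatives from being tensorial; the Christoffel symbols later absorb it.\<close>

lemma fd2_compose:
  assumes "open R" "C2_on f S" "C2_on t R" "t ` R \<subseteq> S" "p \<in> R"
  shows "fd (\<lambda>q. fd (\<lambda>q. f (t q)) q w) p v =
    fd (\<lambda>q. fd f q (fd t p w)) (t p) (fd t p v) + fd f (t p) (fd (\<lambda>q. fd t q w) p v)"
proof -
  have "fd (\<lambda>q. fd (\<lambda>q. f (t q)) q w) p = fd (\<lambda>q. fd f (t q) (fd t q w)) p"
  proof (rule fd_cong_open[OF assms(1,5)])
    fix q assume "q \<in> R"
    then have "((\<lambda>q. f (t q)) has_derivative (\<lambda>v. fd f (t q) (fd t q v))) (at q)"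
      using assms by (intro fd_compose) (auto simp: C2_on_iff)
    from fd_eq[OF this] show "fd (\<lambda>q. f (t q)) q w = fd f (t q) (fd t q w)" by simp
  qed
  also have "\<dots> = (\<lambda>v. fd (\<lambda>q. fd f (t q) (fd t p w)) p v + fd f (t p) (fd (\<lambda>q. fd t q w) p v))"
  proof (rule fd_eq, rule has_derivative_apply_linear[OF assms(1,5)])
    show "linear (fd f (t q))" if "q \<in> R" for q
      using assms that by (intro linear_fd) (auto simp: C2_on_iff)
    show "(\<lambda>q. fd f (t q) w) differentiable at p" for w
      using C1_on_compose[OF C2_on_fd[OF assms(2)] C2_on_imp_C1_on[OF assms(3)] assms(4), of w] assms(5)
      by (auto simp: C1_on_iff)
    show "(\<lambda>q. fd t q w) differentiable at p"
      using C2_on_fd[OF assms(3), of w] assms(5) by (auto simp: C1_on_iff)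
  qed
  also have "fd (\<lambda>q. fd f (t q) (fd t p w)) p = (\<lambda>v. fd (\<lambda>q. fd f q (fd t p w)) (t p) (fd t p v))"
  proof (rule fd_eq, rule fd_compose)
    show "(\<lambda>q. fd f q (fd t p w)) differentiable at (t p)"
      using C2_on_fd[OF assms(2), of "fd t p w"] assms(4,5) by (auto simp: C1_on_iff)
    show "t differentiable at p" using assms(3,5) by (simp add: C2_on_iff)
  qed
  finally show ?thesis by simp
qed

section \<open>Symmetry of second derivatives and the second derivative test\<close>

lemma has_derivative_line:
  assumes "f differentiable (at (p + s *\<^sub>R v))"
  shows "((\<lambda>s. f (p + s *\<^sub>R v)) has_vector_derivative fd f (p + s *\<^sub>R v) v) (at s)"
proof -
  have "((\<lambda>s. p + s *\<^sub>R v) has_derivative (\<lambda>r. r *\<^sub>R v)) (at s)"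
    by (auto intro!: derivative_eq_intros)
  from has_derivative_compose[OF this, of f "fd f (p + s *\<^sub>R v)"] assms
  show ?thesis
    using linear_scale[OF linear_fd[OF assms]]
    by (simp add: has_vector_derivative_def frechet_derivative_works)
qed

lemma DERIV_line:
  fixes f :: "'a::euclidean_space \<Rightarrow> real"
  assumes "f differentiable (at (p + s *\<^sub>R v))"
  shows "((\<lambda>s. f (p + s *\<^sub>R v)) has_real_derivative fd f (p + s *\<^sub>R v) v) (at s)"
  using has_derivative_line[OF assms] by (simp add: has_real_derivative_iff_has_vector_derivative)

lemma isCont_tendsto_nhds: "isCont f x \<Longrightarrow> (f \<longlongrightarrow> f x) (nhds x)"
  by (simp add: continuous_at tendsto_at_iff_tendsto_nhds)

text \<open>Two applications of the mean value theorem: first in the direction \<open>v\<close> to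
  the difference over \<open>h *\<^sub>R w\<close>, then in the direction \<open>w\<close> to the
  resulting first derivative.\<close>

lemma mixed_difference_eq:
  fixes f :: "'a::euclidean_space \<Rightarrow> real"
  assumes "C2_on f S" "0 < h" and S: "\<And>s t. 0 \<le> s \<Longrightarrow> s \<le> h \<Longrightarrow> 0 \<le> t \<Longrightarrow> t \<le> h \<Longrightarrow> p + s *\<^sub>R v + t *\<^sub>R w \<in> S"
  shows "\<exists>s t. 0 < s \<and> s < h \<and> 0 < t \<and> t < h \<and>
    f (p + h *\<^sub>R v + h *\<^sub>R w) - f (p + h *\<^sub>R v) - (f (p + h *\<^sub>R w) - f p)
      = h * (h * fd (\<lambda>q. fd f q v) (p + s *\<^sub>R v + t *\<^sub>R w) w)"
proof -
  have df: "f differentiable (at q)" "(\<lambda>q. fd f q v) differentiable (at q)" if "q \<in> S" for q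
    using assms(1) that C2_on_fd[OF assms(1), of v] by (auto simp: C2_on_iff C1_on_iff)
  let ?g = "\<lambda>s. f (p + h *\<^sub>R w + s *\<^sub>R v) - f (p + s *\<^sub>R v)"
  have "(?g has_real_derivative fd f (p + h *\<^sub>R w + s *\<^sub>R v) v - fd f (p + s *\<^sub>R v) v) (at s)"
    if "0 \<le> s" "s \<le> h" for s
    using S[OF that, of h] S[OF that, of 0] assms(2)
    by (intro DERIV_diff DERIV_line df) (auto simp: algebra_simps)
  from MVT2[OF assms(2) this] obtain s where s: "0 < s" "s < h"
    "?g h - ?g 0 = h * (fd f (p + h *\<^sub>R w + s *\<^sub>R v) v - fd f (p + s *\<^sub>R v) v)" by auto
  have "((\<lambda>t. fd f (p + s *\<^sub>R v + t *\<^sub>R w) v) has_real_derivative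
      fd (\<lambda>q. fd f q v) (p + s *\<^sub>R v + t *\<^sub>R w) w) (at t)" if "0 \<le> t" "t \<le> h" for t
    using S[of s t] that s by (intro DERIV_line df) auto
  from MVT2[OF assms(2) this] obtain t where t: "0 < t" "t < h"
    "fd f (p + s *\<^sub>R v + h *\<^sub>R w) v - fd f (p + s *\<^sub>R v) v
       = h * fd (\<lambda>q. fd f q v) (p + s *\<^sub>R v + t *\<^sub>R w) w" by auto
  have "p + h *\<^sub>R w + s *\<^sub>R v = p + s *\<^sub>R v + h *\<^sub>R w"
    "p + h *\<^sub>R w + h *\<^sub>R v = p + h *\<^sub>R v + h *\<^sub>R w" by (simp_all add: algebra_simps)
  with s t show ?thesis by (intro exI[of _ s] exI[of _ t]) (simp add: algebra_simps)
qed

text \<open>Both mixed derivatives, taken at suitable points near \<open>p\<close>, equal the same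
  second difference divided by \<open>h * h\<close>; continuity removes the displacement of the
  points.\<close>

lemma symmetric_second_derivative_real:
  fixes f :: "'a::euclidean_space \<Rightarrow> real"
  assumes "open S" "C2_on f S" "p \<in> S"
  shows "fd (\<lambda>q. fd f q v) p w = fd (\<lambda>q. fd f q w) p v"
proof (rule ccontr)
  let ?A = "\<lambda>q. fd (\<lambda>q. fd f q v) q w" and ?B = "\<lambda>q. fd (\<lambda>q. fd f q w) q v"
  assume ne: "?A p \<noteq> ?B p"
  define e where "e = \<bar>?A p - ?B p\<bar> / 2"
  have e: "e > 0" using ne by (simp add: e_def)
  have cA: "isCont ?A p" and cB: "isCont ?B p"
    using C2_on_fd[OF assms(2), of v] C2_on_fd[OF assms(2), of w] assms(1,3)
    by (auto simp: C1_on_iff continuous_on_eq_continuous_at)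
  have "(?A \<longlongrightarrow> ?A p) (nhds p)" "(?B \<longlongrightarrow> ?B p) (nhds p)"
    using isCont_tendsto_nhds[OF cA] isCont_tendsto_nhds[OF cB] .
  from tendstoD[OF this(1) e] tendstoD[OF this(2) e] eventually_nhds_in_open[OF assms(1,3)]
  have "\<forall>\<^sub>F q in nhds p. q \<in> S \<and> dist (?A q) (?A p) < e \<and> dist (?B q) (?B p) < e"
    by eventually_elim blast
  then obtain d where d: "d > 0" "\<And>q. dist q p < d \<Longrightarrow> q \<in> S \<and> dist (?A q) (?A p) < e \<and> dist (?B q) (?B p) < e"
    unfolding eventually_nhds_metric by blast
  \<comment> \<open>Keeps the whole parallelogram spanned by \<open>h *\<^sub>R v\<close> and
    \<open>h *\<^sub>R w\<close> within \<open>d / 2\<close> of \<open>p\<close>; the added 1 covers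
    zero vectors.\<close>
  define h where "h = d / (2 * (norm v + norm w + 1))"
  have h: "0 < h" using d(1) by (simp add: h_def add_nonneg_pos)
  have near: "dist (p + s *\<^sub>R v + t *\<^sub>R w) p < d" if "0 \<le> s" "s \<le> h" "0 \<le> t" "t \<le> h" for s t
  proof -
    have "dist (p + s *\<^sub>R v + t *\<^sub>R w) p = norm (s *\<^sub>R v + t *\<^sub>R w)" by (simp add: dist_norm algebra_simps)
    also have "\<dots> \<le> s * norm v + t * norm w" using that by (intro norm_triangle_le) simp
    also have "\<dots> \<le> h * norm v + h * norm w" using that by (intro add_mono mult_right_mono) auto
    also have "\<dots> \<le> h * (norm v + norm w + 1)" using h by (simp add: algebra_simps)
    also have "\<dots> = d / 2"
    proof -
      have "norm v + norm w + 1 \<noteq> 0" by (smt (verit) norm_ge_zero)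
      then show ?thesis by (simp add: h_def field_simps)
    qed
    also have "\<dots> < d" using d(1) by simp
    finally show ?thesis .
  qed
  obtain s t where 1: "0 < s" "s < h" "0 < t" "t < h"
    "f (p + h *\<^sub>R v + h *\<^sub>R w) - f (p + h *\<^sub>R v) - (f (p + h *\<^sub>R w) - f p) = h * (h * ?A (p + s *\<^sub>R v + t *\<^sub>R w))"
    using mixed_difference_eq[OF assms(2) h, of p v w] near d(2) by blast
  have near': "dist (p + s *\<^sub>R w + t *\<^sub>R v) p < d" if "0 \<le> s" "s \<le> h" "0 \<le> t" "t \<le> h" for s t
    using near[of t s] that by (simp add: algebra_simps)
  obtain s' t' where 2: "0 < s'" "s' < h" "0 < t'" "t' < h"
    "f (p + h *\<^sub>R w + h *\<^sub>R v) - f (p + h *\<^sub>R w) - (f (p + h *\<^sub>R v) - f p) = h * (h * ?B (p + s' *\<^sub>R w + t' *\<^sub>R v))"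
    using mixed_difference_eq[OF assms(2) h, of p w v] near' d(2) by blast
  have "p + h *\<^sub>R w + h *\<^sub>R v = p + h *\<^sub>R v + h *\<^sub>R w" by (simp add: algebra_simps)
  with 1(5) 2(5) have "h * (h * ?A (p + s *\<^sub>R v + t *\<^sub>R w)) = h * (h * ?B (p + s' *\<^sub>R w + t' *\<^sub>R v))"
    by (simp add: algebra_simps)
  with h have eq: "?A (p + s *\<^sub>R v + t *\<^sub>R w) = ?B (p + s' *\<^sub>R w + t' *\<^sub>R v)" by simp
  have "dist (?A (p + s *\<^sub>R v + t *\<^sub>R w)) (?A p) < e" using d(2) near[of s t] 1 by auto
  moreover have "dist (?B (p + s' *\<^sub>R w + t' *\<^sub>R v)) (?B p) < e" using d(2) near'[of s' t'] 2 by auto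
  ultimately have "\<bar>?A p - ?B p\<bar> < e + e"
    using dist_triangle[of "?A p" "?B p" "?A (p + s *\<^sub>R v + t *\<^sub>R w)"] unfolding eq
    by (simp add: dist_real_def abs_minus_commute)
  then show False by (simp add: e_def)
qed

lemma symmetric_second_derivative:
  fixes f :: "'a::euclidean_space \<Rightarrow> 'b::euclidean_space"
  assumes "open S" "C2_on f S" "p \<in> S"
  shows "fd (\<lambda>q. fd f q v) p w = fd (\<lambda>q. fd f q w) p v"
proof (rule euclidean_eqI)
  fix i :: 'b assume "i \<in> Basis"
  have L: "bounded_linear (\<lambda>z::'b. z \<bullet> i)" by (rule bounded_linear_inner_left)
  have 1: "fd (\<lambda>q. f q \<bullet> i) q v = fd f q v \<bullet> i" if "q \<in> S" for q v
    using fd_eq[OF bounded_linear.has_derivative[OF L C2_onD[OF assms(2) that]]] by simp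
  have 2: "fd (\<lambda>q. fd (\<lambda>q. f q \<bullet> i) q v) p w = fd (\<lambda>q. fd f q v) p w \<bullet> i" for v w
  proof -
    have "fd (\<lambda>q. fd (\<lambda>q. f q \<bullet> i) q v) p = fd (\<lambda>q. fd f q v \<bullet> i) p"
      by (rule fd_cong_open[OF assms(1,3)]) (rule 1)
    also have "\<dots> = (\<lambda>w. fd (\<lambda>q. fd f q v) p w \<bullet> i)"
      by (rule fd_eq, rule bounded_linear.has_derivative[OF L], rule C1_onD[OF C2_on_fd[OF assms(2)] assms(3)])
    finally show ?thesis by simp
  qed
  have "C2_on (\<lambda>q. f q \<bullet> i) S" by (rule C2_on_bounded_linear[OF assms(1) L assms(2)])
  from symmetric_second_derivative_real[OF assms(1) this assms(3), of v w]
  show "fd (\<lambda>q. fd f q v) p w \<bullet> i = fd (\<lambda>q. fd f q w) p v \<bullet> i" by (simp add: 2)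
qed

text \<open>A positive second derivative along \<open>v\<close> would make the slope, which vanishes
  at \<open>p\<close>, positive just after it, and the mean value theorem would give a larger
  value.\<close>

lemma second_derivative_test:
  fixes f :: "'a::euclidean_space \<Rightarrow> real"
  assumes S: "open S" "p \<in> S" and f: "C2_on f S" and max: "\<And>q. q \<in> S \<Longrightarrow> f q \<le> f p"
  shows "fd f p v = 0" "fd (\<lambda>q. fd f q v) p v \<le> 0"
proof -
  have "fd f p = (\<lambda>v. 0)"
    using max by (intro differential_zero_maxmin[OF S(2,1) C2_onD[OF f S(2)]] disjI1 ballI)
  then have zero: "fd f p v = 0" for v by simp
  then show "fd f p v = 0" .
  show "fd (\<lambda>q. fd f q v) p v \<le> 0"
  proof (rule ccontr)
    assume "\<not> ?thesis"
    then have pos: "0 < fd (\<lambda>q. fd f q v) p v" by simp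
    have "((\<lambda>s. fd f (p + s *\<^sub>R v) v) has_real_derivative fd (\<lambda>q. fd f q v) p v) (at 0)"
      using DERIV_line[of "\<lambda>q. fd f q v" p 0 v] C2_on_fd[OF f, of v] S by (simp add: C1_on_iff)
    from DERIV_pos_inc_right[OF this pos] obtain d where
      d: "d > 0" "\<And>h. 0 < h \<Longrightarrow> h < d \<Longrightarrow> 0 < fd f (p + h *\<^sub>R v) v"
      by (auto simp: zero)
    have "((\<lambda>s. p + s *\<^sub>R v) \<longlongrightarrow> p) (at_right 0)" by (auto intro!: tendsto_eq_intros)
    then have "\<forall>\<^sub>F s in at_right (0::real). p + s *\<^sub>R v \<in> S" using S by (auto dest: topological_tendstoD)
    then obtain b where b: "b > 0" "\<And>s. 0 < s \<Longrightarrow> s < b \<Longrightarrow> p + s *\<^sub>R v \<in> S"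
      unfolding eventually_at_right_field by auto
    define h where "h = min d b / 2"
    have h: "0 < h" "h < d" "h < b" using d b by (auto simp: h_def)
    have inS: "p + s *\<^sub>R v \<in> S" if "0 \<le> s" "s \<le> h" for s
      using b(2)[of s] h S(2) that by (cases "s = 0") auto
    have "((\<lambda>s. f (p + s *\<^sub>R v)) has_real_derivative fd f (p + s *\<^sub>R v) v) (at s)" if "0 \<le> s" "s \<le> h" for s
      using inS[OF that] f by (intro DERIV_line) (simp add: C2_on_iff)
    from MVT2[OF h(1) this] obtain s where s: "0 < s" "s < h" "f (p + h *\<^sub>R v) - f p = h * fd f (p + s *\<^sub>R v) v"
      by auto
    have "0 < h * fd f (p + s *\<^sub>R v) v" using h d(2)[of s] s by simp
    with s(3) max[OF inS[of h]] h show False by simp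
  qed
qed

lemma linear_fd_of_linear:
  assumes "open S" "p \<in> S" "\<And>q. q \<in> S \<Longrightarrow> linear (L q)" "\<And>v. (\<lambda>q. L q v) differentiable (at p)"
  shows "linear (\<lambda>v. fd (\<lambda>q. L q v) p w)"
proof (rule linearI)
  have D: "((\<lambda>q. L q v) has_derivative fd (\<lambda>q. L q v) p) (at p)" for v
    using assms(4) by (simp add: frechet_derivative_works)
  show "fd (\<lambda>q. L q (v + v')) p w = fd (\<lambda>q. L q v) p w + fd (\<lambda>q. L q v') p w" for v v'
  proof -
    have "fd (\<lambda>q. L q (v + v')) p = fd (\<lambda>q. L q v + L q v') p"
      by (rule fd_cong_open[OF assms(1,2)]) (simp add: linear_add[OF assms(3)])
    then show ?thesis using fd_eq[OF has_derivative_add[OF D D]] by simp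
  qed
  show "fd (\<lambda>q. L q (r *\<^sub>R v)) p w = r *\<^sub>R fd (\<lambda>q. L q v) p w" for r v
  proof -
    have "fd (\<lambda>q. L q (r *\<^sub>R v)) p = fd (\<lambda>q. r *\<^sub>R L q v) p"
      by (rule fd_cong_open[OF assms(1,2)]) (simp add: linear_scale[OF assms(3)])
    then show ?thesis using fd_eq[OF has_derivative_scaleR_right[OF D]] by simp
  qed
qed

text \<open>Definiteness makes the map from \<open>z\<close> to the coefficients of
  \<open>b z\<close> injective, hence surjective in finite dimension.\<close>

lemma riesz_bilinear:
  fixes b :: "'a::euclidean_space \<Rightarrow> 'a \<Rightarrow> real"
  assumes lin: "\<And>w. linear (\<lambda>v. b v w)" "\<And>v. linear (b v)" and pos: "\<And>v. v \<noteq> 0 \<Longrightarrow> 0 < b v v" and l: "linear l"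
  shows "\<exists>!z. \<forall>u. b z u = l u"
proof -
  have uniq: "z = z'" if "\<And>u. b z u = b z' u" for z z'
  proof -
    have "b (z - z') (z - z') = 0" using that linear_diff[OF lin(1)] by simp
    with pos[of "z - z'"] show ?thesis by force
  qed
  define \<Phi> where "\<Phi> z = (\<Sum>i\<in>Basis. b z i *\<^sub>R i)" for z :: 'a
  have \<Phi>_inner: "\<Phi> z \<bullet> i = b z i" if "i \<in> Basis" for z i
    using that by (simp add: \<Phi>_def)
  have ext: "b z u = l' u" if "\<And>i. i \<in> Basis \<Longrightarrow> b z i = l' i" "linear l'" for z u l'
    using that linear_eq_sum_Basis[OF lin(2), of z u] linear_eq_sum_Basis[OF that(2), of u] by simp
  have "linear \<Phi>"
    by (rule linearI)
       (simp_all add: \<Phi>_def linear_add[OF lin(1)] linear_scale[OF lin(1)] scaleR_add_left sum.distrib scaleR_sum_right)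
  moreover have "inj \<Phi>"
  proof (rule injI)
    fix z z' assume "\<Phi> z = \<Phi> z'"
    then have "b z i = b z' i" if "i \<in> Basis" for i using \<Phi>_inner[OF that] by metis
    from ext[OF this lin(2)] show "z = z'" using uniq by blast
  qed
  ultimately have "surj \<Phi>" by (simp add: linear_injective_imp_surjective)
  then obtain z where "\<Phi> z = (\<Sum>i\<in>Basis. l i *\<^sub>R i)" by (metis surjD)
  then have "b z i = l i" if "i \<in> Basis" for i using \<Phi>_inner[OF that, of z] that by simp
  from ext[OF this l] uniq show ?thesis by metis
qed

section \<open>Charts, tangent vectors and the Hessian\<close>

locale riemannian =
  fixes \<A> :: "('m::{t2_space,second_countable_topology}, 'a::euclidean_space) chart set"
    and g :: "('m, 'a) metric"
  assumes riem: "riemannian_manifold \<A> g"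
begin

abbreviation tr where "tr \<equiv> transition"
abbreviation ov :: "('m, 'a) chart \<Rightarrow> 'm set \<Rightarrow> 'a set" where "ov c N \<equiv> snd c ` (fst c \<inter> N)"
abbreviation tv where "tv \<equiv> tangent_vector \<A>"
abbreviation gm where "gm \<equiv> metric_coord \<A> g"

definition jac :: "('m, 'a) chart \<Rightarrow> ('m, 'a) chart \<Rightarrow> 'm \<Rightarrow> 'a \<Rightarrow> 'a" where
  "jac c d x = fd (tr c d) (snd c x)"

lemma atlas: "smooth_atlas \<A>" using riem by (simp add: riemannian_manifold_def)

lemma ex_chart: "\<exists>c\<in>\<A>. x \<in> fst c"
proof -
  have "x \<in> (\<Union>c\<in>\<A>. fst c)" using atlas by (simp add: smooth_atlas_def)
  then show ?thesis by blast
qed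

lemma some_chart: "some_chart \<A> x \<in> \<A>" "x \<in> fst (some_chart \<A> x)"
proof -
  have "\<exists>c. c \<in> \<A> \<and> x \<in> fst c" using ex_chart[of x] by blast
  from someI_ex[OF this] show "some_chart \<A> x \<in> \<A>" "x \<in> fst (some_chart \<A> x)"
    unfolding some_chart_def by blast+
qed

lemma chart:
  assumes "c \<in> \<A>"
  shows "open (fst c)" "open (chart_image c)" "continuous_on (fst c) (snd c)"
    "continuous_on (chart_image c) (chart_inv c)"
    "\<And>x. x \<in> fst c \<Longrightarrow> chart_inv c (snd c x) = x"
    "\<And>p. p \<in> chart_image c \<Longrightarrow> snd c (chart_inv c p) = p"
    "\<And>p. p \<in> chart_image c \<Longrightarrow> chart_inv c p \<in> fst c"
proof -
  have "is_chart c" using atlas assms by (simp add: smooth_atlas_def)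
  then have *: "open (fst c)" "open (chart_image c)"
    "homeomorphism (fst c) (chart_image c) (snd c) (chart_inv c)" by (auto simp: is_chart_def)
  show "open (fst c)" "open (chart_image c)" "continuous_on (fst c) (snd c)"
    "continuous_on (chart_image c) (chart_inv c)" using * by (auto simp: homeomorphism_def)
  show "chart_inv c (snd c x) = x" if "x \<in> fst c" for x using * that by (auto simp: homeomorphism_def)
  show "snd c (chart_inv c p) = p" "chart_inv c p \<in> fst c" if "p \<in> chart_image c" for p
    using *(3) that unfolding homeomorphism_def by blast+
qed

lemma mem_ov: "c \<in> \<A> \<Longrightarrow> p \<in> ov c N \<longleftrightarrow> p \<in> chart_image c \<and> chart_inv c p \<in> N"
  using chart(5,6,7)[of c] by (auto intro: rev_image_eqI)

lemma open_ov:
  assumes "c \<in> \<A>" "open N"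
  shows "open (ov c N)"
proof -
  have "open (chart_image c \<inter> chart_inv c -` N)"
    by (rule continuous_open_preimage[OF chart(4,2)[OF assms(1)] assms(2)])
  also have "chart_image c \<inter> chart_inv c -` N = ov c N" using mem_ov[OF assms(1)] by auto
  finally show ?thesis .
qed

lemma open_domain_preimage:
  assumes "c \<in> \<A>" "open R"
  shows "open (fst c \<inter> snd c -` R)"
  by (rule continuous_open_preimage[OF chart(3,1)[OF assms(1)] assms(2)])

lemma tr_C2:
  assumes "c \<in> \<A>" "d \<in> \<A>"
  shows "C2_on (tr c d) (ov c (fst d))"
  using atlas assms by (auto simp: smooth_atlas_def smooth_on_def C2_on_def)

lemma tr_apply: "c \<in> \<A> \<Longrightarrow> x \<in> fst c \<Longrightarrow> tr c d (snd c x) = snd d x"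
  by (simp add: transition_def chart)

lemma tr_image: "c \<in> \<A> \<Longrightarrow> p \<in> ov c (fst d \<inter> N) \<Longrightarrow> tr c d p \<in> ov d (fst c \<inter> N)"
proof -
  assume c: "c \<in> \<A>" and "p \<in> ov c (fst d \<inter> N)"
  then obtain x where "x \<in> fst c" "x \<in> fst d" "x \<in> N" "p = snd c x" by blast
  with tr_apply[OF c, of x d] show ?thesis by auto
qed

lemma tr_self: "c \<in> \<A> \<Longrightarrow> p \<in> chart_image c \<Longrightarrow> tr c c p = p"
  by (simp add: transition_def chart)

lemma chart_inv_tr:
  assumes "c \<in> \<A>" "d \<in> \<A>" "p \<in> ov c (fst d)"
  shows "chart_inv d (tr c d p) = chart_inv c p"
  using assms chart by (auto simp: transition_def)

text \<open>Cocycle identity on triple overlaps, from the chain rule; it is what makes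
  \<open>tangent_vector\<close> land in the tangent space.\<close>

lemma jac_chain:
  assumes c: "c \<in> \<A>" "d \<in> \<A>" "e \<in> \<A>" and x: "x \<in> fst c" "x \<in> fst d" "x \<in> fst e"
  shows "jac c e x v = jac d e x (jac c d x v)"
proof -
  let ?S = "ov c (fst d \<inter> fst e)"
  have S: "open ?S" "snd c x \<in> ?S" using c x by (auto intro: open_ov chart)
  have "fd (tr c e) (snd c x) = fd (\<lambda>q. tr d e (tr c d q)) (snd c x)"
  proof (rule fd_cong_open[OF S])
    fix q assume "q \<in> ?S"
    then show "tr c e q = tr d e (tr c d q)" using c by (auto simp: transition_def chart)
  qed
  also have "\<dots> = (\<lambda>v. fd (tr d e) (tr c d (snd c x)) (fd (tr c d) (snd c x) v))"
    using tr_C2[OF c(1,2)] tr_C2[OF c(2,3)] x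
    by (intro fd_eq[OF fd_compose]) (auto simp: C2_on_iff tr_apply[OF c(1)])
  finally show ?thesis using x by (simp add: jac_def tr_apply[OF c(1)])
qed

lemma jac_self:
  assumes "c \<in> \<A>" "x \<in> fst c"
  shows "jac c c x v = v"
proof -
  have "fd (tr c c) (snd c x) = fd (\<lambda>q. q) (snd c x)"
    using assms by (intro fd_cong_open[OF chart(2)[OF assms(1)]]) (auto simp: tr_self)
  also have "\<dots> = (\<lambda>v. v)" by (rule fd_eq) (auto intro: derivative_intros)
  finally show ?thesis by (simp add: jac_def)
qed

lemma linear_jac:
  assumes "c \<in> \<A>" "d \<in> \<A>" "x \<in> fst c" "x \<in> fst d"
  shows "linear (jac c d x)"
  unfolding jac_def using tr_C2[OF assms(1,2)] assms by (intro linear_fd) (auto simp: C2_on_iff)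

lemma tv_apply: "tv c x v d = (if d \<in> \<A> \<and> x \<in> fst d then jac c d x v else 0)"
  by (simp add: tangent_vector_def jac_def)

lemma tv_coord: "c \<in> \<A> \<Longrightarrow> x \<in> fst c \<Longrightarrow> tv c x v c = v"
  by (simp add: tv_apply jac_self)

lemma tangent_space_iff:
  "\<xi> \<in> tangent_space \<A> x \<longleftrightarrow> (\<forall>c\<in>\<A>. \<forall>d\<in>\<A>. x \<in> fst c \<inter> fst d \<longrightarrow> \<xi> d = jac c d x (\<xi> c)) \<and>
     (\<forall>c. \<not> (c \<in> \<A> \<and> x \<in> fst c) \<longrightarrow> \<xi> c = 0)"
  by (simp add: tangent_space_def jac_def)

lemma tv_in: "c \<in> \<A> \<Longrightarrow> x \<in> fst c \<Longrightarrow> tv c x v \<in> tangent_space \<A> x"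
  by (auto simp: tangent_space_iff tv_apply intro: jac_chain)

lemma tv_repr:
  assumes "\<xi> \<in> tangent_space \<A> x" "c \<in> \<A>" "x \<in> fst c"
  shows "tv c x (\<xi> c) = \<xi>"
proof
  fix d
  have *: "\<And>c d. c \<in> \<A> \<Longrightarrow> d \<in> \<A> \<Longrightarrow> x \<in> fst c \<inter> fst d \<Longrightarrow> \<xi> d = jac c d x (\<xi> c)"
    "\<And>c. \<not> (c \<in> \<A> \<and> x \<in> fst c) \<Longrightarrow> \<xi> c = 0" using assms(1) unfolding tangent_space_iff by blast+
  show "tv c x (\<xi> c) d = \<xi> d"
    using *(1)[of c d] *(2)[of d] assms(2,3) unfolding tv_apply by auto
qed

lemma tangent_coord_change:
  "\<xi> \<in> tangent_space \<A> x \<Longrightarrow> c \<in> \<A> \<Longrightarrow> d \<in> \<A> \<Longrightarrow> x \<in> fst c \<Longrightarrow> x \<in> fst d \<Longrightarrow> \<xi> d = jac c d x (\<xi> c)"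
  unfolding tangent_space_iff by blast

lemma tv_linear:
  assumes "c \<in> \<A>" "x \<in> fst c"
  shows "tv c x (a *\<^sub>R v + b *\<^sub>R w) = (\<lambda>e. a *\<^sub>R tv c x v e + b *\<^sub>R tv c x w e)"
  using assms linear_jac by (auto simp: tv_apply fun_eq_iff linear_add linear_scale)

lemma tv_change:
  assumes "c \<in> \<A>" "d \<in> \<A>" "x \<in> fst c" "x \<in> fst d"
  shows "tv d x (jac c d x v) = tv c x v"
  using jac_chain[OF assms(1,2) _ assms(3,4)] by (auto simp: tv_apply fun_eq_iff)

section \<open>The metric in coordinates and its Christoffel symbols\<close>

lemma g_sym_forms: "g x \<in> sym_forms \<A> x"
  and g_pos: "\<xi> \<in> tangent_space \<A> x \<Longrightarrow> \<xi> \<noteq> (\<lambda>c. 0) \<Longrightarrow> 0 < g x \<xi> \<xi>"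
  using riem by (auto simp: riemannian_manifold_def)

lemma sym_formsD:
  assumes "A \<in> sym_forms \<A> x" "c \<in> \<A>" "x \<in> fst c"
  shows "A (tv c x v) (tv c x w) = A (tv c x w) (tv c x v)"
    "A (tv c x (a *\<^sub>R v + b *\<^sub>R u)) (tv c x w) = a * A (tv c x v) (tv c x w) + b * A (tv c x u) (tv c x w)"
  using assms tv_in[OF assms(2,3)] unfolding sym_forms_def tv_linear[OF assms(2,3)] by blast+

lemma gm_apply:
  "c \<in> \<A> \<Longrightarrow> x \<in> fst c \<Longrightarrow> gm c (snd c x) v w = g x (tv c x v) (tv c x w)"
  by (simp add: metric_coord_def chart)

lemma gm_sym: "c \<in> \<A> \<Longrightarrow> p \<in> chart_image c \<Longrightarrow> gm c p v w = gm c p w v"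
  unfolding metric_coord_def using sym_formsD(1)[OF g_sym_forms] chart(7) by blast

lemma gm_linear1: "c \<in> \<A> \<Longrightarrow> p \<in> chart_image c \<Longrightarrow> linear (\<lambda>v. gm c p v w)"
proof (rule linearI)
  assume c: "c \<in> \<A>" "p \<in> chart_image c"
  note * = sym_formsD(2)[OF g_sym_forms c(1) chart(7)[OF c], folded metric_coord_def]
  show "gm c p (v + v') w = gm c p v w + gm c p v' w" for v v' using *[of 1 v 1 v' w] by simp
  show "gm c p (r *\<^sub>R v) w = r *\<^sub>R gm c p v w" for r v using *[of r v 0 v w] by simp
qed

lemma gm_linear2: "c \<in> \<A> \<Longrightarrow> p \<in> chart_image c \<Longrightarrow> linear (gm c p v)"
proof -
  assume c: "c \<in> \<A>" "p \<in> chart_image c"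
  have "gm c p v = (\<lambda>w. gm c p w v)" using gm_sym[OF c] by blast
  then show ?thesis using gm_linear1[OF c] by simp
qed

lemma gm_pos:
  assumes "c \<in> \<A>" "p \<in> chart_image c" "v \<noteq> 0"
  shows "0 < gm c p v v"
proof -
  have "tv c (chart_inv c p) v c \<noteq> 0" using tv_coord[OF assms(1) chart(7)[OF assms(1,2)]] assms(3) by simp
  then have "tv c (chart_inv c p) v \<noteq> (\<lambda>c. 0)" by metis
  then show ?thesis unfolding metric_coord_def by (intro g_pos tv_in assms chart)
qed

lemma gm_C1:
  assumes "c \<in> \<A>"
  shows "C1_on (\<lambda>p. gm c p v w) (chart_image c)"
proof -
  have "smooth_on (chart_image c) (\<lambda>p. gm c p v w)" using riem assms by (simp add: riemannian_manifold_def)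
  then show ?thesis unfolding smooth_on_def C1_on_def by blast
qed

lemma gm_riesz:
  assumes "c \<in> \<A>" "p \<in> chart_image c" "linear l"
  shows "\<exists>!z. \<forall>u. gm c p z u = l u"
  using gm_linear1[OF assms(1,2)] gm_linear2[OF assms(1,2)] gm_pos[OF assms(1,2)] assms(3)
  by (rule riesz_bilinear)

lemma gm_cancel:
  assumes "c \<in> \<A>" "p \<in> chart_image c" "\<And>u. gm c p z u = gm c p z' u"
  shows "z = z'"
  using gm_riesz[OF assms(1,2) gm_linear2[OF assms(1,2), of z']] assms(3) by auto

lemma gm_tr:
  assumes "c \<in> \<A>" "d \<in> \<A>" "p \<in> ov c (fst d)"
  shows "gm c p v w = gm d (tr c d p) (fd (tr c d) p v) (fd (tr c d) p w)"
proof -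
  obtain x where x: "x \<in> fst c" "x \<in> fst d" "p = snd c x" using assms by blast
  have "fd (tr c d) p a = jac c d x a" for a by (simp add: jac_def x(3))
  moreover have "tr c d p = snd d x" using tr_apply[OF assms(1) x(1)] x(3) by simp
  ultimately show ?thesis
    by (simp only: x(3) gm_apply[OF assms(1) x(1)] gm_apply[OF assms(2) x(2)] tv_change[OF assms(1,2) x(1,2)])
qed

text \<open>Christoffel symbols of the first kind, contracted with \<open>v\<close>,
  \<open>w\<close> and \<open>u\<close>; the right-hand side in the definition of
  \<open>christoffel\<close>.\<close>

definition koszul :: "('m, 'a) chart \<Rightarrow> 'a \<Rightarrow> 'a \<Rightarrow> 'a \<Rightarrow> 'a \<Rightarrow> real" where
  "koszul c p v w u = (fd (\<lambda>q. gm c q w u) p v + fd (\<lambda>q. gm c q v u) p w - fd (\<lambda>q. gm c q v w) p u) / 2"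

abbreviation \<Gamma> where "\<Gamma> \<equiv> christoffel \<A> g"

lemma gm_differentiable: "c \<in> \<A> \<Longrightarrow> p \<in> chart_image c \<Longrightarrow> (\<lambda>p. gm c p v w) differentiable (at p)"
  by (rule C1_on_differentiable[OF gm_C1])

lemma gm_fd_linear:
  assumes "c \<in> \<A>" "p \<in> chart_image c"
  shows "linear (\<lambda>v. fd (\<lambda>q. gm c q v w) p u)" "linear (\<lambda>w. fd (\<lambda>q. gm c q v w) p u)"
    "linear (\<lambda>u. fd (\<lambda>q. gm c q v w) p u)"
proof -
  show "linear (\<lambda>v. fd (\<lambda>q. gm c q v w) p u)"
    by (rule linear_fd_of_linear[OF chart(2)[OF assms(1)] assms(2) gm_linear1[OF assms(1)] gm_differentiable[OF assms]])
  show "linear (\<lambda>w. fd (\<lambda>q. gm c q v w) p u)"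
    by (rule linear_fd_of_linear[OF chart(2)[OF assms(1)] assms(2) gm_linear2[OF assms(1)] gm_differentiable[OF assms]])
  show "linear (\<lambda>u. fd (\<lambda>q. gm c q v w) p u)"
    by (rule linear_fd[OF gm_differentiable[OF assms]])
qed

lemma koszul_linear:
  assumes "c \<in> \<A>" "p \<in> chart_image c"
  shows "linear (koszul c p v w)"
    "koszul c p (r *\<^sub>R v + s *\<^sub>R v') w u = r * koszul c p v w u + s * koszul c p v' w u"
proof -
  define D where "D v w u = fd (\<lambda>q. gm c q v w) p u" for v w u
  have add: "D (v + v') w u = D v w u + D v' w u" "D v (w + w') u = D v w u + D v w' u"
      "D v w (u + u') = D v w u + D v w u'" for v v' w w' u u'
    using linear_add[OF gm_fd_linear(1)[OF assms]] linear_add[OF gm_fd_linear(2)[OF assms]]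
      linear_add[OF gm_fd_linear(3)[OF assms]] by (simp_all add: D_def)
  have scale: "D (r *\<^sub>R v) w u = r * D v w u" "D v (r *\<^sub>R w) u = r * D v w u"
      "D v w (r *\<^sub>R u) = r * D v w u" for v w u r
    using linear_scale[OF gm_fd_linear(1)[OF assms]] linear_scale[OF gm_fd_linear(2)[OF assms]]
      linear_scale[OF gm_fd_linear(3)[OF assms]] by (simp_all add: D_def)
  have k: "koszul c p v w u = (D w u v + D v u w - D v w u) / 2" for v w u
    by (simp add: koszul_def D_def)
  show "linear (koszul c p v w)"
    by (rule linearI) (simp_all add: k add scale algebra_simps add_divide_distrib diff_divide_distrib)
  show "koszul c p (r *\<^sub>R v + s *\<^sub>R v') w u = r * koszul c p v w u + s * koszul c p v' w u"
    by (simp add: k add scale algebra_simps add_divide_distrib diff_divide_distrib)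
qed

lemma koszul_sym:
  assumes "c \<in> \<A>" "p \<in> chart_image c"
  shows "koszul c p v w u = koszul c p w v u"
proof -
  have "fd (\<lambda>q. gm c q v w) p = fd (\<lambda>q. gm c q w v) p"
    by (rule fd_cong_open[OF chart(2)[OF assms(1)] assms(2)]) (rule gm_sym[OF assms(1)])
  then show ?thesis by (simp add: koszul_def)
qed

text \<open>The definite description is legitimate because the Koszul expression is linear in
  \<open>u\<close> and the metric is positive definite.\<close>

lemma christoffel:
  assumes "c \<in> \<A>" "p \<in> chart_image c"
  shows "gm c p (\<Gamma> c p v w) u = koszul c p v w u"
proof -
  have "\<Gamma> c p v w = (THE z. \<forall>u. gm c p z u = koszul c p v w u)"
    by (simp add: christoffel_def koszul_def)
  with theI'[OF gm_riesz[OF assms koszul_linear(1)[OF assms]]] show ?thesis by metis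
qed

lemma christoffel_sym: "c \<in> \<A> \<Longrightarrow> p \<in> chart_image c \<Longrightarrow> \<Gamma> c p v w = \<Gamma> c p w v"
  by (rule gm_cancel) (auto simp: christoffel koszul_sym)

lemma christoffel_linear1:
  assumes "c \<in> \<A>" "p \<in> chart_image c"
  shows "\<Gamma> c p (r *\<^sub>R v + s *\<^sub>R v') w = r *\<^sub>R \<Gamma> c p v w + s *\<^sub>R \<Gamma> c p v' w"
proof (rule gm_cancel[OF assms])
  show "gm c p (\<Gamma> c p (r *\<^sub>R v + s *\<^sub>R v') w) u = gm c p (r *\<^sub>R \<Gamma> c p v w + s *\<^sub>R \<Gamma> c p v' w) u" for u
    using linear_add[OF gm_linear1[OF assms, where w = u]] linear_scale[OF gm_linear1[OF assms, where w = u]]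
    by (simp add: christoffel[OF assms] koszul_linear(2)[OF assms])
qed

text \<open>The inhomogeneous term of the transformation law comes from differentiating \<open>gm_tr\<close>.\<close>

lemma fd_gm_tr:
  assumes c: "c \<in> \<A>" "d \<in> \<A>" and p: "p \<in> ov c (fst d)"
  defines "t \<equiv> tr c d"
  shows "fd (\<lambda>q. gm c q v w) p u =
    fd (\<lambda>q. gm d q (fd t p v) (fd t p w)) (t p) (fd t p u)
      + gm d (t p) (fd t p v) (fd (\<lambda>q. fd t q w) p u)
      + gm d (t p) (fd (\<lambda>q. fd t q v) p u) (fd t p w)"
proof -
  let ?S = "ov c (fst d)"
  have S: "open ?S" using c by (intro open_ov chart)
  have t_im: "t q \<in> chart_image d" if "q \<in> ?S" for q using tr_image[OF c(1), of q d UNIV] that by (auto simp: t_def)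
  have t: "C2_on t ?S" unfolding t_def by (rule tr_C2[OF c])
  have dt: "(\<lambda>q. fd t q v) differentiable (at p)" for v using C1_on_differentiable[OF C2_on_fd[OF t] p] .
  have g: "((\<lambda>q. gm d (t q) a b) has_derivative (\<lambda>u. fd (\<lambda>q. gm d q a b) (t p) (fd t p u))) (at p)" for a b
    by (rule fd_compose[OF gm_differentiable[OF c(2) t_im[OF p]] C2_on_differentiable[OF t p]])
  have 2: "((\<lambda>q. gm d (t q) a (fd t q w)) has_derivative
      (\<lambda>u. fd (\<lambda>q. gm d (t q) a (fd t p w)) p u + gm d (t p) a (fd (\<lambda>q. fd t q w) p u))) (at p)" for a
    by (rule has_derivative_apply_linear[OF S p gm_linear2[OF c(2) t_im] differentiableI[OF g] dt])
  have "((\<lambda>q. gm d (t q) (fd t q v) (fd t q w)) has_derivative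
      (\<lambda>u. fd (\<lambda>q. gm d (t q) (fd t p v) (fd t q w)) p u + gm d (t p) (fd (\<lambda>q. fd t q v) p u) (fd t p w))) (at p)"
    by (rule has_derivative_apply_linear[OF S p gm_linear1[OF c(2) t_im] differentiableI[OF 2] dt])
  moreover have "fd (\<lambda>q. gm c q v w) p = fd (\<lambda>q. gm d (t q) (fd t q v) (fd t q w)) p"
    unfolding t_def by (rule fd_cong_open[OF S p]) (rule gm_tr[OF c])
  ultimately show ?thesis using fd_eq[OF g] fd_eq[OF 2] by (simp add: fd_eq)
qed

text \<open>Inserting \<open>fd_gm_tr\<close> into the Koszul expression produces six terms with
  second derivatives of the transition map. Symmetry cancels four of them and makes the other two
  equal, which leaves the inhomogeneous term.\<close>

lemma christoffel_tr:
  assumes c: "c \<in> \<A>" "d \<in> \<A>" and p: "p \<in> ov c (fst d)"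
  defines "t \<equiv> tr c d"
  shows "fd t p (\<Gamma> c p v w) = \<Gamma> d (t p) (fd t p v) (fd t p w) + fd (\<lambda>q. fd t q w) p v"
proof -
  let ?S = "ov c (fst d)"
  have S: "open ?S" using c by (intro open_ov chart)
  have tp: "t p \<in> chart_image d" using tr_image[OF c(1), of p d UNIV] p by (auto simp: t_def)
  have pc: "p \<in> chart_image c" using p by blast
  have sym: "fd (\<lambda>q. fd t q a) p b = fd (\<lambda>q. fd t q b) p a" for a b
    unfolding t_def by (rule symmetric_second_derivative[OF S tr_C2[OF c] p])
  note gsym = gm_sym[OF c(2) tp]
  have gadd: "gm d (t p) (a + b) e = gm d (t p) a e + gm d (t p) b e" for a b e
    by (rule linear_add[OF gm_linear1[OF c(2) tp]])
  have "koszul c p v w u = koszul d (t p) (fd t p v) (fd t p w) (fd t p u)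
      + gm d (t p) (fd (\<lambda>q. fd t q w) p v) (fd t p u)" for u
    unfolding koszul_def fd_gm_tr[OF c p, folded t_def]
    using gsym[of "fd t p w" "fd (\<lambda>q. fd t q u) p v"] gsym[of "fd t p v" "fd (\<lambda>q. fd t q u) p w"]
      gsym[of "fd t p v" "fd (\<lambda>q. fd t q w) p u"] sym[of u v] sym[of u w] sym[of v w]
    by (simp add: field_simps)
  then have *: "gm d (t p) (fd t p (\<Gamma> c p v w)) (fd t p u)
      = gm d (t p) (\<Gamma> d (t p) (fd t p v) (fd t p w) + fd (\<lambda>q. fd t q w) p v) (fd t p u)" for u
    using gm_tr[OF c p, folded t_def, of "\<Gamma> c p v w" u]
    by (simp add: gadd christoffel[OF c(1) pc] christoffel[OF c(2) tp])
  show ?thesis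
  proof (rule gm_cancel[OF c(2) tp])
    fix u
    obtain x where x: "x \<in> fst c" "x \<in> fst d" "p = snd c x" using p by blast
    \<comment> \<open>The Jacobian of a transition map is onto, so testing against vectors of the
      form \<open>fd t p u\<close> suffices for cancelling the metric.\<close>
    have "u = fd t p (jac d c x u)"
      using jac_chain[OF c(2,1,2) x(2,1,2)] jac_self[OF c(2) x(2)] by (simp add: jac_def[of c d] x t_def)
    with *[of "jac d c x u"] show "gm d (t p) (fd t p (\<Gamma> c p v w)) u =
        gm d (t p) (\<Gamma> d (t p) (fd t p v) (fd t p w) + fd (\<lambda>q. fd t q w) p v) u" by metis
  qed
qed

definition hess_coord :: "('m, 'a) chart \<Rightarrow> ('m \<Rightarrow> real) \<Rightarrow> 'a \<Rightarrow> 'a \<Rightarrow> 'a \<Rightarrow> real" where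
  "hess_coord c \<phi> p v w = fd (\<lambda>q. fd (\<phi> \<circ> chart_inv c) q w) p v - fd (\<phi> \<circ> chart_inv c) p (\<Gamma> c p v w)"

lemma C2_near_iff: "C2_near \<A> x \<phi> \<longleftrightarrow> (\<exists>N. open N \<and> x \<in> N \<and> (\<forall>c\<in>\<A>. C2_on (\<phi> \<circ> chart_inv c) (ov c N)))"
  by (simp add: C2_near_def C2_on_def)

lemma coord_tr:
  assumes c: "c \<in> \<A>" "d \<in> \<A>" and p: "p \<in> ov c (fst d)"
  shows "(\<phi> \<circ> chart_inv c) p = (\<phi> \<circ> chart_inv d) (tr c d p)"
  using assms chart_inv_tr by simp

lemma fd_coord_tr:
  assumes c: "c \<in> \<A>" "d \<in> \<A>" and x: "x \<in> fst c" "x \<in> fst d" and \<phi>: "C2_near \<A> x \<phi>"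
  shows "fd (\<phi> \<circ> chart_inv c) (snd c x) v = fd (\<phi> \<circ> chart_inv d) (snd d x) (jac c d x v)"
proof -
  obtain N where N: "open N" "x \<in> N" "\<And>c. c \<in> \<A> \<Longrightarrow> C2_on (\<phi> \<circ> chart_inv c) (ov c N)"
    using \<phi> by (auto simp: C2_near_iff)
  have "fd (\<phi> \<circ> chart_inv c) (snd c x) = fd (\<lambda>q. (\<phi> \<circ> chart_inv d) (tr c d q)) (snd c x)"
    using c x by (intro fd_cong_open[of "ov c (fst d)"] coord_tr) (auto intro!: open_ov chart)
  also have "\<dots> = (\<lambda>v. fd (\<phi> \<circ> chart_inv d) (tr c d (snd c x)) (fd (tr c d) (snd c x) v))"
  proof (rule fd_eq[OF fd_compose])
    show "\<phi> \<circ> chart_inv d differentiable at (tr c d (snd c x))"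
      unfolding tr_apply[OF c(1) x(1)] by (rule C2_on_differentiable[OF N(3)[OF c(2)]]) (use N(2) x in blast)
    show "tr c d differentiable at (snd c x)"
      by (rule C2_on_differentiable[OF tr_C2[OF c]]) (use x in blast)
  qed
  finally show ?thesis using x by (simp add: jac_def tr_apply[OF c(1)])
qed

text \<open>The second-derivative term of the chain rule and the inhomogeneous term of
  \<open>christoffel_tr\<close> cancel, so the Hessian is a tensor and may be read in any
  chart.\<close>

lemma hess_coord_tr:
  assumes c: "c \<in> \<A>" "d \<in> \<A>" and x: "x \<in> fst c" "x \<in> fst d" and \<phi>: "C2_near \<A> x \<phi>"
  shows "hess_coord c \<phi> (snd c x) v w = hess_coord d \<phi> (snd d x) (jac c d x v) (jac c d x w)"
proof -
  obtain N where N: "open N" "x \<in> N" "\<And>c. c \<in> \<A> \<Longrightarrow> C2_on (\<phi> \<circ> chart_inv c) (ov c N)"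
    using \<phi> by (auto simp: C2_near_iff)
  let ?R = "ov c (fst d \<inter> N)" and ?h = "\<phi> \<circ> chart_inv d" and ?p = "snd c x"
  have R: "open ?R" "?p \<in> ?R" using c x N by (auto intro!: open_ov chart)
  have t: "C2_on (tr c d) ?R" by (rule C2_on_subset[OF tr_C2[OF c]]) blast
  have im: "tr c d ` ?R \<subseteq> ov d N" using tr_image[OF c(1)] by blast
  have eq: "(\<phi> \<circ> chart_inv c) q = ?h (tr c d q)" if "q \<in> ?R" for q
    using that by (intro coord_tr[OF c]) auto
  have "fd (\<lambda>q. fd (\<phi> \<circ> chart_inv c) q w) ?p = fd (\<lambda>q. fd (\<lambda>q. ?h (tr c d q)) q w) ?p"
  proof (rule fd_cong_open[OF R])
    fix q assume "q \<in> ?R"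
    have "fd (\<phi> \<circ> chart_inv c) q = fd (\<lambda>q. ?h (tr c d q)) q"
      by (rule fd_cong_open[OF R(1) \<open>q \<in> ?R\<close>]) (rule eq)
    then show "fd (\<phi> \<circ> chart_inv c) q w = fd (\<lambda>q. ?h (tr c d q)) q w" by simp
  qed
  then have "fd (\<lambda>q. fd (\<phi> \<circ> chart_inv c) q w) ?p v =
      fd (\<lambda>q. fd ?h q (jac c d x w)) (snd d x) (jac c d x v) + fd ?h (snd d x) (fd (\<lambda>q. fd (tr c d) q w) ?p v)"
    using fd2_compose[OF R(1) N(3)[OF c(2)] t im R(2), of w v] x by (simp add: jac_def tr_apply[OF c(1)])
  moreover have "jac c d x (\<Gamma> c ?p v w) = \<Gamma> d (snd d x) (jac c d x v) (jac c d x w) + fd (\<lambda>q. fd (tr c d) q w) ?p v"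
    using christoffel_tr[OF c, of ?p v w] x by (simp add: jac_def tr_apply[OF c(1)])
  moreover have "linear (fd ?h (snd d x))"
    by (rule linear_fd[OF C2_on_differentiable[OF N(3)[OF c(2)]]]) (use N(2) x in blast)
  ultimately show ?thesis
    unfolding hess_coord_def fd_coord_tr[OF c x \<phi>] by (simp add: linear_add)
qed

lemma hessian_eq:
  assumes "c \<in> \<A>" "x \<in> fst c" "C2_near \<A> x \<phi>" "\<xi> \<in> tangent_space \<A> x" "\<eta> \<in> tangent_space \<A> x"
  shows "hessian \<A> g \<phi> x \<xi> \<eta> = hess_coord c \<phi> (snd c x) (\<xi> c) (\<eta> c)"
proof -
  let ?d = "some_chart \<A> x"
  have "hessian \<A> g \<phi> x \<xi> \<eta> = hess_coord ?d \<phi> (snd ?d x) (\<xi> ?d) (\<eta> ?d)"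
    using assms by (simp add: hessian_def hess_coord_def Let_def)
  also have "\<dots> = hess_coord c \<phi> (snd c x) (jac ?d c x (\<xi> ?d)) (jac ?d c x (\<eta> ?d))"
    by (rule hess_coord_tr[OF some_chart(1) assms(1) some_chart(2) assms(2,3)])
  also have "\<dots> = hess_coord c \<phi> (snd c x) (\<xi> c) (\<eta> c)"
    using tangent_coord_change[OF assms(4) some_chart(1) assms(1) some_chart(2) assms(2)]
      tangent_coord_change[OF assms(5) some_chart(1) assms(1) some_chart(2) assms(2)] by simp
  finally show ?thesis .
qed

lemma differential_eq:
  assumes "c \<in> \<A>" "x \<in> fst c" "C2_near \<A> x \<phi>" "\<xi> \<in> tangent_space \<A> x"
  shows "differential \<A> \<phi> x \<xi> = fd (\<phi> \<circ> chart_inv c) (snd c x) (\<xi> c)"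
proof -
  let ?d = "some_chart \<A> x"
  have "differential \<A> \<phi> x \<xi> = fd (\<phi> \<circ> chart_inv c) (snd c x) (jac ?d c x (\<xi> ?d))"
    using fd_coord_tr[OF some_chart(1) assms(1) some_chart(2) assms(2,3)] by (simp add: differential_def Let_def)
  then show ?thesis
    using tangent_coord_change[OF assms(4) some_chart(1) assms(1) some_chart(2) assms(2)] by simp
qed

end

section \<open>Positive definite forms depending on a parameter\<close>

lemma linear_bound_Basis:
  fixes L :: "'a::euclidean_space \<Rightarrow> real"
  assumes "linear L"
  shows "\<bar>L v\<bar> \<le> norm v * (\<Sum>i\<in>Basis. \<bar>L i\<bar>)"
proof -
  have "\<bar>L v\<bar> = \<bar>\<Sum>i\<in>Basis. (v \<bullet> i) * L i\<bar>" using linear_eq_sum_Basis[OF assms, of v] by simp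
  also have "\<dots> \<le> (\<Sum>i\<in>Basis. \<bar>v \<bullet> i\<bar> * \<bar>L i\<bar>)" by (rule order_trans[OF sum_abs]) (simp add: abs_mult)
  also have "\<dots> \<le> (\<Sum>i\<in>Basis. norm v * \<bar>L i\<bar>)"
    by (intro sum_mono mult_right_mono) (auto simp: Basis_le_norm)
  finally show ?thesis by (simp add: sum_distrib_left)
qed

lemma bilinear_bound_Basis:
  fixes b :: "'a::euclidean_space \<Rightarrow> 'a \<Rightarrow> real"
  assumes "\<And>w. linear (\<lambda>v. b v w)" "\<And>v. linear (b v)"
  shows "\<bar>b v w\<bar> \<le> norm v * norm w * (\<Sum>i\<in>Basis. \<Sum>j\<in>Basis. \<bar>b i j\<bar>)"
proof -
  have "\<bar>b v w\<bar> \<le> norm v * (\<Sum>i\<in>Basis. \<bar>b i w\<bar>)" by (rule linear_bound_Basis[OF assms(1)])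
  also have "\<dots> \<le> norm v * (\<Sum>i\<in>Basis. norm w * (\<Sum>j\<in>Basis. \<bar>b i j\<bar>))"
    by (intro mult_left_mono sum_mono linear_bound_Basis[OF assms(2)]) auto
  finally show ?thesis by (simp add: sum_distrib_left mult_ac)
qed

text \<open>Compactness of the unit sphere gives the lower bound at \<open>p\<close> itself. Nearby
  forms differ from it by a small multiple of the squared norm, since finitely many coefficients
  control the difference.\<close>

lemma local_norm_equivalence:
  fixes b :: "'a::euclidean_space \<Rightarrow> 'a \<Rightarrow> 'a \<Rightarrow> real"
  assumes S: "open S" "p \<in> S"
    and lin: "\<And>q w. q \<in> S \<Longrightarrow> linear (\<lambda>v. b q v w)" "\<And>q v. q \<in> S \<Longrightarrow> linear (b q v)"
    and pos: "\<And>v. v \<noteq> 0 \<Longrightarrow> 0 < b p v v"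
    and cont: "\<And>v w. continuous_on S (\<lambda>q. b q v w)"
  shows "\<exists>m M. 0 < m \<and> 0 < M \<and> (\<forall>\<^sub>F q in nhds p. \<forall>v. m * (norm v)\<^sup>2 \<le> b q v v \<and> b q v v \<le> M * (norm v)\<^sup>2)"
proof -
  let ?K = "\<lambda>b. \<Sum>i\<in>Basis. \<Sum>j\<in>Basis. \<bar>b i j\<bar>"
  have "continuous_on UNIV (\<lambda>v. b p v v)"
  proof (rule continuous_on_apply_linear[where L = "b p" and u = "\<lambda>v. v"])
    show "continuous_on UNIV (\<lambda>v. b p v w)" for w
      using lin(1)[OF S(2)] by (intro linear_continuous_on) (simp add: linear_conv_bounded_linear)
  qed (use lin(2) S in auto)
  then have c: "continuous_on (sphere 0 1) (\<lambda>v. b p v v)" by (rule continuous_on_subset) auto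
  have ne: "sphere 0 1 \<noteq> ({} :: 'a set)" by simp
  obtain v0 where v0: "v0 \<in> sphere 0 1" "\<And>v. v \<in> sphere 0 1 \<Longrightarrow> b p v0 v0 \<le> b p v v"
    using continuous_attains_inf[OF compact_sphere ne c] by blast
  define m where "m = b p v0 v0"
  have "v0 \<noteq> 0" using v0(1) by auto
  then have m: "0 < m" using pos by (simp add: m_def)
  have low: "m * (norm v)\<^sup>2 \<le> b p v v" for v
  proof (cases "v = 0")
    case True
    then show ?thesis using linear_0[OF lin(2)[OF S(2)], of v] by simp
  next
    case False
    have "m \<le> b p (v /\<^sub>R norm v) (v /\<^sub>R norm v)" unfolding m_def using False by (intro v0(2)) simp
    also have "\<dots> = b p v v / (norm v)\<^sup>2"
      using linear_scale[OF lin(1)[OF S(2)]] linear_scale[OF lin(2)[OF S(2)]]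
      by (simp add: power2_eq_square divide_inverse mult_ac)
    finally show ?thesis using False by (simp add: field_simps)
  qed
  have diff: "\<bar>b q v v - b p v v\<bar> \<le> (norm v)\<^sup>2 * ?K (\<lambda>i j. b q i j - b p i j)" if "q \<in> S" for q v
    using bilinear_bound_Basis[of "\<lambda>v w. b q v w - b p v w" v v] lin[OF that] lin[OF S(2)]
    by (simp add: linear_compose_sub power2_eq_square)
  have up: "b p v v \<le> (norm v)\<^sup>2 * ?K (b p)" for v
    using bilinear_bound_Basis[of "b p" v v] lin[OF S(2)] by (simp add: power2_eq_square)
  have "((\<lambda>q. ?K (\<lambda>i j. b q i j - b p i j)) \<longlongrightarrow> ?K (\<lambda>i j. b p i j - b p i j)) (nhds p)"
  proof (intro tendsto_sum tendsto_rabs tendsto_diff tendsto_const)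
    show "((\<lambda>q. b q i j) \<longlongrightarrow> b p i j) (nhds p)" for i j
      using cont[of i j] S by (intro isCont_tendsto_nhds) (simp add: continuous_on_eq_continuous_at)
  qed
  then have "((\<lambda>q. ?K (\<lambda>i j. b q i j - b p i j)) \<longlongrightarrow> 0) (nhds p)" by simp
  \<comment> \<open>A perturbation below \<open>m / 2\<close> leaves half of the lower bound and
    raises the upper one by less than \<open>m\<close>.\<close>
  from order_tendstoD(2)[OF this, of "m / 2"] m
  have "\<forall>\<^sub>F q in nhds p. ?K (\<lambda>i j. b q i j - b p i j) < m / 2" by simp
  with eventually_nhds_in_open[OF S]
  have "\<forall>\<^sub>F q in nhds p. \<forall>v. m / 2 * (norm v)\<^sup>2 \<le> b q v v \<and> b q v v \<le> (?K (b p) + m) * (norm v)\<^sup>2"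
  proof eventually_elim
    case (elim q)
    show ?case
    proof
      fix v :: 'a
      have "(norm v)\<^sup>2 * ?K (\<lambda>i j. b q i j - b p i j) \<le> (norm v)\<^sup>2 * (m / 2)"
        using elim(2) by (intro mult_left_mono) auto
      with diff[OF elim(1), of v] have "b q v v - b p v v \<le> (norm v)\<^sup>2 * (m / 2)"
        "b p v v - b q v v \<le> (norm v)\<^sup>2 * (m / 2)" by linarith+
      moreover have "0 \<le> (norm v)\<^sup>2 * (m / 2)" using m by simp
      ultimately show "m / 2 * (norm v)\<^sup>2 \<le> b q v v \<and> b q v v \<le> (?K (b p) + m) * (norm v)\<^sup>2"
        using low[of v] up[of v] by (auto simp: algebra_simps)
    qed
  qed
  moreover have "0 \<le> ?K (b p)" by (intro sum_nonneg) auto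
  ultimately show ?thesis using m by (intro exI[of _ "m / 2"] exI[of _ "?K (b p) + m"]) auto
qed

text \<open>Coercivity turns \<open>b q (z q - z p) (z q - z p)\<close> into a bound for \<open>z q - z p\<close>.\<close>

lemma continuous_on_riesz:
  fixes b :: "'a::euclidean_space \<Rightarrow> 'a \<Rightarrow> 'a \<Rightarrow> real"
  assumes S: "open S"
    and lin: "\<And>q w. q \<in> S \<Longrightarrow> linear (\<lambda>v. b q v w)" "\<And>q v. q \<in> S \<Longrightarrow> linear (b q v)"
    and pos: "\<And>q v. q \<in> S \<Longrightarrow> v \<noteq> 0 \<Longrightarrow> 0 < b q v v"
    and cont: "\<And>v w. continuous_on S (\<lambda>q. b q v w)"
    and l: "\<And>q. q \<in> S \<Longrightarrow> linear (l q)" "\<And>v. continuous_on S (\<lambda>q. l q v)"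
    and z: "\<And>q u. q \<in> S \<Longrightarrow> b q (z q) u = l q u"
  shows "continuous_on S z"
proof -
  have "isCont z p" if p: "p \<in> S" for p
  proof -
    obtain m M where m: "0 < m" "\<forall>\<^sub>F q in nhds p. \<forall>v. m * (norm v)\<^sup>2 \<le> b q v v \<and> b q v v \<le> M * (norm v)\<^sup>2"
      using local_norm_equivalence[OF S p lin pos[OF p] cont] by blast
    \<comment> \<open>\<open>E\<close> measures how far the old representative \<open>z p\<close> is
      from representing \<open>l q\<close>; it vanishes at \<open>p\<close>.\<close>
    define E where "E q = (\<Sum>i\<in>Basis. \<bar>l q i - b q (z p) i\<bar>)" for q
    have "\<forall>\<^sub>F q in nhds p. norm (z q - z p) \<le> E q / m"
      using m(2) eventually_nhds_in_open[OF S p]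
    proof eventually_elim
      case (elim q)
      let ?d = "z q - z p"
      have "m * (norm ?d)\<^sup>2 \<le> b q ?d ?d" using elim(1) by blast
      also have "\<dots> = l q ?d - b q (z p) ?d"
        using linear_diff[OF lin(1)[OF elim(2)]] z[OF elim(2)] by simp
      also have "\<dots> \<le> norm ?d * E q"
        using linear_bound_Basis[OF linear_compose_sub[OF l(1)[OF elim(2)] lin(2)[OF elim(2)]], of ?d "z p"]
        by (simp add: E_def)
      finally have "norm ?d * (m * norm ?d) \<le> norm ?d * E q" by (simp add: power2_eq_square mult_ac)
      moreover have "0 \<le> E q" by (simp add: E_def sum_nonneg)
      ultimately show ?case using m(1) by (cases "?d = 0") (auto simp: field_simps)
    qed
    moreover have "(E \<longlongrightarrow> 0) (nhds p)"
    proof -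
      have "(E \<longlongrightarrow> (\<Sum>i\<in>Basis. \<bar>l p i - b p (z p) i\<bar>)) (nhds p)"
        unfolding E_def
      proof (intro tendsto_sum tendsto_rabs tendsto_diff)
        show "((\<lambda>q. l q i) \<longlongrightarrow> l p i) (nhds p)" for i
          using l(2)[of i] S p by (intro isCont_tendsto_nhds) (simp add: continuous_on_eq_continuous_at)
        show "((\<lambda>q. b q (z p) i) \<longlongrightarrow> b p (z p) i) (nhds p)" for i
          using cont[of "z p" i] S p by (intro isCont_tendsto_nhds) (simp add: continuous_on_eq_continuous_at)
      qed
      then show ?thesis using z[OF p] by simp
    qed
    then have "((\<lambda>q. E q / m) \<longlongrightarrow> 0) (nhds p)" using tendsto_divide[of E 0 "nhds p" "\<lambda>_. m" m] m(1) by simp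
    ultimately have "((\<lambda>q. z q - z p) \<longlongrightarrow> 0) (nhds p)" by (rule Lim_null_comparison)
    then have "(z \<longlongrightarrow> z p) (nhds p)" by (simp add: Lim_null[symmetric])
    then show ?thesis by (simp add: continuous_at tendsto_at_iff_tendsto_nhds)
  qed
  then show ?thesis using S by (simp add: continuous_on_eq_continuous_at)
qed

section \<open>Gradients, jets and the operator along test functions\<close>

context riemannian
begin

lemma gm_continuous: "c \<in> \<A> \<Longrightarrow> continuous_on (chart_image c) (\<lambda>p. gm c p v w)"
  by (rule C1_on_continuous[OF gm_C1])

lemma christoffel_continuous:
  assumes c: "c \<in> \<A>"
  shows "continuous_on (chart_image c) (\<lambda>p. \<Gamma> c p v w)"
proof (rule continuous_on_riesz[OF chart(2)[OF c] gm_linear1[OF c] gm_linear2[OF c] gm_pos[OF c] gm_continuous[OF c]])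
  show "linear (koszul c p v w)" if "p \<in> chart_image c" for p using koszul_linear(1)[OF c that] .
  show "continuous_on (chart_image c) (\<lambda>p. koszul c p v w u)" for u
    unfolding koszul_def by (intro continuous_intros C1_on_continuous_fd[OF gm_C1[OF c]]) simp
qed (simp_all add: christoffel[OF c])

definition grad_coord :: "('m, 'a) chart \<Rightarrow> ('m \<Rightarrow> real) \<Rightarrow> 'a \<Rightarrow> 'a" where
  "grad_coord c \<phi> p = (THE z. \<forall>u. gm c p z u = fd (\<phi> \<circ> chart_inv c) p u)"

definition gradient :: "('m \<Rightarrow> real) \<Rightarrow> 'm \<Rightarrow> ('m, 'a) tvec" where
  "gradient \<phi> x = (let c = some_chart \<A> x in tv c x (grad_coord c \<phi> (snd c x)))"

text \<open>The fibre coordinates of \<open>triv\<close> are nested bounded linear maps.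
  \<open>Blinfun\<close> represents a function faithfully only if it is bounded linear, which is
  shown below where \<open>\<phi>\<close> is of class C2 in the chart.\<close>

definition hess_blinfun :: "('m, 'a) chart \<Rightarrow> ('m \<Rightarrow> real) \<Rightarrow> 'a \<Rightarrow> 'a \<Rightarrow>\<^sub>L 'a \<Rightarrow>\<^sub>L real" where
  "hess_blinfun c \<phi> p = Blinfun (\<lambda>v. Blinfun (hess_coord c \<phi> p v))"

lemma grad_coord:
  assumes "c \<in> \<A>" "p \<in> chart_image c" "(\<phi> \<circ> chart_inv c) differentiable (at p)"
  shows "gm c p (grad_coord c \<phi> p) u = fd (\<phi> \<circ> chart_inv c) p u"
  using theI'[OF gm_riesz[OF assms(1,2) linear_fd[OF assms(3)]]] by (simp add: grad_coord_def)

text \<open>Positive definiteness determines the representing vector, and chart independence of the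
  differential lets any chart compute it.\<close>

lemma gradient_unique:
  assumes c: "c \<in> \<A>" "x \<in> fst c" and \<phi>: "C2_near \<A> x \<phi>"
  shows "\<zeta> \<in> tangent_space \<A> x \<and> (\<forall>\<xi>\<in>tangent_space \<A> x. g x \<zeta> \<xi> = differential \<A> \<phi> x \<xi>)
    \<longleftrightarrow> \<zeta> = tv c x (grad_coord c \<phi> (snd c x))"
proof -
  obtain N where N: "open N" "x \<in> N" "\<And>c. c \<in> \<A> \<Longrightarrow> C2_on (\<phi> \<circ> chart_inv c) (ov c N)"
    using \<phi> by (auto simp: C2_near_iff)
  have px: "snd c x \<in> chart_image c" using c by blast
  have gc: "gm c (snd c x) (grad_coord c \<phi> (snd c x)) u = fd (\<phi> \<circ> chart_inv c) (snd c x) u" for u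
    by (rule grad_coord[OF c(1) px C2_on_differentiable[OF N(3)[OF c(1)]]]) (use c N in blast)
  have metric: "g x \<zeta> \<xi> = gm c (snd c x) (\<zeta> c) (\<xi> c)" if "\<zeta> \<in> tangent_space \<A> x" "\<xi> \<in> tangent_space \<A> x" for \<zeta> \<xi>
    using tv_repr[OF that(1) c] tv_repr[OF that(2) c] gm_apply[OF c] by simp
  show ?thesis
  proof
    assume L: "\<zeta> \<in> tangent_space \<A> x \<and> (\<forall>\<xi>\<in>tangent_space \<A> x. g x \<zeta> \<xi> = differential \<A> \<phi> x \<xi>)"
    have "gm c (snd c x) (\<zeta> c) u = gm c (snd c x) (grad_coord c \<phi> (snd c x)) u" for u
      using L metric[of \<zeta> "tv c x u"] tv_in[OF c, of u] differential_eq[OF c \<phi> tv_in[OF c, of u]]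
        tv_coord[OF c] gc by simp
    from gm_cancel[OF c(1) px this] tv_repr[OF _ c, of \<zeta>] L show "\<zeta> = tv c x (grad_coord c \<phi> (snd c x))"
      by simp
  next
    assume R: "\<zeta> = tv c x (grad_coord c \<phi> (snd c x))"
    have "g x \<zeta> \<xi> = differential \<A> \<phi> x \<xi>" if "\<xi> \<in> tangent_space \<A> x" for \<xi>
      using metric[of \<zeta> \<xi>] that differential_eq[OF c \<phi> that] gc tv_in[OF c] tv_coord[OF c] by (simp add: R)
    then show "\<zeta> \<in> tangent_space \<A> x \<and> (\<forall>\<xi>\<in>tangent_space \<A> x. g x \<zeta> \<xi> = differential \<A> \<phi> x \<xi>)"
      using tv_in[OF c] by (simp add: R)
  qed
qed

lemma gradient_eq:
  assumes "c \<in> \<A>" "x \<in> fst c" "C2_near \<A> x \<phi>"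
  shows "gradient \<phi> x = tv c x (grad_coord c \<phi> (snd c x))"
  using gradient_unique[OF assms] gradient_unique[OF some_chart assms(3), of "gradient \<phi> x"]
  by (simp add: gradient_def Let_def)

lemma gradient_iff:
  assumes "C2_near \<A> x \<phi>"
  shows "\<zeta> \<in> tangent_space \<A> x \<and> (\<forall>\<xi>\<in>tangent_space \<A> x. g x \<zeta> \<xi> = differential \<A> \<phi> x \<xi>) \<longleftrightarrow>
    \<zeta> = gradient \<phi> x"
  unfolding gradient_def Let_def by (rule gradient_unique[OF some_chart assms])

text \<open>With \<zeta> a function of \<phi>, the viscosity conditions take the shape of the
  abstract tests on \<open>G \<phi> x r\<close>.\<close>

lemma superjet_iff:
  "(\<zeta>, A) \<in> superjet \<A> g u x \<longleftrightarrow> (\<exists>\<phi>. C2_near \<A> x \<phi> \<and> (\<forall>\<^sub>F y in nhds x. u y - \<phi> y \<le> u x - \<phi> x) \<and>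
     \<zeta> = gradient \<phi> x \<and> A = hessian \<A> g \<phi> x)"
  unfolding superjet_def mem_Collect_eq case_prod_conv using gradient_iff by blast

lemma subjet_iff:
  "(\<zeta>, A) \<in> subjet \<A> g u x \<longleftrightarrow> (\<exists>\<phi>. C2_near \<A> x \<phi> \<and> (\<forall>\<^sub>F y in nhds x. u x - \<phi> x \<le> u y - \<phi> y) \<and>
     \<zeta> = gradient \<phi> x \<and> A = hessian \<A> g \<phi> x)"
  unfolding subjet_def mem_Collect_eq case_prod_conv using gradient_iff by blast

lemma tangent_space_linear:
  assumes "\<xi> \<in> tangent_space \<A> x" "\<eta> \<in> tangent_space \<A> x"
  shows "(\<lambda>c. a *\<^sub>R \<xi> c + b *\<^sub>R \<eta> c) \<in> tangent_space \<A> x"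
proof -
  obtain c where c: "c \<in> \<A>" "x \<in> fst c" using ex_chart by blast
  have "(\<lambda>e. a *\<^sub>R \<xi> e + b *\<^sub>R \<eta> e) = tv c x (a *\<^sub>R \<xi> c + b *\<^sub>R \<eta> c)"
    using tv_linear[OF c, of a "\<xi> c" b "\<eta> c"] tv_repr[OF assms(1) c] tv_repr[OF assms(2) c] by simp
  then show ?thesis using tv_in[OF c] by simp
qed

lemma triv_in_jet_space:
  assumes c: "c \<in> \<A>" and t: "t \<in> triv_dom c"
  shows "triv \<A> c t \<in> jet_space \<A>"
proof -
  obtain p r z B where t_eq: "t = (p, r, z, B)" by (metis prod_cases4)
  have p: "p \<in> chart_image c" and B: "\<And>v w. blinfun_apply (blinfun_apply B v) w = blinfun_apply (blinfun_apply B w) v"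
    using t by (auto simp: triv_dom_def t_eq)
  let ?x = "chart_inv c p"
  have x: "?x \<in> fst c" using chart(7)[OF c p] .
  have "(\<lambda>\<xi> \<eta>. if \<xi> \<in> tangent_space \<A> ?x \<and> \<eta> \<in> tangent_space \<A> ?x
      then blinfun_apply (blinfun_apply B (\<xi> c)) (\<eta> c) else 0) \<in> sym_forms \<A> ?x"
    unfolding sym_forms_def
    by (auto simp: tangent_space_linear blinfun.bilinear_simps intro: B)
  then show ?thesis using tv_in[OF c x] by (simp add: t_eq triv_def jet_space_def)
qed

lemma topspace_jet: "topspace (jet_topology \<A>) = jet_space \<A>"
proof
  show "topspace (jet_topology \<A>) \<subseteq> jet_space \<A>"
    using openin_jet_topology[of \<A> "topspace (jet_topology \<A>)"] by simp
  have "openin (jet_topology \<A>) (jet_space \<A>)"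
    unfolding openin_jet_topology
  proof (intro conjI ballI subset_refl)
    fix c assume c: "c \<in> \<A>"
    have "triv_dom c \<inter> triv \<A> c -` jet_space \<A> = triv_dom c" using triv_in_jet_space[OF c] by auto
    then show "openin (top_of_set (triv_dom c)) (triv_dom c \<inter> triv \<A> c -` jet_space \<A>)" by simp
  qed
  then show "jet_space \<A> \<subseteq> topspace (jet_topology \<A>)" by (rule openin_subset)
qed

text \<open>Openness in \<open>jet_topology\<close> is tested by pulling back along
  \<open>triv\<close>, so continuity on the bundle gives continuity in fibre coordinates.\<close>

lemma continuous_on_triv:
  assumes "continuous_map (jet_topology \<A>) euclideanreal F" "c \<in> \<A>"
  shows "continuous_on (triv_dom c) (\<lambda>t. F (triv \<A> c t))"
proof (subst continuous_on_open_gen[where T = UNIV], simp, intro allI impI)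
  fix U :: "real set" assume "openin (top_of_set UNIV) U"
  then have "openin (jet_topology \<A>) {t \<in> jet_space \<A>. F t \<in> U}"
    using openin_continuous_map_preimage[OF assms(1), of U] by (simp add: topspace_jet)
  then have "openin (top_of_set (triv_dom c)) (triv_dom c \<inter> triv \<A> c -` {t \<in> jet_space \<A>. F t \<in> U})"
    using assms(2) by (simp add: openin_jet_topology)
  moreover have "triv_dom c \<inter> triv \<A> c -` {t \<in> jet_space \<A>. F t \<in> U} = triv_dom c \<inter> (\<lambda>t. F (triv \<A> c t)) -` U"
    using triv_in_jet_space[OF assms(2)] by auto
  ultimately show "openin (top_of_set (triv_dom c)) (triv_dom c \<inter> (\<lambda>t. F (triv \<A> c t)) -` U)" by simp
qed

context
  fixes c and \<phi> :: "'m \<Rightarrow> real" and S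
  assumes c: "c \<in> \<A>" and S: "open S" "S \<subseteq> chart_image c" and \<phi>: "C2_on (\<phi> \<circ> chart_inv c) S"
begin

lemma hess_coord_sym:
  assumes "p \<in> S"
  shows "hess_coord c \<phi> p v w = hess_coord c \<phi> p w v"
proof -
  have "p \<in> chart_image c" using assms S(2) by blast
  then show ?thesis
    unfolding hess_coord_def
    using symmetric_second_derivative[OF S(1) \<phi> assms, of v w] christoffel_sym[OF c, of p v w] by simp
qed

lemma hess_coord_linear1:
  assumes "p \<in> S"
  shows "linear (\<lambda>v. hess_coord c \<phi> p v w)"
proof -
  have 1: "linear (fd (\<lambda>q. fd (\<phi> \<circ> chart_inv c) q w) p)"
    by (rule linear_fd[OF C1_on_differentiable[OF C2_on_fd[OF \<phi>] assms]])
  have pc: "p \<in> chart_image c" using assms S(2) by blast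
  have 2: "linear (\<lambda>v. \<Gamma> c p v w)"
    using christoffel_linear1[OF c pc, of 1 _ 1 _ w] christoffel_linear1[OF c pc, of _ _ 0 _ w]
    by (intro linearI) simp_all
  show ?thesis
    unfolding hess_coord_def
    using linear_compose_sub[OF 1 linear_compose[OF 2 linear_fd[OF C2_on_differentiable[OF \<phi> assms]]]]
    by (simp add: o_def)
qed

lemma hess_coord_linear2: "p \<in> S \<Longrightarrow> linear (hess_coord c \<phi> p v)"
proof -
  assume p: "p \<in> S"
  have "hess_coord c \<phi> p v = (\<lambda>w. hess_coord c \<phi> p w v)" using hess_coord_sym[OF p] by blast
  then show ?thesis using hess_coord_linear1[OF p] by simp
qed

lemma hess_blinfun_apply:
  assumes "p \<in> S"
  shows "blinfun_apply (blinfun_apply (hess_blinfun c \<phi> p) v) w = hess_coord c \<phi> p v w"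
proof -
  have bl: "bounded_linear (hess_coord c \<phi> p v)" for v
    using hess_coord_linear2[OF assms] by (simp add: linear_conv_bounded_linear)
  have "linear (\<lambda>v. Blinfun (hess_coord c \<phi> p v))"
    by (intro linearI blinfun_eqI)
       (simp_all add: bounded_linear_Blinfun_apply[OF bl] blinfun.bilinear_simps
         linear_add[OF hess_coord_linear1[OF assms]] linear_scale[OF hess_coord_linear1[OF assms]])
  then have "bounded_linear (\<lambda>v. Blinfun (hess_coord c \<phi> p v))" by (simp add: linear_conv_bounded_linear)
  then show ?thesis by (simp add: hess_blinfun_def bounded_linear_Blinfun_apply bl)
qed

lemma hess_blinfun_continuous: "continuous_on S (hess_blinfun c \<phi>)"
proof (intro continuous_on_blinfun_componentwise)
  have cont: "continuous_on S (\<lambda>p. hess_coord c \<phi> p v w)" for v w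
    unfolding hess_coord_def
  proof (intro continuous_on_diff)
    show "continuous_on S (\<lambda>p. fd (\<lambda>q. fd (\<phi> \<circ> chart_inv c) q w) p v)"
      by (rule C1_on_continuous_fd[OF C2_on_fd[OF \<phi>]])
    show "continuous_on S (\<lambda>p. fd (\<phi> \<circ> chart_inv c) p (\<Gamma> c p v w))"
      by (rule continuous_on_apply_linear[OF linear_fd[OF C2_on_differentiable[OF \<phi>]]
          C1_on_continuous[OF C2_on_fd[OF \<phi>]] continuous_on_subset[OF christoffel_continuous[OF c] S(2)]])
  qed
  show "continuous_on S (\<lambda>p. blinfun_apply (blinfun_apply (hess_blinfun c \<phi> p) v) w)" for v w
    using cont by (subst continuous_on_cong[OF refl]) (auto simp: hess_blinfun_apply)
qed

lemma grad_coord_continuous: "continuous_on S (grad_coord c \<phi>)"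
proof (rule continuous_on_riesz[OF S(1)])
  have pc: "p \<in> chart_image c" if "p \<in> S" for p using that S(2) by blast
  show "linear (\<lambda>v. gm c p v w)" "linear (gm c p w)" if "p \<in> S" for p w
    using gm_linear1[OF c pc[OF that]] gm_linear2[OF c pc[OF that]] .
  show "0 < gm c p v v" if "p \<in> S" "v \<noteq> 0" for p v using gm_pos[OF c pc[OF that(1)] that(2)] .
  show "continuous_on S (\<lambda>p. gm c p v w)" for v w by (rule continuous_on_subset[OF gm_continuous[OF c] S(2)])
  show "linear (fd (\<phi> \<circ> chart_inv c) p)" if "p \<in> S" for p by (rule linear_fd[OF C2_on_differentiable[OF \<phi> that]])
  show "continuous_on S (\<lambda>p. fd (\<phi> \<circ> chart_inv c) p v)" for v by (rule C1_on_continuous[OF C2_on_fd[OF \<phi>]])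
  show "gm c p (grad_coord c \<phi> p) u = fd (\<phi> \<circ> chart_inv c) p u" if "p \<in> S" for p u
    using grad_coord[OF c pc[OF that] C2_on_differentiable[OF \<phi> that]] .
qed

end

text \<open>Writes the jet of a test function through its coordinate jet in a fixed chart, whose
  components vary continuously with the point.\<close>

lemma jet_eq_triv:
  assumes c: "c \<in> \<A>" "x \<in> fst c" and S: "open S" "snd c x \<in> S" "S \<subseteq> chart_image c"
    and \<phi>: "C2_on (\<phi> \<circ> chart_inv c) S" "C2_near \<A> x \<phi>"
  shows "(snd c x, r, grad_coord c \<phi> (snd c x), hess_blinfun c \<phi> (snd c x)) \<in> triv_dom c"
    "(x, r, gradient \<phi> x, hessian \<A> g \<phi> x) =
      triv \<A> c (snd c x, r, grad_coord c \<phi> (snd c x), hess_blinfun c \<phi> (snd c x))"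
proof -
  note ap = hess_blinfun_apply[OF c(1) S(1,3) \<phi>(1) S(2)]
  show "(snd c x, r, grad_coord c \<phi> (snd c x), hess_blinfun c \<phi> (snd c x)) \<in> triv_dom c"
    using S hess_coord_sym[OF c(1) S(1,3) \<phi>(1) S(2)] by (auto simp: triv_dom_def ap)
  have "hessian \<A> g \<phi> x = (\<lambda>\<xi> \<eta>. if \<xi> \<in> tangent_space \<A> x \<and> \<eta> \<in> tangent_space \<A> x
      then hess_coord c \<phi> (snd c x) (\<xi> c) (\<eta> c) else 0)"
    using hessian_eq[OF c \<phi>(2)] by (auto simp: fun_eq_iff hessian_def)
  then show "(x, r, gradient \<phi> x, hessian \<A> g \<phi> x) =
      triv \<A> c (snd c x, r, grad_coord c \<phi> (snd c x), hess_blinfun c \<phi> (snd c x))"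
    using chart(5)[OF c] gradient_eq[OF c \<phi>(2)] by (simp add: triv_def ap cong: if_cong)
qed

lemma jet_in_jet_space:
  assumes "C2_near \<A> x \<phi>"
  shows "gradient \<phi> x \<in> tangent_space \<A> x" "hessian \<A> g \<phi> x \<in> sym_forms \<A> x"
proof -
  obtain N where N: "open N" "x \<in> N" "\<And>c. c \<in> \<A> \<Longrightarrow> C2_on (\<phi> \<circ> chart_inv c) (ov c N)"
    using assms by (auto simp: C2_near_iff)
  obtain c where c: "c \<in> \<A>" "x \<in> fst c" using ex_chart by blast
  have S: "open (ov c N)" "snd c x \<in> ov c N" "ov c N \<subseteq> chart_image c" using c N open_ov by auto
  have "(x, 0, gradient \<phi> x, hessian \<A> g \<phi> x) \<in> jet_space \<A>"
    using triv_in_jet_space[OF c(1) jet_eq_triv(1)[OF c S N(3)[OF c(1)] assms, of 0]]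
      jet_eq_triv(2)[OF c S N(3)[OF c(1)] assms, of 0] by simp
  then show "gradient \<phi> x \<in> tangent_space \<A> x" "hessian \<A> g \<phi> x \<in> sym_forms \<A> x"
    by (auto simp: jet_space_def)
qed

text \<open>All jets near \<open>x\<close> are read in one chart; the limit then follows from
  continuity of \<open>F\<close> in the trivialisation and of the coordinate gradient and
  Hessian.\<close>

lemma operator_tendsto:
  assumes F: "continuous_map (jet_topology \<A>) euclideanreal F" and \<phi>: "C2_near \<A> x \<phi>"
  shows "((\<lambda>(y, s). F (y, s, gradient \<phi> y, hessian \<A> g \<phi> y)) \<longlongrightarrow> F (x, r, gradient \<phi> x, hessian \<A> g \<phi> x))
    (nhds x \<times>\<^sub>F nhds r)"
proof -
  obtain N where N: "open N" "x \<in> N" "\<And>c. c \<in> \<A> \<Longrightarrow> C2_on (\<phi> \<circ> chart_inv c) (ov c N)"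
    using \<phi> by (auto simp: C2_near_iff)
  obtain c where c: "c \<in> \<A>" "x \<in> fst c" using ex_chart by blast
  let ?S = "ov c N"
  have S: "open ?S" "snd c x \<in> ?S" "?S \<subseteq> chart_image c" using c N open_ov by auto
  have C2: "C2_on (\<phi> \<circ> chart_inv c) ?S" by (rule N(3)[OF c(1)])
  define J where "J = (\<lambda>(p, s::real). (p, s, grad_coord c \<phi> p, hess_blinfun c \<phi> p))"
  have near: "C2_near \<A> y \<phi>" if "y \<in> N" for y using that N by (auto simp: C2_near_iff)
  have J_eq: "J (snd c y, s) \<in> triv_dom c" "F (y, s, gradient \<phi> y, hessian \<A> g \<phi> y) = F (triv \<A> c (J (snd c y, s)))"
    if y: "y \<in> N" "y \<in> fst c" for y s
  proof -
    have "snd c y \<in> ?S" using y by blast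
    note * = jet_eq_triv[OF c(1) y(2) S(1) this S(3) C2 near[OF y(1)], of s]
    show "J (snd c y, s) \<in> triv_dom c" using *(1) by (simp add: J_def)
    show "F (y, s, gradient \<phi> y, hessian \<A> g \<phi> y) = F (triv \<A> c (J (snd c y, s)))"
      unfolding *(2) by (simp add: J_def)
  qed
  have "continuous_on (?S \<times> UNIV) J"
    unfolding J_def case_prod_unfold
    by (intro continuous_intros continuous_on_compose2[OF grad_coord_continuous[OF c(1) S(1,3) C2]]
        continuous_on_compose2[OF hess_blinfun_continuous[OF c(1) S(1,3) C2]]) auto
  moreover have "J ` (?S \<times> UNIV) \<subseteq> triv_dom c" using J_eq(1) by blast
  ultimately have "continuous_on (?S \<times> UNIV) (\<lambda>t. F (triv \<A> c (J t)))"
    using continuous_on_compose2[OF continuous_on_triv[OF F c(1)]] by blast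
  then have "isCont (\<lambda>t. F (triv \<A> c (J t))) (snd c x, r)"
    using continuous_on_eq_continuous_at[OF open_Times[OF S(1) open_UNIV]] S(2) by blast
  then have 1: "((\<lambda>t. F (triv \<A> c (J t))) \<longlongrightarrow> F (triv \<A> c (J (snd c x, r)))) (nhds (snd c x, r))"
    by (rule isCont_tendsto_nhds)
  have "isCont (snd c) x" using chart(3,1)[OF c(1)] c(2) by (simp add: continuous_on_eq_continuous_at)
  then have "(snd c \<longlongrightarrow> snd c x) (nhds x)" by (rule isCont_tendsto_nhds)
  then have 2: "filterlim (\<lambda>t. (snd c (fst t), snd t)) (nhds (snd c x, r)) (nhds x \<times>\<^sub>F nhds r)"
    by (intro tendsto_Pair filterlim_snd filterlim_compose[OF _ filterlim_fst])
  have 3: "\<forall>\<^sub>F t in nhds x \<times>\<^sub>F nhds r. F (triv \<A> c (J (snd c (fst t), snd t))) =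
      (case t of (y, s) \<Rightarrow> F (y, s, gradient \<phi> y, hessian \<A> g \<phi> y))"
  proof -
    have "\<forall>\<^sub>F y in nhds x. y \<in> N \<inter> fst c"
      using N(1,2) c chart(1)[OF c(1)] by (intro eventually_nhds_in_open) auto
    from eventually_compose_filterlim[OF this filterlim_fst]
    have "\<forall>\<^sub>F t in nhds x \<times>\<^sub>F nhds r. fst t \<in> N \<inter> fst c" .
    then show ?thesis by eventually_elim (auto simp: J_eq(2))
  qed
  show ?thesis
    using Lim_transform_eventually[OF filterlim_compose[OF 1 2] 3] J_eq(2)[OF N(2) c(2), of r] by simp
qed

text \<open>At a maximum of \<open>\<phi> - \<psi>\<close> the first derivatives agree and the
  second derivatives are ordered. Equal first derivatives give equal Christoffel terms, so the order
  passes to the Riemannian Hessians.\<close>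

lemma operator_elliptic:
  assumes F: "degenerate_elliptic \<A> F" and \<phi>: "C2_near \<A> x \<phi>" and \<psi>: "C2_near \<A> x \<psi>"
    and max: "\<forall>\<^sub>F y in nhds x. \<phi> y - \<psi> y \<le> \<phi> x - \<psi> x"
  shows "F (x, r, gradient \<psi> x, hessian \<A> g \<psi> x) \<le> F (x, r, gradient \<phi> x, hessian \<A> g \<phi> x)"
proof -
  obtain N1 where N1: "open N1" "x \<in> N1" "\<And>c. c \<in> \<A> \<Longrightarrow> C2_on (\<phi> \<circ> chart_inv c) (ov c N1)"
    using \<phi> by (auto simp: C2_near_iff)
  obtain N2 where N2: "open N2" "x \<in> N2" "\<And>c. c \<in> \<A> \<Longrightarrow> C2_on (\<psi> \<circ> chart_inv c) (ov c N2)"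
    using \<psi> by (auto simp: C2_near_iff)
  obtain N3 where N3: "open N3" "x \<in> N3" "\<And>y. y \<in> N3 \<Longrightarrow> \<phi> y - \<psi> y \<le> \<phi> x - \<psi> x"
    using max unfolding eventually_nhds by blast
  obtain c where c: "c \<in> \<A>" "x \<in> fst c" using ex_chart by blast
  define S where "S = ov c (N1 \<inter> N2 \<inter> N3)"
  let ?h = "\<phi> \<circ> chart_inv c" and ?k = "\<psi> \<circ> chart_inv c" and ?p = "snd c x"
  have S: "open S" "?p \<in> S" unfolding S_def using c N1 N2 N3 by (auto intro!: open_ov)
  have h: "C2_on ?h S" and k: "C2_on ?k S"
    by (rule C2_on_subset[OF N1(3)[OF c(1)]], force simp: S_def, rule C2_on_subset[OF N2(3)[OF c(1)]], force simp: S_def)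
  define e where "e = (\<lambda>q. ?h q + - ?k q)"
  have e: "C2_on e S"
    unfolding e_def by (intro C2_on_add S h C2_on_bounded_linear[OF S(1) bounded_linear_minus[OF bounded_linear_ident] k])
  have emax: "e q \<le> e ?p" if "q \<in> S" for q
    using that N3(3) chart(5)[OF c(1)] c(2) by (auto simp: S_def e_def)
  have fd_e: "fd e q v = fd ?h q v - fd ?k q v" if "q \<in> S" for q v
    using fd_eq[OF has_derivative_add[OF C2_onD[OF h that] has_derivative_minus[OF C2_onD[OF k that]]]]
    by (simp add: e_def)
  have fd_eq0: "fd ?h ?p = fd ?k ?p"
    using second_derivative_test(1)[OF S e emax] fd_e[OF S(2)] by force
  have "fd (\<lambda>q. fd e q v) ?p v = fd (\<lambda>q. fd ?h q v) ?p v - fd (\<lambda>q. fd ?k q v) ?p v" for v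
  proof -
    have "fd (\<lambda>q. fd e q v) ?p = fd (\<lambda>q. fd ?h q v - fd ?k q v) ?p"
      by (rule fd_cong_open[OF S]) (rule fd_e)
    then show ?thesis
      using fd_eq[OF has_derivative_diff[OF C1_onD[OF C2_on_fd[OF h] S(2), of v] C1_onD[OF C2_on_fd[OF k] S(2), of v]]]
      by simp
  qed
  then have hess: "hess_coord c \<phi> ?p v v \<le> hess_coord c \<psi> ?p v v" for v
    using second_derivative_test(2)[OF S e emax, of v] by (simp add: hess_coord_def fd_eq0)
  have "grad_coord c \<phi> ?p = grad_coord c \<psi> ?p" by (simp add: grad_coord_def fd_eq0)
  then have grad: "gradient \<phi> x = gradient \<psi> x" by (simp add: gradient_eq[OF c] \<phi> \<psi>)
  have "form_le \<A> x (hessian \<A> g \<phi> x) (hessian \<A> g \<psi> x)"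
    unfolding form_le_def using hess by (auto simp: hessian_eq[OF c] \<phi> \<psi>)
  then show ?thesis
    unfolding grad using F jet_in_jet_space[OF \<phi>] jet_in_jet_space[OF \<psi>] unfolding degenerate_elliptic_def by blast
qed

end

section \<open>Test functions and the quartic penalty\<close>

lemma quartic:
  fixes p0 :: "'a::euclidean_space"
  defines "f \<equiv> \<lambda>p. ((p - p0) \<bullet> (p - p0))\<^sup>2"
  shows "C2_on f UNIV" "fd f p0 v = 0" "fd (\<lambda>q. fd f q v) p0 w = 0"
proof -
  have 1: "(f has_derivative (\<lambda>v. 4 * ((p - p0) \<bullet> (p - p0)) * ((p - p0) \<bullet> v))) (at p)" for p
    unfolding f_def by (auto intro!: derivative_eq_intros simp: fun_eq_iff algebra_simps inner_commute)
  have 2: "((\<lambda>p. 4 * ((p - p0) \<bullet> (p - p0)) * ((p - p0) \<bullet> v)) has_derivative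
      (\<lambda>w. 8 * ((p - p0) \<bullet> w) * ((p - p0) \<bullet> v) + 4 * ((p - p0) \<bullet> (p - p0)) * (w \<bullet> v))) (at p)" for p v
    by (auto intro!: derivative_eq_intros simp: fun_eq_iff algebra_simps inner_commute)
  have "C1_on (\<lambda>p. 4 * ((p - p0) \<bullet> (p - p0)) * ((p - p0) \<bullet> v)) UNIV" for v
    by (rule C1_onI[OF 2]) (intro continuous_intros)
  from C2_onI[OF open_UNIV 1 this] show "C2_on f UNIV" .
  have fd: "fd f q = (\<lambda>v. 4 * ((q - p0) \<bullet> (q - p0)) * ((q - p0) \<bullet> v))" for q by (rule fd_eq[OF 1])
  show "fd f p0 v = 0" by (simp add: fd)
  show "fd (\<lambda>q. fd f q v) p0 w = 0" unfolding fd using fd_eq[OF 2, of v p0] by simp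
qed

context riemannian
begin

lemma C2_near_uminus: "C2_near \<A> x \<phi> \<Longrightarrow> C2_near \<A> x (\<lambda>y. - \<phi> y)"
proof -
  assume "C2_near \<A> x \<phi>"
  then obtain N where N: "open N" "x \<in> N" "\<And>c. c \<in> \<A> \<Longrightarrow> C2_on (\<phi> \<circ> chart_inv c) (ov c N)"
    by (auto simp: C2_near_iff)
  have "C2_on ((\<lambda>y. - \<phi> y) \<circ> chart_inv c) (ov c N)" if "c \<in> \<A>" for c
    using C2_on_bounded_linear[OF open_ov[OF that N(1)] bounded_linear_minus[OF bounded_linear_ident] N(3)[OF that]]
    by (simp add: o_def)
  with N show ?thesis by (auto simp: C2_near_iff)
qed

lemma C2_near_nhds: "C2_near \<A> x \<phi> \<Longrightarrow> \<forall>\<^sub>F y in nhds x. C2_near \<A> y \<phi>"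
  unfolding C2_near_iff eventually_nhds by blast

lemma C2_near_isCont: "C2_near \<A> x \<phi> \<Longrightarrow> isCont \<phi> x"
proof -
  assume "C2_near \<A> x \<phi>"
  then obtain N where N: "open N" "x \<in> N" "\<And>c. c \<in> \<A> \<Longrightarrow> C2_on (\<phi> \<circ> chart_inv c) (ov c N)"
    by (auto simp: C2_near_iff)
  obtain c where c: "c \<in> \<A>" "x \<in> fst c" using ex_chart by blast
  have "continuous_on (fst c \<inter> N) (\<lambda>y. (\<phi> \<circ> chart_inv c) (snd c y))"
    by (rule continuous_on_compose2[OF C1_on_continuous[OF C2_on_imp_C1_on[OF N(3)[OF c(1)]]]
        continuous_on_subset[OF chart(3)[OF c(1)]]]) auto
  then have "continuous_on (fst c \<inter> N) \<phi>"
    by (rule continuous_on_eq) (simp add: chart(5)[OF c(1)])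
  moreover have "open (fst c \<inter> N)" using chart(1)[OF c(1)] N(1) by blast
  ultimately show ?thesis using c(2) N(2) continuous_on_eq_continuous_at by blast
qed

text \<open>The fourth power of the coordinate distance is positive off \<open>x\<close> but has
  vanishing first and second derivatives there, so it does not disturb the jet; a quadratic penalty
  would change the Hessian.\<close>

lemma quartic_penalty:
  assumes N: "open N" "x \<in> N"
  shows "\<exists>\<theta> K. compact K \<and> K \<subseteq> N \<and> x \<in> interior K \<and>
      continuous_on K \<theta> \<and> \<theta> x = 0 \<and> (\<forall>y\<in>K - {x}. 0 < \<theta> y) \<and>
      (\<forall>\<phi> s. C2_near \<A> x \<phi> \<longrightarrow> C2_near \<A> x (\<lambda>y. \<phi> y + s * \<theta> y) \<and>
        gradient (\<lambda>y. \<phi> y + s * \<theta> y) x = gradient \<phi> x \<and>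
        hessian \<A> g (\<lambda>y. \<phi> y + s * \<theta> y) x = hessian \<A> g \<phi> x)"
proof -
  obtain c where c: "c \<in> \<A>" "x \<in> fst c" using ex_chart by blast
  define p0 where "p0 = snd c x"
  have "open (ov c N)" "p0 \<in> ov c N" using open_ov[OF c(1) N(1)] c(2) N(2) by (auto simp: p0_def)
  then obtain \<rho> where \<rho>: "\<rho> > 0" "cball p0 \<rho> \<subseteq> ov c N" using open_contains_cball by blast
  have im: "cball p0 \<rho> \<subseteq> chart_image c" using \<rho>(2) by blast
  define K where "K = chart_inv c ` cball p0 \<rho>"
  define q where "q = (\<lambda>p. ((p - p0) \<bullet> (p - p0))\<^sup>2)"
  define \<theta> where "\<theta> = (\<lambda>y. q (snd c y))"
  have "chart_inv c p \<in> fst c \<inter> N" if "p \<in> cball p0 \<rho>" for p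
    using subsetD[OF \<rho>(2) that] mem_ov[OF c(1), of p N] chart(7)[OF c(1), of p] by blast
  then have Kc: "K \<subseteq> fst c" "K \<subseteq> N" unfolding K_def by blast+
  have "compact K"
    unfolding K_def by (rule compact_continuous_image[OF continuous_on_subset[OF chart(4)[OF c(1)] im] compact_cball])
  moreover have "x \<in> interior K"
  proof (rule interiorI)
    show "open (fst c \<inter> snd c -` ball p0 \<rho>)" by (rule open_domain_preimage[OF c(1) open_ball])
    show "x \<in> fst c \<inter> snd c -` ball p0 \<rho>" using c(2) \<rho>(1) by (simp add: p0_def)
    show "fst c \<inter> snd c -` ball p0 \<rho> \<subseteq> K"
    proof
      fix y assume "y \<in> fst c \<inter> snd c -` ball p0 \<rho>"
      then have "y = chart_inv c (snd c y)" "snd c y \<in> cball p0 \<rho>" using chart(5)[OF c(1)] by auto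
      then show "y \<in> K" unfolding K_def by blast
    qed
  qed
  moreover have "continuous_on K \<theta>"
    unfolding \<theta>_def q_def by (intro continuous_intros continuous_on_subset[OF chart(3)[OF c(1)] Kc(1)])
  moreover have "\<theta> x = 0" by (simp add: \<theta>_def q_def p0_def)
  moreover have "0 < \<theta> y" if "y \<in> K - {x}" for y
  proof -
    have "y \<in> fst c" "y \<noteq> x" using that Kc by auto
    then have "snd c y \<noteq> p0" using chart(5)[OF c(1)] c(2) unfolding p0_def by metis
    then show ?thesis by (simp add: \<theta>_def q_def)
  qed
  moreover have "C2_near \<A> x (\<lambda>y. \<phi> y + s * \<theta> y) \<and>
        gradient (\<lambda>y. \<phi> y + s * \<theta> y) x = gradient \<phi> x \<and>
        hessian \<A> g (\<lambda>y. \<phi> y + s * \<theta> y) x = hessian \<A> g \<phi> x" if \<phi>: "C2_near \<A> x \<phi>" for \<phi> s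
  proof -
    obtain N' where N': "open N'" "x \<in> N'" "\<And>c. c \<in> \<A> \<Longrightarrow> C2_on (\<phi> \<circ> chart_inv c) (ov c N')"
      using \<phi> by (auto simp: C2_near_iff)
    \<comment> \<open>Outside the domain of \<open>c\<close> the values of \<open>snd c\<close>, and
      so of \<open>\<theta>\<close>, are arbitrary; the neighbourhood is therefore cut down to
      \<open>fst c\<close>.\<close>
    let ?\<psi> = "\<lambda>y. \<phi> y + s * \<theta> y" and ?M = "fst c \<inter> N'"
    have M: "open ?M" "x \<in> ?M" using N' c chart(1)[OF c(1)] by auto
    have "C2_on (?\<psi> \<circ> chart_inv d) (ov d ?M)" if d: "d \<in> \<A>" for d
    proof -
      have o: "open (ov d ?M)" by (rule open_ov[OF d M(1)])
      have "C2_on (\<lambda>p. q (tr d c p)) (ov d ?M)"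
        unfolding q_def
        by (rule C2_on_compose[OF o quartic(1) C2_on_subset[OF tr_C2[OF d c(1)]]]) auto
      then have "C2_on (\<lambda>p. (\<phi> \<circ> chart_inv d) p + s * q (tr d c p)) (ov d ?M)"
        by (intro C2_on_add[OF o] C2_on_subset[OF N'(3)[OF d]] C2_on_bounded_linear[OF o bounded_linear_mult_right]) auto
      then show ?thesis by (simp add: o_def \<theta>_def transition_def)
    qed
    then have \<psi>: "C2_near \<A> x ?\<psi>" using M unfolding C2_near_iff by blast
    let ?S = "ov c ?M" and ?h = "\<phi> \<circ> chart_inv c" and ?k = "?\<psi> \<circ> chart_inv c"
    have S: "open ?S" "p0 \<in> ?S" using open_ov[OF c(1) M(1)] M(2) c(2) by (auto simp: p0_def)
    have h: "C2_on ?h ?S" by (rule C2_on_subset[OF N'(3)[OF c(1)]]) auto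
    have k_eq: "?k p = ?h p + s * q p" if "p \<in> ?S" for p
      using that chart(6)[OF c(1), of p] by (auto simp: \<theta>_def)
    have q': "(q has_derivative fd q p) (at p)" for p using C2_onD[OF quartic(1), of p p0] by (simp add: q_def)
    have q'': "((\<lambda>p. fd q p w) has_derivative fd (\<lambda>p. fd q p w) p) (at p)" for p w
      using C1_onD[OF C2_on_fd[OF quartic(1)], of p p0 w] by (simp add: q_def)
    have fdk: "fd ?k p = (\<lambda>v. fd ?h p v + s * fd q p v)" if p: "p \<in> ?S" for p
    proof -
      have "fd ?k p = fd (\<lambda>p. ?h p + s * q p) p" by (rule fd_cong_open[OF S(1) p k_eq])
      also have "\<dots> = (\<lambda>v. fd ?h p v + s * fd q p v)"
        by (intro fd_eq has_derivative_add has_derivative_mult_right q' C2_onD[OF h p])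
      finally show ?thesis .
    qed
    have fd0: "fd ?k p0 = fd ?h p0" using fdk[OF S(2)] quartic(2)[of p0] by (simp add: q_def)
    have "fd (\<lambda>p. fd ?k p w) p0 = fd (\<lambda>p. fd ?h p w) p0" for w
    proof -
      have "fd (\<lambda>p. fd ?k p w) p0 = fd (\<lambda>p. fd ?h p w + s * fd q p w) p0"
        by (rule fd_cong_open[OF S]) (simp add: fdk)
      also have "\<dots> = (\<lambda>v. fd (\<lambda>p. fd ?h p w) p0 v + s * fd (\<lambda>p. fd q p w) p0 v)"
        by (intro fd_eq has_derivative_add has_derivative_mult_right q'' C1_onD[OF C2_on_fd[OF h] S(2)])
      finally show ?thesis using quartic(3)[of p0 w] by (simp add: q_def)
    qed
    then have "hess_coord c ?\<psi> p0 v w = hess_coord c \<phi> p0 v w" for v w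
      unfolding hess_coord_def fd0 by simp
    then have "hessian \<A> g ?\<psi> x \<xi> \<eta> = hessian \<A> g \<phi> x \<xi> \<eta>" for \<xi> \<eta>
    proof (cases "\<xi> \<in> tangent_space \<A> x \<and> \<eta> \<in> tangent_space \<A> x")
      case True
      with \<open>\<And>v w. hess_coord c ?\<psi> p0 v w = hess_coord c \<phi> p0 v w\<close> show ?thesis
        using hessian_eq[OF c \<psi>, of \<xi> \<eta>] hessian_eq[OF c \<phi>, of \<xi> \<eta>] by (simp add: p0_def)
    qed (auto simp: hessian_def)
    moreover have "grad_coord c ?\<psi> p0 = grad_coord c \<phi> p0" unfolding grad_coord_def fd0 ..
    then have "gradient ?\<psi> x = gradient \<phi> x"
      using gradient_eq[OF c \<psi>] gradient_eq[OF c \<phi>] by (simp add: p0_def)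
    ultimately show ?thesis using \<psi> by blast
  qed
  ultimately show ?thesis using Kc(2) by blast
qed

section \<open>The Riemannian distance\<close>

definition speed :: "(real \<Rightarrow> 'm) \<Rightarrow> real \<Rightarrow> real" where
  "speed \<gamma> t = sqrt (g (\<gamma> t) (velocity \<A> \<gamma> t) (velocity \<A> \<gamma> t))"

text \<open>Unlike in \<open>piecewise_C1_path\<close>, the interval is arbitrary and the finite set
  of break points need not contain the endpoints or lie in the interval, which eases restriction,
  gluing and reparametrization.\<close>

definition pw_C1_on :: "(real \<Rightarrow> 'm) \<Rightarrow> real \<Rightarrow> real \<Rightarrow> bool" where
  "pw_C1_on \<gamma> a b \<longleftrightarrow> continuous_on {a..b} \<gamma> \<and> (\<exists>S. finite S \<and>
     (\<forall>u v. a \<le> u \<and> u < v \<and> v \<le> b \<and> S \<inter> {u<..<v} = {} \<longrightarrow> C1_curve_on \<A> u v \<gamma>))"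

lemma C1_curve_on_subinterval:
  assumes "C1_curve_on \<A> a b \<gamma>" "a \<le> u" "v \<le> b"
  shows "C1_curve_on \<A> u v \<gamma>"
  unfolding C1_curve_on_def
proof
  fix c assume "c \<in> \<A>"
  with assms(1) obtain D where D: "continuous_on {t\<in>{a..b}. \<gamma> t \<in> fst c} D"
    "\<And>t. t \<in> {a..b} \<Longrightarrow> \<gamma> t \<in> fst c \<Longrightarrow> (snd c \<circ> \<gamma> has_vector_derivative D t) (at t within {a..b})"
    unfolding C1_curve_on_def by blast
  have sub: "{u..v} \<subseteq> {a..b}" using assms by auto
  show "\<exists>D. continuous_on {t\<in>{u..v}. \<gamma> t \<in> fst c} D \<and>
      (\<forall>t\<in>{u..v}. \<gamma> t \<in> fst c \<longrightarrow> (snd c \<circ> \<gamma> has_vector_derivative D t) (at t within {u..v}))"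
    using sub by (intro exI[of _ D] conjI ballI impI continuous_on_subset[OF D(1)]
        has_vector_derivative_within_subset[OF D(2)]) auto
qed

lemma piecewise_C1_path_iff: "piecewise_C1_path \<A> \<gamma> \<longleftrightarrow> pw_C1_on \<gamma> 0 1"
proof
  assume L: "piecewise_C1_path \<A> \<gamma>"
  then obtain S where S: "finite S" "{0, 1} \<subseteq> S" "S \<subseteq> {0..1}"
    and "\<forall>a\<in>S. \<forall>b\<in>S. a < b \<and> S \<inter> {a<..<b} = {} \<longrightarrow> C1_curve_on \<A> a b \<gamma>"
    unfolding piecewise_C1_path_def by blast
  then have S4: "C1_curve_on \<A> a b \<gamma>" if "a \<in> S" "b \<in> S" "a < b" "S \<inter> {a<..<b} = {}" for a b
    using that by simp
  have "C1_curve_on \<A> u v \<gamma>" if uv: "0 \<le> u" "u < v" "v \<le> 1" "S \<inter> {u<..<v} = {}" for u v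
  proof -
    \<comment> \<open>\<open>a\<close> and \<open>b\<close> are the break points that enclose
      \<open>u\<close> and \<open>v\<close>; none lies strictly between them, so the piece on
      \<open>{a..b}\<close> can be restricted.\<close>
    define a where "a = Max {s\<in>S. s \<le> u}"
    define b where "b = Min {s\<in>S. v \<le> s}"
    have fa: "finite {s\<in>S. s \<le> u}" "{s\<in>S. s \<le> u} \<noteq> {}" and fb: "finite {s\<in>S. v \<le> s}" "{s\<in>S. v \<le> s} \<noteq> {}"
      using S(1,2) uv by auto
    have a: "a \<in> S" "a \<le> u" and b: "b \<in> S" "v \<le> b" using Max_in[OF fa] Min_in[OF fb] by (auto simp: a_def b_def)
    have "S \<inter> {a<..<b} = {}"
    proof (rule ccontr)
      assume "S \<inter> {a<..<b} \<noteq> {}"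
      then obtain s where s: "s \<in> S" "a < s" "s < b" by auto
      have "u < s" using s(1,2) Max_ge[OF fa(1), of s] unfolding a_def by force
      moreover have "s < v" using s(1,3) Min_le[OF fb(1), of s] unfolding b_def by force
      ultimately show False using uv(4) s(1) by auto
    qed
    then have "C1_curve_on \<A> a b \<gamma>" using a b uv by (intro S4) auto
    from C1_curve_on_subinterval[OF this a(2) b(2)] show ?thesis .
  qed
  moreover have "continuous_on {0..1} \<gamma>" using L by (simp add: piecewise_C1_path_def path_def)
  ultimately show "pw_C1_on \<gamma> 0 1" using S(1) unfolding pw_C1_on_def by blast
next
  assume R: "pw_C1_on \<gamma> 0 1"
  then obtain S where S: "finite S"
    "\<And>u v. 0 \<le> u \<Longrightarrow> u < v \<Longrightarrow> v \<le> 1 \<Longrightarrow> S \<inter> {u<..<v} = {} \<Longrightarrow> C1_curve_on \<A> u v \<gamma>"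
    unfolding pw_C1_on_def by blast
  let ?S = "(S \<inter> {0..1}) \<union> {0, 1}"
  have "C1_curve_on \<A> a b \<gamma>" if "a \<in> ?S" "b \<in> ?S" "a < b" "?S \<inter> {a<..<b} = {}" for a b
    using that by (intro S(2)) auto
  moreover have "finite ?S" "{0, 1} \<subseteq> ?S" "?S \<subseteq> {0..1}" using S(1) by auto
  moreover have "path \<gamma>" using R by (simp add: pw_C1_on_def path_def)
  ultimately show "piecewise_C1_path \<A> \<gamma>" unfolding piecewise_C1_path_def by blast
qed

text \<open>\<open>velocity\<close> takes a derivative in each chart separately. Continuity keeps
  the curve inside the domain of \<open>c\<close> near \<open>t\<close>, so the chain rule for
  transition maps shows these derivatives to be the coordinates of one tangent vector.\<close>

lemma velocity_eq:
  assumes c: "c \<in> \<A>" "\<gamma> t \<in> fst c" and cont: "isCont \<gamma> t" and D: "(snd c \<circ> \<gamma> has_vector_derivative D) (at t)"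
  shows "velocity \<A> \<gamma> t = tv c (\<gamma> t) D"
proof
  fix d
  show "velocity \<A> \<gamma> t d = tv c (\<gamma> t) D d"
  proof (cases "d \<in> \<A> \<and> \<gamma> t \<in> fst d")
    case True
    have "tr c d differentiable at (snd c (\<gamma> t))"
      using True c by (intro C2_on_differentiable[OF tr_C2]) auto
    then have "(tr c d has_derivative jac c d (\<gamma> t)) (at ((snd c \<circ> \<gamma>) t))"
      by (simp add: jac_def frechet_derivative_works)
    from has_derivative_compose[OF D[unfolded has_vector_derivative_def] this]
    have "((\<lambda>s. tr c d ((snd c \<circ> \<gamma>) s)) has_vector_derivative jac c d (\<gamma> t) D) (at t)"
      using True c by (simp add: has_vector_derivative_def linear_scale[OF linear_jac])
    moreover have "\<forall>\<^sub>F s in nhds t. \<gamma> s \<in> fst c"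
      using topological_tendstoD[OF isCont_tendsto_nhds[OF cont] chart(1)[OF c(1)] c(2)] .
    then have "\<forall>\<^sub>F s in nhds t. tr c d ((snd c \<circ> \<gamma>) s) = (snd d \<circ> \<gamma>) s"
      by eventually_elim (simp add: tr_apply[OF c(1)])
    then obtain U where "open U" "t \<in> U" "\<And>s. s \<in> U \<Longrightarrow> tr c d ((snd c \<circ> \<gamma>) s) = (snd d \<circ> \<gamma>) s"
      unfolding eventually_nhds by blast
    ultimately have "(snd d \<circ> \<gamma> has_vector_derivative jac c d (\<gamma> t) D) (at t)"
      using has_vector_derivative_transform_within_open by blast
    from vector_derivative_at[OF this] show ?thesis using True by (simp add: velocity_def tv_apply)
  qed (auto simp: velocity_def tv_apply)
qed

lemma speed_eq:
  assumes "c \<in> \<A>" "\<gamma> t \<in> fst c" "isCont \<gamma> t" "(snd c \<circ> \<gamma> has_vector_derivative D) (at t)"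
  shows "speed \<gamma> t = sqrt (gm c (snd c (\<gamma> t)) D D)"
  unfolding speed_def velocity_eq[OF assms] by (simp add: gm_apply[OF assms(1,2)])

lemma speed_nonneg: "c \<in> \<A> \<Longrightarrow> \<gamma> t \<in> fst c \<Longrightarrow> isCont \<gamma> t \<Longrightarrow> (snd c \<circ> \<gamma> has_vector_derivative D) (at t) \<Longrightarrow> 0 \<le> speed \<gamma> t"
  using gm_pos[of c "snd c (\<gamma> t)" D] linear_0[OF gm_linear1, of c "snd c (\<gamma> t)" D]
  by (cases "D = 0") (auto simp: speed_eq)

lemma C1_curve_on_derivative:
  assumes "C1_curve_on \<A> u v \<gamma>" "c \<in> \<A>"
  shows "\<exists>D. continuous_on {t\<in>{u..v}. \<gamma> t \<in> fst c} D \<and>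
    (\<forall>t\<in>{u<..<v}. \<gamma> t \<in> fst c \<longrightarrow> (snd c \<circ> \<gamma> has_vector_derivative D t) (at t))"
proof -
  obtain D where D: "continuous_on {t\<in>{u..v}. \<gamma> t \<in> fst c} D"
    "\<And>t. t \<in> {u..v} \<Longrightarrow> \<gamma> t \<in> fst c \<Longrightarrow> (snd c \<circ> \<gamma> has_vector_derivative D t) (at t within {u..v})"
    using assms unfolding C1_curve_on_def by blast
  have "(snd c \<circ> \<gamma> has_vector_derivative D t) (at t)" if "t \<in> {u<..<v}" "\<gamma> t \<in> fst c" for t
    using D(2)[of t] that at_within_Icc_at[of u t v] by simp
  with D(1) show ?thesis by blast
qed

lemma pw_C1_on_regular:
  assumes "pw_C1_on \<gamma> a b"
  shows "\<exists>S. finite S \<and> (\<forall>t\<in>{a<..<b} - S. isCont \<gamma> t \<and>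
    (\<forall>c\<in>\<A>. \<gamma> t \<in> fst c \<longrightarrow> (\<exists>D. (snd c \<circ> \<gamma> has_vector_derivative D) (at t))))"
proof -
  obtain S where S: "finite S" "continuous_on {a..b} \<gamma>"
    "\<And>u v. a \<le> u \<Longrightarrow> u < v \<Longrightarrow> v \<le> b \<Longrightarrow> S \<inter> {u<..<v} = {} \<Longrightarrow> C1_curve_on \<A> u v \<gamma>"
    using assms unfolding pw_C1_on_def by blast
  have "isCont \<gamma> t \<and> (\<forall>c\<in>\<A>. \<gamma> t \<in> fst c \<longrightarrow> (\<exists>D. (snd c \<circ> \<gamma> has_vector_derivative D) (at t)))"
    if t: "t \<in> {a<..<b} - S" for t
  proof
    have "continuous_on {a<..<b} \<gamma>" by (rule continuous_on_subset[OF S(2)]) auto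
    then show "isCont \<gamma> t" using t by (simp add: continuous_on_eq_continuous_at)
    obtain d where d: "d > 0" "\<And>x. x \<in> S \<Longrightarrow> x \<noteq> t \<Longrightarrow> d \<le> dist t x"
      using finite_set_avoid[OF S(1), of t] by blast
    define u where "u = max a (t - d)"
    define v where "v = min b (t + d)"
    have uv: "a \<le> u" "u < t" "t < v" "v \<le> b" using t d(1) by (auto simp: u_def v_def)
    have "S \<inter> {u<..<v} = {}"
    proof (rule ccontr)
      assume "S \<inter> {u<..<v} \<noteq> {}"
      then obtain s where s: "s \<in> S" "u < s" "s < v" by auto
      then have "d \<le> dist t s" using t d(2) by auto
      then show False using s by (auto simp: u_def v_def dist_real_def)
    qed
    then have C: "C1_curve_on \<A> u v \<gamma>" using uv by (intro S(3)) auto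
    show "\<forall>c\<in>\<A>. \<gamma> t \<in> fst c \<longrightarrow> (\<exists>D. (snd c \<circ> \<gamma> has_vector_derivative D) (at t))"
      using C1_curve_on_derivative[OF C] uv by (meson greaterThanLessThan_iff)
  qed
  with S(1) show ?thesis by blast
qed

lemma speed_integrable_chart:
  assumes "C1_curve_on \<A> u v \<gamma>" "continuous_on {u..v} \<gamma>" "c \<in> \<A>" "\<gamma> ` {u..v} \<subseteq> fst c"
  shows "speed \<gamma> integrable_on {u..v}"
proof -
  obtain D where D: "continuous_on {t\<in>{u..v}. \<gamma> t \<in> fst c} D"
    "\<And>t. t \<in> {u<..<v} \<Longrightarrow> \<gamma> t \<in> fst c \<Longrightarrow> (snd c \<circ> \<gamma> has_vector_derivative D t) (at t)"
    using C1_curve_on_derivative[OF assms(1,3)] by blast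
  have eq: "{t\<in>{u..v}. \<gamma> t \<in> fst c} = {u..v}" using assms(4) by auto
  have p: "continuous_on {u..v} (\<lambda>t. snd c (\<gamma> t))"
    by (rule continuous_on_compose2[OF chart(3)[OF assms(3)] assms(2,4)])
  have im: "snd c (\<gamma> t) \<in> chart_image c" if "t \<in> {u..v}" for t using assms(4) that by blast
  have "continuous_on {u..v} (\<lambda>t. gm c (snd c (\<gamma> t)) (D t) (D t))"
  proof (rule continuous_on_apply_linear[where L = "\<lambda>t a. gm c (snd c (\<gamma> t)) a (D t)"])
    show "linear (\<lambda>a. gm c (snd c (\<gamma> t)) a (D t))" if "t \<in> {u..v}" for t
      using gm_linear1[OF assms(3) im[OF that]] .
    show "continuous_on {u..v} (\<lambda>t. gm c (snd c (\<gamma> t)) a (D t))" for a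
    proof (rule continuous_on_apply_linear[where L = "\<lambda>t. gm c (snd c (\<gamma> t)) a"])
      show "linear (gm c (snd c (\<gamma> t)) a)" if "t \<in> {u..v}" for t
        using gm_linear2[OF assms(3) im[OF that]] .
      show "continuous_on {u..v} (\<lambda>t. gm c (snd c (\<gamma> t)) a e)" for e
        using im by (intro continuous_on_compose2[OF gm_continuous[OF assms(3)] p]) auto
    qed (use D(1) eq in simp)
  qed (use D(1) eq in simp)
  then have "(\<lambda>t. sqrt (gm c (snd c (\<gamma> t)) (D t) (D t))) integrable_on {u..v}"
    by (intro integrable_continuous_interval continuous_intros)
  then show ?thesis
  proof (rule integrable_spike_finite[rotated 2])
    show "speed \<gamma> t = sqrt (gm c (snd c (\<gamma> t)) (D t) (D t))" if "t \<in> {u..v} - {u, v}" for t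
    proof (rule speed_eq[OF assms(3)])
      show "\<gamma> t \<in> fst c" using that assms(4) by blast
      then show "(snd c \<circ> \<gamma> has_vector_derivative D t) (at t)" using that by (intro D(2)) auto
      have "continuous_on {u<..<v} \<gamma>" by (rule continuous_on_subset[OF assms(2)]) auto
      then show "isCont \<gamma> t" using that by (simp add: continuous_on_eq_continuous_at)
    qed
  qed simp
qed

text \<open>A path may cross many charts, so integrability is proved near each parameter and then on
  the whole interval by Bolzano subdivision.\<close>

lemma speed_integrable:
  assumes "pw_C1_on \<gamma> a b"
  shows "speed \<gamma> integrable_on {a..b}"
proof (cases "a \<le> b")
  case True
  obtain S where S: "finite S" "continuous_on {a..b} \<gamma>"
    "\<And>u v. a \<le> u \<Longrightarrow> u < v \<Longrightarrow> v \<le> b \<Longrightarrow> S \<inter> {u<..<v} = {} \<Longrightarrow> C1_curve_on \<A> u v \<gamma>"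
    using assms unfolding pw_C1_on_def by blast
  define P where "P u v \<longleftrightarrow> (a \<le> u \<and> v \<le> b \<longrightarrow> speed \<gamma> integrable_on {u..v})" for u v
  have "P a b" using True
  proof (induction rule: Bolzano)
    case (trans u v w)
    then show ?case unfolding P_def by (auto intro: Henstock_Kurzweil_Integration.integrable_combine[of u v w])
  next
    case (local x)
    obtain c where c: "c \<in> \<A>" "\<gamma> x \<in> fst c" using ex_chart by blast
    have "(\<gamma> \<longlongrightarrow> \<gamma> x) (at x within {a..b})" using S(2) local by (simp add: continuous_on_def)
    from topological_tendstoD[OF this chart(1)[OF c(1)] c(2)]
    obtain e where e: "e > 0" "\<And>s. s \<in> {a..b} \<Longrightarrow> s \<noteq> x \<Longrightarrow> dist s x < e \<Longrightarrow> \<gamma> s \<in> fst c"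
      unfolding eventually_at by blast
    obtain d where d: "d > 0" "\<And>s. s \<in> S \<Longrightarrow> s \<noteq> x \<Longrightarrow> d \<le> dist x s"
      using finite_set_avoid[OF S(1), of x] by blast
    \<comment> \<open>Only intervals ending at \<open>x\<close> are treated directly:
      \<open>x\<close> itself may be a break point, but on either side of it no other is
      near.\<close>
    have piece: "speed \<gamma> integrable_on {u..v}" if uv: "a \<le> u" "v \<le> b" "u \<le> x" "x \<le> v" "v - u < min d e" "u = x \<or> v = x" for u v
    proof (cases "u < v")
      case True
      have "S \<inter> {u<..<v} = {}"
      proof (rule ccontr)
        assume "S \<inter> {u<..<v} \<noteq> {}"
        then obtain s where s: "s \<in> S" "u < s" "s < v" by auto
        then have "d \<le> dist x s" using uv(6) d(2) by auto
        then show False using s uv by (auto simp: dist_real_def)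
      qed
      then have "C1_curve_on \<A> u v \<gamma>" using True uv by (intro S(3)) auto
      moreover have "continuous_on {u..v} \<gamma>" using uv by (intro continuous_on_subset[OF S(2)]) auto
      moreover have "\<gamma> s \<in> fst c" if "s \<in> {u..v}" for s
        using that uv c(2) e(2)[of s] by (cases "s = x") (auto simp: dist_real_def)
      ultimately show ?thesis using c(1) by (intro speed_integrable_chart) auto
    next
      case False
      then have "u = v" using uv by auto
      then show ?thesis using integrable_on_refl[of "speed \<gamma>" v] by simp
    qed
    have "P u v" if uv: "u \<le> x" "x \<le> v" "v - u < min d e" for u v
      unfolding P_def
    proof
      assume "a \<le> u \<and> v \<le> b"
      then have "speed \<gamma> integrable_on {u..x}" "speed \<gamma> integrable_on {x..v}" using uv local by (auto intro!: piece)
      with uv show "speed \<gamma> integrable_on {u..v}"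
        by (intro Henstock_Kurzweil_Integration.integrable_combine[of u x v])
    qed
    with d(1) e(1) show ?case by (intro exI[of _ "min d e"]) auto
  qed
  then show ?thesis by (simp add: P_def)
next
  case False
  then show ?thesis using integrable_on_empty by simp
qed

text \<open>\<open>velocity\<close> uses the two-sided derivative, which at the endpoints also sees
  the curves outside the interval; the endpoints form a negligible set.\<close>

lemma integral_speed_cong:
  assumes "\<And>t. t \<in> {a..b} \<Longrightarrow> \<gamma> t = \<gamma>' t"
  shows "integral {a..b} (speed \<gamma>) = integral {a..b} (speed \<gamma>')"
proof (rule integral_spike[of "{a, b}"])
  show "speed \<gamma>' t = speed \<gamma> t" if t: "t \<in> {a..b} - {a, b}" for t
  proof -
    have "\<forall>\<^sub>F s in nhds t. s \<in> {a<..<b}" using t by (intro eventually_nhds_in_open) auto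
    then have ev: "\<forall>\<^sub>F s in nhds t. (snd c \<circ> \<gamma>) s = (snd c \<circ> \<gamma>') s" for c :: "('m, 'a) chart"
      by eventually_elim (use assms in auto)
    have "vector_derivative (snd c \<circ> \<gamma>) (at t) = vector_derivative (snd c \<circ> \<gamma>') (at t)" for c :: "('m, 'a) chart"
      by (rule vector_derivative_cong_eq) (use ev in \<open>auto elim: eventually_mono\<close>)
    moreover have "\<gamma> t = \<gamma>' t" using assms t by auto
    ultimately have "velocity \<A> \<gamma>' t = velocity \<A> \<gamma> t" by (auto simp: velocity_def fun_eq_iff)
    with \<open>\<gamma> t = \<gamma>' t\<close> show ?thesis by (simp add: speed_def)
  qed
qed auto

lemma C1_curve_on_cong:
  assumes "C1_curve_on \<A> a b \<gamma>'" "\<And>t. t \<in> {a..b} \<Longrightarrow> \<gamma> t = \<gamma>' t"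
  shows "C1_curve_on \<A> a b \<gamma>"
  unfolding C1_curve_on_def
proof
  fix c assume "c \<in> \<A>"
  then obtain D where D: "continuous_on {t\<in>{a..b}. \<gamma>' t \<in> fst c} D"
    "\<And>t. t \<in> {a..b} \<Longrightarrow> \<gamma>' t \<in> fst c \<Longrightarrow> (snd c \<circ> \<gamma>' has_vector_derivative D t) (at t within {a..b})"
    using assms(1) unfolding C1_curve_on_def by blast
  have "{t\<in>{a..b}. \<gamma>' t \<in> fst c} = {t\<in>{a..b}. \<gamma> t \<in> fst c}" using assms(2) by auto
  moreover have "(snd c \<circ> \<gamma> has_vector_derivative D t) (at t within {a..b})" if "t \<in> {a..b}" "\<gamma> t \<in> fst c" for t
    by (rule has_vector_derivative_transform[OF that(1) _ D(2)]) (use assms(2) that in auto)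
  ultimately show "\<exists>D. continuous_on {t\<in>{a..b}. \<gamma> t \<in> fst c} D \<and>
      (\<forall>t\<in>{a..b}. \<gamma> t \<in> fst c \<longrightarrow> (snd c \<circ> \<gamma> has_vector_derivative D t) (at t within {a..b}))"
    using D(1) by auto
qed

lemma pw_C1_on_cong:
  assumes "pw_C1_on \<gamma>' a b" "\<And>t. t \<in> {a..b} \<Longrightarrow> \<gamma> t = \<gamma>' t"
  shows "pw_C1_on \<gamma> a b"
proof -
  obtain S where S: "finite S" "continuous_on {a..b} \<gamma>'"
    "\<And>u v. a \<le> u \<Longrightarrow> u < v \<Longrightarrow> v \<le> b \<Longrightarrow> S \<inter> {u<..<v} = {} \<Longrightarrow> C1_curve_on \<A> u v \<gamma>'"
    using assms(1) unfolding pw_C1_on_def by blast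
  have "C1_curve_on \<A> u v \<gamma>" if "a \<le> u" "u < v" "v \<le> b" "S \<inter> {u<..<v} = {}" for u v
    by (rule C1_curve_on_cong[OF S(3)[OF that]]) (use assms(2) that in auto)
  moreover have "continuous_on {a..b} \<gamma>" using S(2) assms(2) by (metis continuous_on_cong)
  ultimately show ?thesis using S(1) unfolding pw_C1_on_def by blast
qed

lemma pw_C1_on_subinterval:
  assumes "pw_C1_on \<gamma> a b" "a \<le> u" "v \<le> b"
  shows "pw_C1_on \<gamma> u v"
proof -
  obtain S where S: "finite S" "continuous_on {a..b} \<gamma>"
    "\<And>u v. a \<le> u \<Longrightarrow> u < v \<Longrightarrow> v \<le> b \<Longrightarrow> S \<inter> {u<..<v} = {} \<Longrightarrow> C1_curve_on \<A> u v \<gamma>"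
    using assms(1) unfolding pw_C1_on_def by blast
  have "continuous_on {u..v} \<gamma>" by (rule continuous_on_subset[OF S(2)]) (use assms in auto)
  then show ?thesis
    using S(1,3) assms(2,3) unfolding pw_C1_on_def by (intro conjI exI[of _ S]) auto
qed

lemma pw_C1_on_combine:
  assumes "pw_C1_on \<gamma> a b" "pw_C1_on \<gamma> b c" "a \<le> b" "b \<le> c"
  shows "pw_C1_on \<gamma> a c"
proof -
  obtain S1 where S1: "finite S1" "continuous_on {a..b} \<gamma>"
    "\<And>u v. a \<le> u \<Longrightarrow> u < v \<Longrightarrow> v \<le> b \<Longrightarrow> S1 \<inter> {u<..<v} = {} \<Longrightarrow> C1_curve_on \<A> u v \<gamma>"
    using assms(1) unfolding pw_C1_on_def by blast
  obtain S2 where S2: "finite S2" "continuous_on {b..c} \<gamma>"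
    "\<And>u v. b \<le> u \<Longrightarrow> u < v \<Longrightarrow> v \<le> c \<Longrightarrow> S2 \<inter> {u<..<v} = {} \<Longrightarrow> C1_curve_on \<A> u v \<gamma>"
    using assms(2) unfolding pw_C1_on_def by blast
  let ?S = "insert b (S1 \<union> S2)"
  have "C1_curve_on \<A> u v \<gamma>" if uv: "a \<le> u" "u < v" "v \<le> c" "?S \<inter> {u<..<v} = {}" for u v
  proof (cases "v \<le> b")
    case True
    then show ?thesis using uv by (intro S1(3)) auto
  next
    case False
    then have "b \<le> u" using uv by (metis disjoint_insert(2) greaterThanLessThan_iff inf_commute not_le)
    then show ?thesis using uv by (intro S2(3)) auto
  qed
  moreover have "continuous_on ({a..b} \<union> {b..c}) \<gamma>"
    by (rule continuous_on_closed_Un[OF _ _ S1(2) S2(2)]) auto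
  then have "continuous_on {a..c} \<gamma>" using assms(3,4) by (simp add: ivl_disj_un_two_touch)
  moreover have "finite ?S" using S1 S2 by simp
  ultimately show ?thesis unfolding pw_C1_on_def by blast
qed

end

lemma integral_le_off_finite:
  fixes f h :: "real \<Rightarrow> real"
  assumes "finite S" "f integrable_on {a..b}" "h integrable_on {a..b}"
    "\<And>t. t \<in> {a..b} - S \<Longrightarrow> f t \<le> h t"
  shows "integral {a..b} f \<le> integral {a..b} h"
proof -
  let ?f = "\<lambda>t. if t \<in> S then h t else f t"
  have "integral {a..b} f = integral {a..b} ?f"
    by (rule integral_spike[OF negligible_finite[OF assms(1)]]) auto
  also have "?f integrable_on {a..b}"
    by (rule integrable_spike_finite[OF assms(1) _ assms(2)]) auto
  then have "integral {a..b} ?f \<le> integral {a..b} h"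
    by (rule integral_le[OF _ assms(3)]) (use assms(4) in auto)
  finally show ?thesis .
qed

context riemannian
begin

lemma length_nonneg:
  assumes "pw_C1_on \<gamma> a b"
  shows "0 \<le> integral {a..b} (speed \<gamma>)"
proof -
  obtain S where S: "finite S" "\<And>t. t \<in> {a<..<b} - S \<Longrightarrow> isCont \<gamma> t \<and>
    (\<forall>c\<in>\<A>. \<gamma> t \<in> fst c \<longrightarrow> (\<exists>D. (snd c \<circ> \<gamma> has_vector_derivative D) (at t)))"
    using pw_C1_on_regular[OF assms] by blast
  have nn: "0 \<le> speed \<gamma> t" if t: "t \<in> {a..b} - (S \<union> {a, b})" for t
  proof -
    obtain c where c: "c \<in> \<A>" "\<gamma> t \<in> fst c" using ex_chart by blast
    have r: "t \<in> {a<..<b} - S" using t by auto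
    with S(2)[OF r] c obtain D where "(snd c \<circ> \<gamma> has_vector_derivative D) (at t)" by blast
    then show ?thesis using speed_nonneg[where \<gamma> = \<gamma> and t = t, OF c] S(2)[OF r] by blast
  qed
  have "integral {a..b} (\<lambda>t. 0) \<le> integral {a..b} (speed \<gamma>)"
    by (rule integral_le_off_finite[of "S \<union> {a, b}", OF _ _ speed_integrable[OF assms] nn]) (use S(1) in auto)
  then show ?thesis by simp
qed

lemma pw_C1_on_affine:
  assumes \<gamma>: "pw_C1_on \<gamma> a b" and m: "m \<noteq> 0" and im: "\<And>t. t \<in> {u..v} \<Longrightarrow> m * t + k \<in> {a..b}"
  shows "pw_C1_on (\<lambda>t. \<gamma> (m * t + k)) u v"
proof -
  obtain S where S: "finite S" "continuous_on {a..b} \<gamma>"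
    "\<And>u v. a \<le> u \<Longrightarrow> u < v \<Longrightarrow> v \<le> b \<Longrightarrow> S \<inter> {u<..<v} = {} \<Longrightarrow> C1_curve_on \<A> u v \<gamma>"
    using \<gamma> unfolding pw_C1_on_def by blast
  let ?f = "\<lambda>t. m * t + k"
  let ?S = "?f -` S"
  have fin: "finite ?S" by (rule finite_vimageI[OF S(1)]) (use m in \<open>auto simp: inj_def\<close>)
  have cont: "continuous_on {u..v} (\<lambda>t. \<gamma> (m * t + k))"
    by (rule continuous_on_compose2[OF S(2)]) (use im in \<open>auto intro!: continuous_intros\<close>)
  have "C1_curve_on \<A> r s (\<lambda>t. \<gamma> (m * t + k))" if rs: "u \<le> r" "r < s" "s \<le> v" "?S \<inter> {r<..<s} = {}" for r s
  proof -
    define lo hi where "lo = min (?f r) (?f s)" and "hi = max (?f r) (?f s)"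
    have f_in: "?f t \<in> {lo..hi}" if "t \<in> {r..s}" for t
      using that m by (cases "0 < m") (auto simp: lo_def hi_def min_def max_def mult_le_cancel_left)
    have f_out: "(x - k) / m \<in> {r<..<s}" if "x \<in> {lo<..<hi}" for x
      using that m rs(2)
      by (cases "0 < m") (auto simp: lo_def hi_def min_def max_def mult_le_cancel_left field_simps split: if_splits)
    have "S \<inter> {lo<..<hi} = {}"
    proof (rule ccontr)
      assume "S \<inter> {lo<..<hi} \<noteq> {}"
      then obtain x where x: "x \<in> S" "x \<in> {lo<..<hi}" by blast
      then have "(x - k) / m \<in> ?S" using m by simp
      with f_out[OF x(2)] rs(4) show False by blast
    qed
    moreover have "m * r \<noteq> m * s" using rs(2) m by simp
    then have "lo < hi" unfolding lo_def hi_def by linarith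
    moreover have "a \<le> lo" "hi \<le> b" using im[of r] im[of s] rs by (auto simp: lo_def hi_def)
    ultimately have C: "C1_curve_on \<A> lo hi \<gamma>" by (intro S(3))
    show ?thesis
      unfolding C1_curve_on_def
    proof
      fix c assume "c \<in> \<A>"
      with C obtain D where D: "continuous_on {t\<in>{lo..hi}. \<gamma> t \<in> fst c} D"
        "\<And>t. t \<in> {lo..hi} \<Longrightarrow> \<gamma> t \<in> fst c \<Longrightarrow> (snd c \<circ> \<gamma> has_vector_derivative D t) (at t within {lo..hi})"
        unfolding C1_curve_on_def by blast
      have "continuous_on {t\<in>{r..s}. \<gamma> (?f t) \<in> fst c} (\<lambda>t. m *\<^sub>R D (?f t))"
        by (intro continuous_intros continuous_on_compose2[OF D(1)]) (use f_in in auto)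
      moreover have "(snd c \<circ> (\<lambda>t. \<gamma> (?f t)) has_vector_derivative m *\<^sub>R D (?f t)) (at t within {r..s})"
        if t: "t \<in> {r..s}" "\<gamma> (?f t) \<in> fst c" for t
      proof -
        have 1: "(?f has_vector_derivative m) (at t within {r..s})"
          by (auto intro!: derivative_eq_intros)
        have "?f ` {r..s} \<subseteq> {lo..hi}" using f_in by blast
        from has_vector_derivative_within_subset[OF D(2)[OF f_in[OF t(1)] t(2)] this]
        show ?thesis using vector_diff_chain_within[OF 1] by (simp add: o_def)
      qed
      ultimately show "\<exists>D. continuous_on {t\<in>{r..s}. \<gamma> (?f t) \<in> fst c} D \<and>
          (\<forall>t\<in>{r..s}. \<gamma> (?f t) \<in> fst c \<longrightarrow>
            (snd c \<circ> (\<lambda>t. \<gamma> (?f t)) has_vector_derivative D t) (at t within {r..s}))" by blast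
    qed
  qed
  with fin cont show ?thesis unfolding pw_C1_on_def by blast
qed

lemma speed_affine:
  assumes "isCont \<gamma> (m * t + k)" "c \<in> \<A>" "\<gamma> (m * t + k) \<in> fst c"
    "(snd c \<circ> \<gamma> has_vector_derivative D) (at (m * t + k))"
  shows "speed (\<lambda>t. \<gamma> (m * t + k)) t = \<bar>m\<bar> * speed \<gamma> (m * t + k)"
proof -
  have "((\<lambda>t. m * t + k) has_vector_derivative m) (at t)" by (auto intro!: derivative_eq_intros)
  from vector_diff_chain_at[OF this assms(4)]
  have D: "(snd c \<circ> (\<lambda>t. \<gamma> (m * t + k)) has_vector_derivative m *\<^sub>R D) (at t)" by (simp add: o_def)
  have cont: "isCont (\<lambda>t. \<gamma> (m * t + k)) t"
    by (rule isCont_o2[where f = "\<lambda>t. m * t + k" and g = \<gamma>]) (intro continuous_intros, rule assms(1))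
  let ?p = "snd c (\<gamma> (m * t + k))"
  have p: "?p \<in> chart_image c" using assms(3) by blast
  have "gm c ?p (m *\<^sub>R D) (m *\<^sub>R D) = m\<^sup>2 * gm c ?p D D"
    using linear_scale[OF gm_linear1[OF assms(2) p]] linear_scale[OF gm_linear2[OF assms(2) p]]
    by (simp add: power2_eq_square)
  then show ?thesis
    using speed_eq[where \<gamma> = "\<lambda>t. \<gamma> (m * t + k)" and t = t, OF assms(2) assms(3) cont D]
      speed_eq[where \<gamma> = \<gamma> and t = "m * t + k", OF assms(2,3,1,4)]
    by (simp add: real_sqrt_mult)
qed

text \<open>The factor \<open>\<bar>m\<bar>\<close> from the chain rule cancels the one from the
  change of variables, off a finite set of irregular times.\<close>

lemma integral_speed_affine:
  assumes \<gamma>: "pw_C1_on \<gamma> a b" and m: "m \<noteq> 0" and im: "(\<lambda>t. m * t + k) ` {u..v} = {a..b}" and "a < b"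
  shows "integral {u..v} (speed (\<lambda>t. \<gamma> (m * t + k))) = integral {a..b} (speed \<gamma>)"
proof -
  let ?f = "\<lambda>t. m * t + k"
  obtain S where S: "finite S" "\<And>t. t \<in> {a<..<b} - S \<Longrightarrow> isCont \<gamma> t \<and>
    (\<forall>c\<in>\<A>. \<gamma> t \<in> fst c \<longrightarrow> (\<exists>D. (snd c \<circ> \<gamma> has_vector_derivative D) (at t)))"
    using pw_C1_on_regular[OF \<gamma>] by blast
  let ?S = "?f -` (S \<union> {a, b})"
  have fin: "finite ?S" by (rule finite_vimageI) (use S(1) m in \<open>auto simp: inj_def\<close>)
  have eq: "speed (\<lambda>t. \<gamma> (?f t)) t = \<bar>m\<bar> * speed \<gamma> (?f t)" if t: "t \<in> {u..v} - ?S" for t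
  proof -
    have "?f t \<in> {a..b}" using im t by blast
    then have r: "?f t \<in> {a<..<b} - S" using t by auto
    obtain c where c: "c \<in> \<A>" "\<gamma> (?f t) \<in> fst c" using ex_chart by blast
    with S(2)[OF r] obtain D where "(snd c \<circ> \<gamma> has_vector_derivative D) (at (?f t))" by blast
    then show ?thesis using S(2)[OF r] c by (intro speed_affine) auto
  qed
  have im': "(\<lambda>x. (1 / m) *\<^sub>R x + - ((1 / m) *\<^sub>R k)) ` cbox a b = {u..v}"
  proof -
    have "(\<lambda>x. (1 / m) *\<^sub>R x + - ((1 / m) *\<^sub>R k)) ` cbox a b
        = (\<lambda>t. (1 / m) *\<^sub>R (m * t + k) + - ((1 / m) *\<^sub>R k)) ` {u..v}"
      unfolding im[symmetric] cbox_interval image_image ..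
    also have "\<dots> = {u..v}" using m by (simp add: field_simps)
    finally show ?thesis .
  qed
  have "(speed \<gamma> has_integral integral {a..b} (speed \<gamma>)) (cbox a b)"
    using speed_integrable[OF \<gamma>] by (simp add: integrable_integral)
  from has_integral_affinity[OF this m, of k]
  have "((\<lambda>t. speed \<gamma> (m * t + k)) has_integral (1 / \<bar>m\<bar>) * integral {a..b} (speed \<gamma>)) {u..v}"
    unfolding im' by simp
  from has_integral_mult_right[OF this, of "\<bar>m\<bar>"] m
  have "((\<lambda>t. \<bar>m\<bar> * speed \<gamma> (m * t + k)) has_integral integral {a..b} (speed \<gamma>)) {u..v}" by simp
  then have "((speed (\<lambda>t. \<gamma> (?f t))) has_integral integral {a..b} (speed \<gamma>)) {u..v}"
    by (rule has_integral_spike_finite[OF fin, rotated]) (rule eq)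
  then show ?thesis by (rule integral_unique)
qed

section \<open>The distance through strict inequalities\<close>

abbreviation dist_less :: "'m \<Rightarrow> 'm \<Rightarrow> real \<Rightarrow> bool" where
  "dist_less x y r \<equiv> riem_dist \<A> g x y < ereal r"

lemma path_len_eq: "path_len \<A> g \<gamma> = integral {0..1} (speed \<gamma>)"
  unfolding path_len_def speed_def ..

text \<open>Strict inequalities with a real bound avoid both infinite distances and the question
  whether the infimum is attained.\<close>

lemma dist_less_iff:
  "dist_less x y r \<longleftrightarrow> (\<exists>\<gamma>. pw_C1_on \<gamma> 0 1 \<and> \<gamma> 0 = x \<and> \<gamma> 1 = y \<and> integral {0..1} (speed \<gamma>) < r)"
  by (auto simp: riem_dist_def INF_less_iff piecewise_C1_path_iff pathstart_def pathfinish_def path_len_eq)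

lemma dist_lessI:
  assumes "pw_C1_on \<gamma> a b" "a < b" "integral {a..b} (speed \<gamma>) < r"
  shows "dist_less (\<gamma> a) (\<gamma> b) r"
proof -
  have im: "(\<lambda>t. (b - a) * t + a) ` {0..1} = {a..b}"
    using assms(2) image_affinity_atLeastAtMost[of "b - a" a 0 1] by simp
  have ne: "b - a \<noteq> 0" using assms(2) by simp
  have "pw_C1_on (\<lambda>t. \<gamma> ((b - a) * t + a)) 0 1"
    by (rule pw_C1_on_affine[OF assms(1) ne]) (use im in blast)
  with integral_speed_affine[OF assms(1) ne im assms(2)] assms(3) show ?thesis
    unfolding dist_less_iff by (intro exI[of _ "\<lambda>t. \<gamma> ((b - a) * t + a)"]) auto
qed

lemma dist_less_sym:
  assumes "dist_less x y r"
  shows "dist_less y x r"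
proof -
  obtain \<gamma> where \<gamma>: "pw_C1_on \<gamma> 0 1" "\<gamma> 0 = x" "\<gamma> 1 = y" "integral {0..1} (speed \<gamma>) < r"
    using assms unfolding dist_less_iff by blast
  have im: "(\<lambda>t. -1 * t + 1) ` {0..1} = {0..(1::real)}"
    using image_affinity_atLeastAtMost[of "-1" "1::real" 0 1] by simp
  have "pw_C1_on (\<lambda>t. \<gamma> (-1 * t + 1)) 0 1"
    by (rule pw_C1_on_affine[OF \<gamma>(1)]) auto
  moreover have "integral {0..1} (speed (\<lambda>t. \<gamma> (-1 * t + 1))) = integral {0..1} (speed \<gamma>)"
    by (rule integral_speed_affine[OF \<gamma>(1) _ im]) auto
  ultimately show ?thesis
    using \<gamma> unfolding dist_less_iff by (intro exI[of _ "\<lambda>t. \<gamma> (-1 * t + 1)"]) auto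
qed

lemma dist_less_trans:
  assumes "dist_less x y r" "dist_less y z s"
  shows "dist_less x z (r + s)"
proof -
  obtain \<gamma> where \<gamma>: "pw_C1_on \<gamma> 0 1" "\<gamma> 0 = x" "\<gamma> 1 = y" "integral {0..1} (speed \<gamma>) < r"
    using assms(1) unfolding dist_less_iff by blast
  obtain \<beta> where \<beta>: "pw_C1_on \<beta> 0 1" "\<beta> 0 = y" "\<beta> 1 = z" "integral {0..1} (speed \<beta>) < s"
    using assms(2) unfolding dist_less_iff by blast
  \<comment> \<open>The two paths are joined on \<open>{0..2}\<close>; \<open>dist_lessI\<close>
    takes care of the rescaling.\<close>
  define \<alpha> where "\<alpha> = (\<lambda>t. if t \<le> 1 then \<gamma> t else \<beta> (1 * t + (-1)))"
  have 1: "\<alpha> t = \<gamma> t" if "t \<in> {0..1}" for t using that by (simp add: \<alpha>_def)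
  have 2: "\<alpha> t = \<beta> (1 * t + (-1))" if "t \<in> {1..2}" for t
    using that \<gamma>(3) \<beta>(2) by (cases "t = 1") (auto simp: \<alpha>_def)
  have im: "(\<lambda>t. 1 * t + (-1)) ` {1..2} = {0..(1::real)}"
    using image_affinity_atLeastAtMost[of 1 "-1::real" 1 2] by simp
  have p1: "pw_C1_on \<alpha> 0 1" using pw_C1_on_cong[OF \<gamma>(1) 1] .
  have "pw_C1_on (\<lambda>t. \<beta> (1 * t + (-1))) 1 2" by (rule pw_C1_on_affine[OF \<beta>(1)]) auto
  from pw_C1_on_cong[OF this 2] have p2: "pw_C1_on \<alpha> 1 2" .
  have p: "pw_C1_on \<alpha> 0 2" by (rule pw_C1_on_combine[OF p1 p2]) auto
  have i1: "integral {0..1} (speed \<alpha>) = integral {0..1} (speed \<gamma>)" by (rule integral_speed_cong[OF 1])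
  have "integral {1..2} (speed \<alpha>) = integral {1..2} (speed (\<lambda>t. \<beta> (1 * t + (-1))))"
    by (rule integral_speed_cong[OF 2])
  also have "\<dots> = integral {0..1} (speed \<beta>)" by (rule integral_speed_affine[OF \<beta>(1) _ im]) auto
  finally have i2: "integral {1..2} (speed \<alpha>) = integral {0..1} (speed \<beta>)" .
  have "integral {0..1} (speed \<alpha>) + integral {1..2} (speed \<alpha>) = integral {0..2} (speed \<alpha>)"
    by (rule Henstock_Kurzweil_Integration.integral_combine[OF _ _ speed_integrable[OF p]]) auto
  then have "integral {0..2} (speed \<alpha>) < r + s" using i1 i2 \<gamma>(4) \<beta>(4) by simp
  from dist_lessI[OF p _ this] show ?thesis using \<gamma>(2) \<beta>(3) by (simp add: \<alpha>_def)
qed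

text \<open>The path is cut where the initial part is shorter than \<open>r\<close> and the rest
  shorter than \<open>s\<close>. Such points replace points on minimizing geodesics in the
  Hopf-Rinow argument.\<close>

lemma dist_less_split:
  assumes "dist_less x z (r + s)" "0 < r" "0 < s"
  shows "\<exists>y. dist_less x y r \<and> dist_less y z s"
proof -
  obtain \<gamma> where \<gamma>: "pw_C1_on \<gamma> 0 1" "\<gamma> 0 = x" "\<gamma> 1 = z" "integral {0..1} (speed \<gamma>) < r + s"
    using assms(1) unfolding dist_less_iff by blast
  have int: "speed \<gamma> integrable_on {0..1}" by (rule speed_integrable[OF \<gamma>(1)])
  define L where "L = (\<lambda>t. integral {0..t} (speed \<gamma>))"
  have L: "continuous_on {0..1} L" unfolding L_def by (rule indefinite_integral_continuous_1[OF int])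
  have comb: "L t + integral {t..1} (speed \<gamma>) = L 1" if "0 \<le> t" "t \<le> 1" for t
    unfolding L_def by (rule Henstock_Kurzweil_Integration.integral_combine[OF that int])
  have L0: "L 0 = 0" by (simp add: L_def)
  have L1: "L 1 < r + s" using \<gamma>(4) by (simp add: L_def)
  \<comment> \<open>The cut must be interior because \<open>dist_lessI\<close> needs nondegenerate
    intervals. If the whole path is shorter than \<open>s\<close>, a small time works; otherwise the
    intermediate value theorem reaches a length \<open>a\<close> between \<open>L 1 - s\<close> and
    \<open>min r (L 1)\<close>.\<close>
  have "\<exists>t. 0 < t \<and> t < 1 \<and> L t < r \<and> L 1 - L t < s"
  proof -
    show ?thesis
    proof (cases "L 1 < s")
      case True
      have "(L \<longlongrightarrow> L 0) (at 0 within {0..1})" using L by (simp add: continuous_on_def)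
      then have "\<forall>\<^sub>F t in at 0 within {0..1}. dist (L t) (L 0) < min r (s - L 1)"
        using assms True by (intro tendstoD) auto
      then obtain d where d: "d > 0" "\<And>t. t \<in> {0..1} \<Longrightarrow> t \<noteq> 0 \<Longrightarrow> dist t 0 < d \<Longrightarrow> dist (L t) (L 0) < min r (s - L 1)"
        unfolding eventually_at by blast
      define t where "t = min d 1 / 2"
      have t: "0 < t" "t < 1" "t < d" using d(1) by (auto simp: t_def)
      then have "dist (L t) (L 0) < min r (s - L 1)" by (intro d(2)) auto
      then have "\<bar>L t\<bar> < r" "\<bar>L t\<bar> < s - L 1" by (auto simp: L0 dist_real_def)
      then show ?thesis using t by (intro exI[of _ t]) linarith
    next
      case False
      define a where "a = (max 0 (L 1 - s) + min r (L 1)) / 2"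
      have a: "L 1 - s < a" "a < r" "0 < a" "a < L 1"
        using False assms L1 by (auto simp: a_def max_def min_def)
      have "\<exists>t\<ge>0. t \<le> 1 \<and> L t = a" using a L0 L by (intro IVT') auto
      then obtain t where t: "0 \<le> t" "t \<le> 1" "L t = a" by blast
      then have "t \<noteq> 0" "t \<noteq> 1" using a L0 by auto
      with t a show ?thesis by (intro exI[of _ t]) auto
    qed
  qed
  then obtain t where t: "0 < t" "t < 1" "L t < r" "L 1 - L t < s" by blast
  have "dist_less (\<gamma> 0) (\<gamma> t) r"
    by (rule dist_lessI[OF pw_C1_on_subinterval[OF \<gamma>(1)]]) (use t in \<open>auto simp: L_def\<close>)
  moreover have "dist_less (\<gamma> t) (\<gamma> 1) s"
    by (rule dist_lessI[OF pw_C1_on_subinterval[OF \<gamma>(1)]]) (use t comb[of t] in auto)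
  ultimately show ?thesis using \<gamma>(2,3) by auto
qed

lemma metric_bounds:
  assumes c: "c \<in> \<A>" "x \<in> fst c" and N: "open N" "x \<in> N"
  shows "\<exists>m M \<rho>. 0 < m \<and> 0 < M \<and> 0 < \<rho> \<and> cball (snd c x) \<rho> \<subseteq> ov c N \<and>
    (\<forall>q\<in>cball (snd c x) \<rho>. \<forall>v. m * (norm v)\<^sup>2 \<le> gm c q v v \<and> gm c q v v \<le> M * (norm v)\<^sup>2)"
proof -
  let ?p = "snd c x"
  have p: "?p \<in> chart_image c" using c by blast
  obtain m M where mM: "0 < m" "0 < M"
    and "\<forall>\<^sub>F q in nhds ?p. \<forall>v. m * (norm v)\<^sup>2 \<le> gm c q v v \<and> gm c q v v \<le> M * (norm v)\<^sup>2"
    using local_norm_equivalence[OF chart(2)[OF c(1)] p gm_linear1[OF c(1)] gm_linear2[OF c(1)]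
        gm_pos[OF c(1) p] gm_continuous[OF c(1)]] by blast
  moreover have "\<forall>\<^sub>F q in nhds ?p. q \<in> ov c N"
    using c N open_ov[OF c(1) N(1)] by (intro eventually_nhds_in_open) auto
  ultimately have "\<forall>\<^sub>F q in nhds ?p. q \<in> ov c N \<and>
      (\<forall>v. m * (norm v)\<^sup>2 \<le> gm c q v v \<and> gm c q v v \<le> M * (norm v)\<^sup>2)" by (intro eventually_conj)
  then obtain r where r: "r > 0" "\<And>q. dist q ?p < r \<Longrightarrow> q \<in> ov c N \<and>
      (\<forall>v. m * (norm v)\<^sup>2 \<le> gm c q v v \<and> gm c q v v \<le> M * (norm v)\<^sup>2)"
    unfolding eventually_nhds_metric by blast
  have *: "dist q ?p < r" if "q \<in> cball ?p (r / 2)" for q using that r(1) by (auto simp: dist_commute)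
  have "cball ?p (r / 2) \<subseteq> ov c N \<and>
      (\<forall>q\<in>cball ?p (r / 2). \<forall>v. m * (norm v)\<^sup>2 \<le> gm c q v v \<and> gm c q v v \<le> M * (norm v)\<^sup>2)"
    using r(2)[OF *] by blast
  moreover have "0 < r / 2" using r(1) by simp
  ultimately show ?thesis using mM by blast
qed

text \<open>The straight segment in coordinates has length at most \<open>sqrt M\<close> times its
  Euclidean length, so points close in the manifold topology are close in distance.\<close>

lemma dist_less_nhds:
  assumes "0 < e"
  shows "\<forall>\<^sub>F y in nhds x. dist_less y x e"
proof -
  obtain c where c: "c \<in> \<A>" "x \<in> fst c" using ex_chart by blast
  define p where "p = snd c x"
  obtain m M \<rho> where b: "0 < M" "0 < \<rho>" "cball p \<rho> \<subseteq> ov c UNIV"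
    "\<And>q v. q \<in> cball p \<rho> \<Longrightarrow> gm c q v v \<le> M * (norm v)\<^sup>2"
    using metric_bounds[OF c open_UNIV UNIV_I] unfolding p_def by blast
  have bound: "dist_less (chart_inv c q) x e" if q: "q \<in> ball p \<rho>" "sqrt M * norm (p - q) < e" for q
  proof -
    let ?\<gamma> = "\<lambda>t. chart_inv c (q + t *\<^sub>R (p - q))"
    have seg: "q + t *\<^sub>R (p - q) \<in> cball p \<rho>" if "t \<in> {0..1}" for t
    proof -
      have "q + t *\<^sub>R (p - q) = (1 - t) *\<^sub>R q + t *\<^sub>R p" by (simp add: algebra_simps)
      moreover have "(1 - t) *\<^sub>R q + t *\<^sub>R p \<in> cball p \<rho>"
        using convex_cball[of p \<rho>] q(1) b(2) that by (intro convexD) auto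
      ultimately show ?thesis by simp
    qed
    have im: "q + t *\<^sub>R (p - q) \<in> chart_image c" if "t \<in> {0..1}" for t using seg[OF that] b(3) by blast
    have cont: "continuous_on {0..1} ?\<gamma>"
      by (rule continuous_on_compose2[OF chart(4)[OF c(1)]]) (use im in \<open>auto intro!: continuous_intros\<close>)
    have deriv: "(snd d \<circ> ?\<gamma> has_vector_derivative fd (tr c d) (q + t *\<^sub>R (p - q)) (p - q)) (at t)"
      if "t \<in> {0..1}" "d \<in> \<A>" "?\<gamma> t \<in> fst d" for t d
    proof -
      have "q + t *\<^sub>R (p - q) \<in> ov c (fst d)" using im[OF that(1)] that(3) mem_ov[OF c(1)] by blast
      from has_derivative_line[OF C2_on_differentiable[OF tr_C2[OF c(1) that(2)] this]]
      show ?thesis by (simp add: o_def transition_def)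
    qed
    have "C1_curve_on \<A> 0 1 ?\<gamma>"
      unfolding C1_curve_on_def
    proof
      fix d assume d: "d \<in> \<A>"
      have "continuous_on {t\<in>{0..1}. ?\<gamma> t \<in> fst d} (\<lambda>t. fd (tr c d) (q + t *\<^sub>R (p - q)) (p - q))"
        by (rule continuous_on_compose2[OF C1_on_continuous[OF C2_on_fd[OF tr_C2[OF c(1) d]]]])
           (use im mem_ov[OF c(1)] in \<open>auto intro!: continuous_intros\<close>)
      then show "\<exists>D. continuous_on {t\<in>{0..1}. ?\<gamma> t \<in> fst d} D \<and> (\<forall>t\<in>{0..1}. ?\<gamma> t \<in> fst d \<longrightarrow>
          (snd d \<circ> ?\<gamma> has_vector_derivative D t) (at t within {0..1}))"
        using deriv[OF _ d] by (blast intro: has_vector_derivative_at_within)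
    qed
    then have pw: "pw_C1_on ?\<gamma> 0 1"
      unfolding pw_C1_on_def
      by (intro conjI cont exI[of _ "{}"]) (auto intro: C1_curve_on_subinterval)
    have "integral {0..1} (speed ?\<gamma>) \<le> integral {0..1} (\<lambda>t::real. sqrt M * norm (p - q))"
    proof (rule integral_le_off_finite[of "{0, 1}"])
      fix t :: real assume "t \<in> {0..1} - {0, 1}"
      then have t: "t \<in> {0..1}" "t \<in> {0<..<1}" by auto
      have \<gamma>c: "?\<gamma> t \<in> fst c" by (rule chart(7)[OF c(1) im[OF t(1)]])
      have "continuous_on {0<..<1} ?\<gamma>" by (rule continuous_on_subset[OF cont]) auto
      then have "isCont ?\<gamma> t" using t(2) by (simp add: continuous_on_eq_continuous_at)
      moreover have "fd (tr c c) (q + t *\<^sub>R (p - q)) (p - q) = p - q"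
        using jac_self[OF c(1) \<gamma>c, of "p - q"] chart(6)[OF c(1) im[OF t(1)]] by (simp add: jac_def)
      ultimately have "speed ?\<gamma> t = sqrt (gm c (q + t *\<^sub>R (p - q)) (p - q) (p - q))"
        using speed_eq[where \<gamma> = ?\<gamma> and t = t, OF c(1) \<gamma>c _ deriv[OF t(1) c(1) \<gamma>c]] chart(6)[OF c(1) im[OF t(1)]] by simp
      also have "\<dots> \<le> sqrt (M * (norm (p - q))\<^sup>2)" using b(4)[OF seg[OF t(1)]] by simp
      also have "\<dots> = sqrt M * norm (p - q)" by (simp add: real_sqrt_mult)
      finally show "speed ?\<gamma> t \<le> sqrt M * norm (p - q)" .
    qed (use speed_integrable[OF pw] in auto)
    also have "\<dots> < e" using q(2) by simp
    finally have "dist_less (?\<gamma> 0) (?\<gamma> 1) e" by (intro dist_lessI[OF pw]) auto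
    then show ?thesis using chart(5)[OF c] by (simp add: p_def)
  qed
  have "isCont (snd c) x" using chart(3,1)[OF c(1)] c(2) by (simp add: continuous_on_eq_continuous_at)
  then have lim: "(snd c \<longlongrightarrow> p) (nhds x)" unfolding p_def by (rule isCont_tendsto_nhds)
  then have "((\<lambda>y. sqrt M * norm (p - snd c y)) \<longlongrightarrow> sqrt M * norm (p - p)) (nhds x)"
    by (intro tendsto_intros)
  then have "\<forall>\<^sub>F y in nhds x. sqrt M * norm (p - snd c y) < e" using assms by (intro order_tendstoD(2)) auto
  moreover have "\<forall>\<^sub>F y in nhds x. snd c y \<in> ball p \<rho>"
    using topological_tendstoD[OF lim open_ball] b(2) by simp
  moreover have "\<forall>\<^sub>F y in nhds x. y \<in> fst c" using c chart(1)[OF c(1)] by (intro eventually_nhds_in_open) auto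
  ultimately show ?thesis
    by eventually_elim (use bound chart(5)[OF c(1)] in metis)
qed

text \<open>A path that leaves a coordinate ball has a piece of definite length before its first exit.\<close>

lemma dist_less_compact:
  "\<exists>e>0. \<exists>K. compact K \<and> (\<forall>y. dist_less x y e \<longrightarrow> y \<in> K)"
proof -
  obtain c where c: "c \<in> \<A>" "x \<in> fst c" using ex_chart by blast
  define p where "p = snd c x"
  obtain m M \<rho> where b: "0 < m" "0 < \<rho>" "cball p \<rho> \<subseteq> ov c UNIV"
    "\<And>q v. q \<in> cball p \<rho> \<Longrightarrow> m * (norm v)\<^sup>2 \<le> gm c q v v"
    using metric_bounds[OF c open_UNIV UNIV_I] unfolding p_def by blast
  have im: "cball p \<rho> \<subseteq> chart_image c" using b(3) by blast
  define K where "K = chart_inv c ` cball p \<rho>"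
  define W where "W = fst c \<inter> snd c -` ball p \<rho>"
  have K: "compact K"
    unfolding K_def by (rule compact_continuous_image[OF continuous_on_subset[OF chart(4)[OF c(1)] im] compact_cball])
  have W: "open W" "x \<in> W"
    unfolding W_def using open_domain_preimage[OF c(1) open_ball] c b(2) by (auto simp: p_def)
  have KD: "y \<in> fst c \<and> snd c y \<in> cball p \<rho>" if "y \<in> K" for y
  proof -
    obtain q where q: "y = chart_inv c q" "q \<in> cball p \<rho>" using \<open>y \<in> K\<close> unfolding K_def by blast
    then have "q \<in> chart_image c" using im by blast
    with chart(6,7)[OF c(1) this] q show ?thesis by simp
  qed
  have WK: "W \<subseteq> K"
  proof
    fix y assume "y \<in> W"
    then have "y = chart_inv c (snd c y)" "snd c y \<in> cball p \<rho>" using chart(5)[OF c(1)] by (auto simp: W_def)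
    then show "y \<in> K" unfolding K_def by blast
  qed
  \<comment> \<open>Before leaving the ball a path covers a coordinate distance of at least \<rho>,
    and its speed is at least \<open>sqrt m\<close> times the coordinate speed; this gives the
    radius.\<close>
  have "y \<in> K" if y: "dist_less x y (sqrt m * \<rho>)" for y
  proof (rule ccontr)
    assume "y \<notin> K"
    obtain \<gamma> where \<gamma>: "pw_C1_on \<gamma> 0 1" "\<gamma> 0 = x" "\<gamma> 1 = y" "integral {0..1} (speed \<gamma>) < sqrt m * \<rho>"
      using y unfolding dist_less_iff by blast
    have cont: "continuous_on {0..1} \<gamma>" using \<gamma>(1) by (simp add: pw_C1_on_def)
    define E where "E = {0..1} \<inter> \<gamma> -` (- W)"
    have "closed E" unfolding E_def using W(1) by (intro continuous_closed_preimage[OF cont]) auto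
    moreover have E1: "1 \<in> E" using \<gamma>(3) \<open>y \<notin> K\<close> WK by (auto simp: E_def)
    moreover have "bdd_below E" by (rule bdd_belowI[of _ 0]) (auto simp: E_def)
    ultimately have \<tau>E: "Inf E \<in> E" by (intro closed_contains_Inf) auto
    define \<tau> where "\<tau> = Inf E"
    have \<tau>: "0 \<le> \<tau>" "\<tau> \<le> 1" "\<gamma> \<tau> \<notin> W" using \<tau>E by (auto simp: E_def \<tau>_def)
    have "\<tau> \<noteq> 0" using \<tau>(3) \<gamma>(2) W(2) by auto
    then have \<tau>0: "0 < \<tau>" using \<tau>(1) by simp
    have before: "\<gamma> t \<in> W" if "0 \<le> t" "t < \<tau>" for t
    proof (rule ccontr)
      assume "\<gamma> t \<notin> W"
      then have "t \<in> E" using that \<tau>(2) by (auto simp: E_def)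
      then have "\<tau> \<le> t" unfolding \<tau>_def using \<open>bdd_below E\<close> by (rule cInf_lower)
      with that show False by simp
    qed
    \<comment> \<open>Closedness of \<open>K\<close> extends membership to the exit time
      itself.\<close>
    have \<gamma>K: "\<gamma> t \<in> K" if "t \<in> {0..\<tau>}" for t
    proof -
      have "closed ({0..1} \<inter> \<gamma> -` K)" by (rule continuous_closed_preimage[OF cont]) (auto intro: compact_imp_closed K)
      moreover have "{0..<\<tau>} \<subseteq> {0..1} \<inter> \<gamma> -` K" using before subsetD[OF WK] \<tau>(2) by auto
      ultimately have "closure {0..<\<tau>} \<subseteq> {0..1} \<inter> \<gamma> -` K" by (rule closure_minimal[rotated])
      then show ?thesis using that \<tau>0 by auto
    qed
    have "snd c (\<gamma> \<tau>) \<notin> ball p \<rho>" using \<tau>(3) KD[OF \<gamma>K[of \<tau>]] \<tau>(1) by (auto simp: W_def)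
    then have far: "\<rho> \<le> norm (snd c (\<gamma> \<tau>) - snd c (\<gamma> 0))" by (simp add: \<gamma>(2) p_def[symmetric] dist_norm norm_minus_commute)
    obtain S where S: "finite S" "\<And>t. t \<in> {0<..<1} - S \<Longrightarrow> isCont \<gamma> t \<and>
      (\<forall>c\<in>\<A>. \<gamma> t \<in> fst c \<longrightarrow> (\<exists>D. (snd c \<circ> \<gamma> has_vector_derivative D) (at t)))"
      using pw_C1_on_regular[OF \<gamma>(1)] by blast
    \<comment> \<open>Zero at irregular times and outside the open interval, so that the norm bound
      by \<open>s'\<close> holds everywhere; the fundamental theorem tolerates the finitely many
      exceptions.\<close>
    define f' where "f' t = (if t \<in> {0<..<\<tau>} - S then vector_derivative (snd c \<circ> \<gamma>) (at t) else 0)" for t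
    have D: "isCont \<gamma> t" "(snd c \<circ> \<gamma> has_vector_derivative f' t) (at t)" if t: "t \<in> {0<..<\<tau>} - S" for t
    proof -
      have t1: "t \<in> {0<..<1} - S" using t \<tau>(2) by auto
      then show "isCont \<gamma> t" using S(2) by blast
      have "\<gamma> t \<in> fst c" using KD[OF \<gamma>K[of t]] t by auto
      then obtain D where "(snd c \<circ> \<gamma> has_vector_derivative D) (at t)" using S(2)[OF t1] c(1) by blast
      then show "(snd c \<circ> \<gamma> has_vector_derivative f' t) (at t)"
        using t vector_derivative_at by (auto simp: f'_def)
    qed
    have "continuous_on {0..\<tau>} (snd c \<circ> \<gamma>)"
    proof (rule continuous_on_compose[OF continuous_on_subset[OF cont] continuous_on_subset[OF chart(3)[OF c(1)]]])
      show "\<gamma> ` {0..\<tau>} \<subseteq> fst c" using KD \<gamma>K by blast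
    qed (use \<tau>(2) in auto)
    then have "(f' has_integral (snd c \<circ> \<gamma>) \<tau> - (snd c \<circ> \<gamma>) 0) {0..\<tau>}"
      by (rule fundamental_theorem_of_calculus_interior_strong[OF S(1) \<tau>(1), rotated]) (rule D(2))
    then have I: "f' integrable_on {0..\<tau>}" "integral {0..\<tau>} f' = snd c (\<gamma> \<tau>) - snd c (\<gamma> 0)"
      by (auto simp: integral_unique has_integral_integrable)
    have int: "speed \<gamma> integrable_on {0..\<tau>}"
      using speed_integrable[OF pw_C1_on_subinterval[OF \<gamma>(1)]] \<tau> by simp
    define s' where "s' t = (if t \<in> {0<..<\<tau>} - S then speed \<gamma> t / sqrt m else 0)" for t
    have "(\<lambda>t. speed \<gamma> t / sqrt m) integrable_on {0..\<tau>}"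
      using integrable_cmul[OF int, of "1 / sqrt m"] by simp
    then have "s' integrable_on {0..\<tau>}"
      by (rule integrable_spike_finite[of "S \<union> {0, \<tau>}", rotated 2])
         (use S(1) in \<open>auto simp: s'_def\<close>)
    moreover have "integral {0..\<tau>} s' = integral {0..\<tau>} (\<lambda>t. speed \<gamma> t / sqrt m)"
      by (rule integral_spike[of "S \<union> {0, \<tau>}"]) (use S(1) in \<open>auto simp: s'_def\<close>)
    moreover have "norm (f' t) \<le> s' t" for t
    proof (cases "t \<in> {0<..<\<tau>} - S")
      case True
      have tK: "\<gamma> t \<in> fst c" "snd c (\<gamma> t) \<in> cball p \<rho>" using KD[OF \<gamma>K[of t]] True by auto
      have "sqrt m * norm (f' t) = sqrt (m * (norm (f' t))\<^sup>2)" by (simp add: real_sqrt_mult)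
      also have "\<dots> \<le> sqrt (gm c (snd c (\<gamma> t)) (f' t) (f' t))" using b(4)[OF tK(2)] by simp
      also have "\<dots> = speed \<gamma> t" using speed_eq[where \<gamma> = \<gamma> and t = t, OF c(1) tK(1) D[OF True]] by simp
      finally show ?thesis using True b(1) by (simp add: s'_def field_simps)
    qed (auto simp: s'_def f'_def)
    ultimately have "norm (integral {0..\<tau>} f') \<le> integral {0..\<tau>} (speed \<gamma>) / sqrt m"
      using integral_norm_bound_integral[OF I(1), of s'] by simp
    with far I(2) have "\<rho> \<le> integral {0..\<tau>} (speed \<gamma>) / sqrt m" by simp
    moreover have "integral {0..\<tau>} (speed \<gamma>) \<le> integral {0..1} (speed \<gamma>)"
      using Henstock_Kurzweil_Integration.integral_combine[OF \<tau>(1,2) speed_integrable[OF \<gamma>(1)]]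
        length_nonneg[OF pw_C1_on_subinterval[OF \<gamma>(1), of \<tau> 1]] \<tau> by simp
    ultimately show False using \<gamma>(4) b(1) by (simp add: field_simps)
  qed
  moreover have "0 < sqrt m * \<rho>" using b by simp
  ultimately show ?thesis using K by blast
qed

section \<open>Precompactness of bounded sets (Hopf-Rinow)\<close>

definition precompact_ball :: "'m \<Rightarrow> real \<Rightarrow> bool" where
  "precompact_ball x r \<longleftrightarrow> (\<exists>K. compact K \<and> {y. dist_less x y r} \<subseteq> K)"

lemma dist_less_refl: "0 < e \<Longrightarrow> dist_less x x e"
  using dist_less_nhds eventually_nhds_x_imp_x by fast

text \<open>The compact closure of the ball of radius \<open>s\<close> is covered by finitely many
  sets of points within \<open>\<rho> / 2\<close> of centres \<open>q\<close> in that ball. A point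
  at distance less than \<open>\<rho> / 2\<close> from the ball is then within \<open>\<rho>\<close>
  of one of these finitely many centres.\<close>

lemma precompact_ball_enlarge:
  assumes balls: "\<And>q. dist_less p q s \<Longrightarrow> precompact_ball q \<rho>"
    and pre: "precompact_ball p s" and pos: "0 < s" "0 < \<rho>"
  shows "precompact_ball p (s + \<rho> / 2)"
proof -
  obtain K0 where K0: "compact K0" "{y. dist_less p y s} \<subseteq> K0" using pre by (auto simp: precompact_ball_def)
  define K where "K = closure {y. dist_less p y s}"
  have "K \<subseteq> K0" unfolding K_def by (rule closure_minimal[OF K0(2) compact_imp_closed[OF K0(1)]])
  then have K: "compact K" using compact_Int_closed[OF K0(1), of K] by (simp add: K_def Int_absorb1)
  have "\<exists>V q. open V \<and> k \<in> V \<and> dist_less p q s \<and> (\<forall>y\<in>V. dist_less q y (\<rho> / 2))" if k: "k \<in> K" for k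
  proof -
    \<comment> \<open>\<open>k\<close> lies only in the closure, while a centre must lie in the ball
      itself; the two steps from \<open>q\<close> to \<open>k\<close> and from \<open>k\<close> to
      \<open>y\<close>, each below \<open>\<rho> / 4\<close>, stay below
      \<open>\<rho> / 2\<close>.\<close>
    obtain V where V: "open V" "k \<in> V" "\<And>y. y \<in> V \<Longrightarrow> dist_less y k (\<rho> / 4)"
      using dist_less_nhds[of "\<rho> / 4" k] pos unfolding eventually_nhds by auto
    obtain q where q: "q \<in> V" "dist_less p q s"
      using k V(1,2) unfolding K_def closure_iff_nhds_not_empty by blast
    have "dist_less q y (\<rho> / 2)" if "y \<in> V" for y
      using dist_less_trans[OF V(3)[OF q(1)] dist_less_sym[OF V(3)[OF that]]] by simp
    with V(1,2) q(2) show ?thesis by blast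
  qed
  then obtain V q where Vq: "\<And>k. k \<in> K \<Longrightarrow> open (V k) \<and> k \<in> V k \<and> dist_less p (q k) s \<and>
      (\<forall>y\<in>V k. dist_less (q k) y (\<rho> / 2))" by metis
  obtain C where C: "C \<subseteq> K" "finite C" "K \<subseteq> (\<Union>k\<in>C. V k)"
    using compactE_image[OF K, of K V] Vq by blast
  have "\<forall>k\<in>C. \<exists>L. compact L \<and> {y. dist_less (q k) y \<rho>} \<subseteq> L"
    using balls Vq C(1) by (auto simp: precompact_ball_def)
  then obtain L where L: "\<And>k. k \<in> C \<Longrightarrow> compact (L k) \<and> {y. dist_less (q k) y \<rho>} \<subseteq> L k" by metis
  have "compact (\<Union>k\<in>C. L k)" using C(2) L by (intro compact_UN) auto
  moreover have "z \<in> (\<Union>k\<in>C. L k)" if z: "dist_less p z (s + \<rho> / 2)" for z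
  proof -
    obtain y where y: "dist_less p y s" "dist_less y z (\<rho> / 2)" using dist_less_split[OF z] pos by auto
    have "y \<in> {y. dist_less p y s}" using y(1) by simp
    then have "y \<in> K" unfolding K_def by (rule subsetD[OF closure_subset])
    then obtain k where k: "k \<in> C" "y \<in> V k" using C(3) by blast
    then have "dist_less (q k) y (\<rho> / 2)" using Vq C(1) by blast
    from dist_less_trans[OF this y(2)] have "dist_less (q k) z \<rho>" by simp
    then show ?thesis using L[OF k(1)] k(1) by blast
  qed
  ultimately show ?thesis unfolding precompact_ball_def by blast
qed

text \<open>Starting from radius \<open>r / 2\<close>, two enlargements by \<open>r / 4\<close>
  reach \<open>r\<close>.\<close>

lemma precompact_ball_half:
  assumes balls: "\<And>q. dist_less p q r \<Longrightarrow> precompact_ball q (r / 2)" and r: "0 < r"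
  shows "precompact_ball p r"
proof -
  have mono: "dist_less p q r" if "dist_less p q s" "s \<le> r" for q s
    using that by (metis ereal_less_eq(3) order_less_le_trans)
  have step: "precompact_ball p (s + r / 2 / 2)" if "precompact_ball p s" "0 < s" "s \<le> r" for s
    by (rule precompact_ball_enlarge[OF balls[OF mono] that(1,2)]) (use that(3) r in auto)
  have "precompact_ball p (r / 2)" using balls dist_less_refl[OF r] by blast
  from step[OF this] have "precompact_ball p (r / 2 + r / 2 / 2)" using r by simp
  from step[OF this] have "precompact_ball p (r / 2 + r / 2 / 2 + r / 2 / 2)" using r by simp
  then show ?thesis by simp
qed

text \<open>Hopf-Rinow: if a ball of radius \<open>R\<close> is not precompact, then repeatedly halving the radius gives a
  Cauchy sequence of centres whose limit contradicts local compactness.\<close>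

lemma precompact_balls:
  assumes complete: "complete_riemannian \<A> g" and R: "0 < R"
  shows "precompact_ball p R"
proof (rule ccontr)
  assume neg: "\<not> precompact_ball p R"
  have "\<exists>X. \<forall>k. \<not> precompact_ball (X k) (R / 2 ^ k) \<and> dist_less (X k) (X (Suc k)) (R / 2 ^ k)"
  proof (rule dependent_nat_choice)
    show "\<exists>x. \<not> precompact_ball x (R / 2 ^ 0)" using neg by auto
    show "\<exists>y. \<not> precompact_ball y (R / 2 ^ Suc k) \<and> dist_less x y (R / 2 ^ k)"
      if "\<not> precompact_ball x (R / 2 ^ k)" for x k
    proof (rule ccontr)
      assume "\<not> ?thesis"
      then have "precompact_ball q (R / 2 ^ k / 2)" if "dist_less x q (R / 2 ^ k)" for q
        using that by (auto simp: mult.commute)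
      from precompact_ball_half[OF this] that R show False by simp
    qed
  qed
  then obtain X where X: "\<And>k. \<not> precompact_ball (X k) (R / 2 ^ k)" "\<And>k. dist_less (X k) (X (Suc k)) (R / 2 ^ k)"
    by blast
  \<comment> \<open>Geometric series: the steps from index \<open>m\<close> on have total length
    below \<open>2 * R / 2 ^ m\<close>.\<close>
  have chain: "dist_less (X m) (X (m + j)) (2 * R / 2 ^ m)" for m j
  proof (induction j arbitrary: m)
    case 0
    then show ?case using R by (simp add: dist_less_refl)
  next
    case (Suc j)
    have "dist_less (X m) (X (Suc m + j)) (R / 2 ^ m + 2 * R / 2 ^ Suc m)"
      by (rule dist_less_trans[OF X(2) Suc])
    then show ?case by (simp add: field_simps)
  qed
  have small: "\<exists>N. \<forall>m\<ge>N. 2 * R / 2 ^ m < e" if "0 < e" for e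
  proof -
    have "(\<lambda>m. 2 * R * (1 / 2) ^ m) \<longlonglongrightarrow> 2 * R * 0"
      by (intro tendsto_mult tendsto_const LIMSEQ_realpow_zero) auto
    from order_tendstoD(2)[OF this, of e] that show ?thesis
      by (auto simp: eventually_sequentially power_one_over)
  qed
  have mono: "dist_less x y s" if "dist_less x y r" "r < s" for x y r s
    using that by (metis ereal_less_eq(3) less_imp_le order_less_le_trans)
  have "\<exists>N. \<forall>m\<ge>N. \<forall>n\<ge>N. dist_less (X m) (X n) e" if e: "0 < e" for e
  proof -
    obtain N where N: "\<And>m. m \<ge> N \<Longrightarrow> 2 * R / 2 ^ m < e" using small[OF e] by blast
    have le: "dist_less (X m) (X n) e" if "N \<le> m" "m \<le> n" for m n
      using mono[OF chain N[OF that(1)], of "n - m"] that(2) by simp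
    have "dist_less (X m) (X n) e" if "N \<le> m" "N \<le> n" for m n
      using le[of m n] dist_less_sym[OF le[of n m]] that by linarith
    then show ?thesis by blast
  qed
  then obtain x where x: "(\<lambda>n. riem_dist \<A> g (X n) x) \<longlonglongrightarrow> 0"
    using complete unfolding complete_riemannian_def by blast
  obtain e K where eK: "0 < e" "compact K" "\<And>y. dist_less x y e \<Longrightarrow> y \<in> K"
    using dist_less_compact by blast
  have "\<forall>\<^sub>F n in sequentially. dist_less (X n) x (e / 2)"
    using order_tendstoD(2)[OF x, of "ereal (e / 2)"] eK(1) by simp
  moreover obtain N where "\<And>m. m \<ge> N \<Longrightarrow> 2 * R / 2 ^ m < e / 2" using small[of "e / 2"] eK(1) by auto
  then have "\<forall>\<^sub>F n in sequentially. 2 * R / 2 ^ n < e / 2" unfolding eventually_sequentially by blast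
  ultimately have "\<forall>\<^sub>F n in sequentially. dist_less (X n) x (e / 2) \<and> 2 * R / 2 ^ n < e / 2"
    by (rule eventually_conj)
  then obtain n where n: "dist_less (X n) x (e / 2)" "2 * R / 2 ^ n < e / 2"
    unfolding eventually_sequentially by blast
  have "y \<in> K" if "dist_less (X n) y (R / 2 ^ n)" for y
  proof -
    have "0 \<le> R / 2 ^ n" using R by simp
    then have "dist_less (X n) y (e / 2)" using n(2) by (intro mono[OF that]) simp
    from dist_less_trans[OF dist_less_sym[OF n(1)] this] show ?thesis by (intro eK(3)) simp
  qed
  then have "precompact_ball (X n) (R / 2 ^ n)" using eK(2) unfolding precompact_ball_def by blast
  with X(1) show False by blast
qed

lemma compact_closure_bounded:
  assumes "complete_riemannian \<A> g" "riem_bounded \<A> g S"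
  shows "compact (closure S)"
proof (cases "S = {}")
  case False
  then obtain x where x: "x \<in> S" by blast
  obtain B where B: "\<And>y. y \<in> S \<Longrightarrow> riem_dist \<A> g x y \<le> ereal B"
    using assms(2) x unfolding riem_bounded_def by blast
  \<comment> \<open>The added 1 makes the bound strict and the radius positive.\<close>
  define R where "R = max B 0 + 1"
  have "ereal B < ereal R" "0 < R" by (auto simp: R_def)
  then have "S \<subseteq> {y. dist_less x y R}" using le_less_trans[OF B] by blast
  moreover obtain K where K: "compact K" "{y. dist_less x y R} \<subseteq> K"
    using precompact_balls[OF assms(1) \<open>0 < R\<close>] unfolding precompact_ball_def by blast
  ultimately have "closure S \<subseteq> K" by (intro closure_minimal compact_imp_closed) auto
  then show ?thesis using compact_Int_closed[OF K(1) closed_closure, of S] by (simp add: Int_absorb1)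
qed simp

section \<open>Envelopes and transfer to the Dirichlet problem\<close>

lemma lower_envelope_nhds:
  assumes "a < lower_envelope \<A> g S u x"
  shows "\<forall>\<^sub>F y in nhds x. y \<in> S \<longrightarrow> a < ereal (u y)"
proof -
  define h where "h = (\<lambda>r. INF y\<in>{y\<in>S. riem_dist \<A> g y x \<le> ereal r}. ereal (u y))"
  have anti: "h s \<le> h r" if "r \<le> s" for r s
    unfolding h_def using that by (intro INF_superset_mono) (auto intro: order_trans)
  \<comment> \<open>\<open>Lim\<close> is a definite description, so an actual limit must be
    exhibited; monotonicity in the radius identifies it as a supremum.\<close>
  have "(h \<longlongrightarrow> (SUP r\<in>{0<..}. h r)) (at_right 0)"
  proof (rule order_tendstoI)
    fix b assume "b < (SUP r\<in>{0<..}. h r)"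
    then obtain r where "0 < r" "b < h r" by (auto simp: less_SUP_iff)
    then show "\<forall>\<^sub>F s in at_right 0. b < h s"
      unfolding eventually_at_right_field using anti by (meson less_imp_le less_le_trans)
  next
    fix b assume b: "(SUP r\<in>{0<..}. h r) < b"
    have "h r < b" if "0 < r" for r
      using SUP_upper[of r "{0<..}" h] that b by (auto intro: le_less_trans)
    then show "\<forall>\<^sub>F s in at_right 0. h s < b"
      unfolding eventually_at_right_field by (intro exI[of _ 1]) auto
  qed
  from tendsto_Lim[OF _ this] have "lower_envelope \<A> g S u x = (SUP r\<in>{0<..}. h r)"
    by (simp add: lower_envelope_def h_def)
  with assms obtain r where r: "0 < r" "a < h r" by (auto simp: less_SUP_iff)
  \<comment> \<open>Distance balls contain topological neighbourhoods, so a bound on the ball of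
    radius \<open>r\<close> is a bound near \<open>x\<close>.\<close>
  from dist_less_nhds[OF r(1), of x] show ?thesis
  proof eventually_elim
    case (elim y)
    show ?case
    proof
      assume "y \<in> S"
      then have "h r \<le> ereal (u y)" unfolding h_def using elim by (intro INF_lower) auto
      with r(2) show "a < ereal (u y)" by (rule less_le_trans)
    qed
  qed
qed

lemma upper_envelope_nhds:
  assumes "upper_envelope \<A> g S u x < a"
  shows "\<forall>\<^sub>F y in nhds x. y \<in> S \<longrightarrow> ereal (u y) < a"
proof -
  define h where "h = (\<lambda>r. SUP y\<in>{y\<in>S. riem_dist \<A> g y x \<le> ereal r}. ereal (u y))"
  have mono: "h r \<le> h s" if "r \<le> s" for r s
    unfolding h_def using that by (intro SUP_subset_mono) (auto intro: order_trans)
  have "(h \<longlongrightarrow> (INF r\<in>{0<..}. h r)) (at_right 0)"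
  proof (rule order_tendstoI)
    fix b assume "(INF r\<in>{0<..}. h r) < b"
    then obtain r where "0 < r" "h r < b" by (auto simp: INF_less_iff)
    then show "\<forall>\<^sub>F s in at_right 0. h s < b"
      unfolding eventually_at_right_field using mono by (meson less_imp_le le_less_trans)
  next
    fix b assume b: "b < (INF r\<in>{0<..}. h r)"
    have "b < h r" if "0 < r" for r
      using INF_lower[of r "{0<..}" h] that b by (auto intro: less_le_trans)
    then show "\<forall>\<^sub>F s in at_right 0. b < h s"
      unfolding eventually_at_right_field by (intro exI[of _ 1]) auto
  qed
  from tendsto_Lim[OF _ this] have "upper_envelope \<A> g S u x = (INF r\<in>{0<..}. h r)"
    by (simp add: upper_envelope_def h_def)
  with assms obtain r where r: "0 < r" "h r < a" by (auto simp: INF_less_iff)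
  from dist_less_nhds[OF r(1), of x] show ?thesis
  proof eventually_elim
    case (elim y)
    show ?case
    proof
      assume "y \<in> S"
      then have "ereal (u y) \<le> h r" unfolding h_def using elim by (intro SUP_upper) auto
      then show "ereal (u y) < a" using r(2) by (rule le_less_trans)
    qed
  qed
qed

end

text \<open>Functions are total on the manifold, but only their values on the closure count. Outside
  it the competitors in the theorem are unconstrained, so their supremum can be identified with the
  solution on the closure only.\<close>

lemma DP_subsolution_cong:
  assumes "open \<Omega>" "\<And>x. x \<in> closure \<Omega> \<Longrightarrow> u x = v x" "DP_subsolution \<A> g F \<Omega> f v"
  shows "DP_subsolution \<A> g F \<Omega> f u"
proof -
  have ev: "\<forall>\<^sub>F y in nhds x. u y = v y" if "x \<in> \<Omega>" for x
    using eventually_nhds_in_open[OF assms(1) that]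
    by eventually_elim (use assms(2) closure_subset[of \<Omega>] in blast)
  have "superjet \<A> g u x = superjet \<A> g v x" if "x \<in> \<Omega>" for x
  proof -
    have "(\<forall>\<^sub>F y in nhds x. u y - \<phi> y \<le> u x - \<phi> x) \<longleftrightarrow> (\<forall>\<^sub>F y in nhds x. v y - \<phi> y \<le> v x - \<phi> x)" for \<phi>
      using eventually_nhds_x_imp_x[OF ev[OF that]]
      by (intro eventually_cong[OF ev[OF that]]) simp
    then show ?thesis by (simp add: superjet_def)
  qed
  moreover have "u x = v x" if "x \<in> \<Omega>" for x using assms(2) closure_subset that by blast
  moreover have "usc_on (closure \<Omega>) u" using assms(2,3) by (simp add: DP_subsolution_def usc_on_iff cong: imp_cong)
  moreover have "frontier \<Omega> \<subseteq> closure \<Omega>" by (simp add: frontier_def)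
  ultimately show ?thesis
    using assms(2,3) by (auto simp: DP_subsolution_def viscosity_subsolution_def)
qed

lemma DP_supersolution_cong:
  assumes "open \<Omega>" "\<And>x. x \<in> closure \<Omega> \<Longrightarrow> u x = v x" "DP_supersolution \<A> g F \<Omega> f v"
  shows "DP_supersolution \<A> g F \<Omega> f u"
proof -
  have ev: "\<forall>\<^sub>F y in nhds x. u y = v y" if "x \<in> \<Omega>" for x
    using eventually_nhds_in_open[OF assms(1) that]
    by eventually_elim (use assms(2) closure_subset[of \<Omega>] in blast)
  have "subjet \<A> g u x = subjet \<A> g v x" if "x \<in> \<Omega>" for x
  proof -
    have "(\<forall>\<^sub>F y in nhds x. u x - \<phi> x \<le> u y - \<phi> y) \<longleftrightarrow> (\<forall>\<^sub>F y in nhds x. v x - \<phi> x \<le> v y - \<phi> y)" for \<phi>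
      using eventually_nhds_x_imp_x[OF ev[OF that]]
      by (intro eventually_cong[OF ev[OF that]]) simp
    then show ?thesis by (simp add: subjet_def)
  qed
  moreover have "u x = v x" if "x \<in> \<Omega>" for x using assms(2) closure_subset that by blast
  moreover have "lsc_on (closure \<Omega>) u"
    using assms(2,3) by (simp add: DP_supersolution_def lsc_on_iff usc_on_iff cong: imp_cong)
  moreover have "frontier \<Omega> \<subseteq> closure \<Omega>" by (simp add: frontier_def)
  ultimately show ?thesis
    using assms(2,3) by (auto simp: DP_supersolution_def viscosity_supersolution_def)
qed

context riemannian
begin

text \<open>The point where geometry meets the abstract method: continuity of \<open>F\<close> along
  jets, ellipticity by the second derivative test, and the quartic as penalty.\<close>

lemma elliptic_test_operator:
  assumes "proper_operator \<A> F" "continuous_map (jet_topology \<A>) euclideanreal F"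
  shows "elliptic_test (C2_near \<A>) (\<lambda>\<phi> x r. F (x, r, gradient \<phi> x, hessian \<A> g \<phi> x))"
proof
  show "F (x, r, gradient \<psi> x, hessian \<A> g \<psi> x) \<le> F (x, r, gradient \<phi> x, hessian \<A> g \<phi> x)"
    if "C2_near \<A> x \<phi>" "C2_near \<A> x \<psi>" "\<forall>\<^sub>F y in nhds x. \<phi> y - \<psi> y \<le> \<phi> x - \<psi> x" for x \<phi> \<psi> r
    using operator_elliptic[OF _ that] assms(1) by (simp add: proper_operator_def)
  show "F (x, r, gradient \<phi> x, hessian \<A> g \<phi> x) \<le> F (x, s, gradient \<phi> x, hessian \<A> g \<phi> x)"
    if "C2_near \<A> x \<phi>" "r \<le> s" for x \<phi> r s
    using assms(1) jet_in_jet_space[OF that(1)] that(2) unfolding proper_operator_def by blast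
  show "\<exists>\<theta> K. compact K \<and> K \<subseteq> N \<and> x \<in> interior K \<and>
      continuous_on K \<theta> \<and> \<theta> x = 0 \<and> (\<forall>y\<in>K - {x}. 0 < \<theta> y) \<and>
      (\<forall>\<phi> s. C2_near \<A> x \<phi> \<longrightarrow> C2_near \<A> x (\<lambda>y. \<phi> y + s * \<theta> y) \<and>
        (\<forall>r. F (x, r, gradient (\<lambda>y. \<phi> y + s * \<theta> y) x, hessian \<A> g (\<lambda>y. \<phi> y + s * \<theta> y) x) =
          F (x, r, gradient \<phi> x, hessian \<A> g \<phi> x)))" if N: "open N" "x \<in> N" for N x
  proof -
    obtain \<theta> K where K: "compact K" "K \<subseteq> N" "x \<in> interior K" "continuous_on K \<theta>" "\<theta> x = 0"
        "\<forall>y\<in>K - {x}. 0 < \<theta> y"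
      and *: "\<And>\<phi> s. C2_near \<A> x \<phi> \<Longrightarrow> C2_near \<A> x (\<lambda>y. \<phi> y + s * \<theta> y) \<and>
        gradient (\<lambda>y. \<phi> y + s * \<theta> y) x = gradient \<phi> x \<and>
        hessian \<A> g (\<lambda>y. \<phi> y + s * \<theta> y) x = hessian \<A> g \<phi> x"
      using quartic_penalty[OF N] by blast
    show ?thesis by (intro exI[of _ \<theta>] exI[of _ K] conjI K allI impI) (simp_all add: *)
  qed
qed (auto intro: C2_near_uminus C2_near_nhds C2_near_isCont operator_tendsto[OF assms(2)])

lemma DP_subsolution_iff:
  assumes "elliptic_test (C2_near \<A>) (\<lambda>\<phi> x r. F (x, r, gradient \<phi> x, hessian \<A> g \<phi> x))" (is "elliptic_test _ ?G")
  shows "DP_subsolution \<A> g F \<Omega> f u \<longleftrightarrow> usc_on (closure \<Omega>) u \<and>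
    (\<forall>x\<in>\<Omega>. elliptic_test.sub_at (C2_near \<A>) ?G u x) \<and> (\<forall>x\<in>frontier \<Omega>. u x \<le> f x)"
proof -
  interpret elliptic_test "C2_near \<A>" ?G by (rule assms)
  have "(\<forall>(\<zeta>, A)\<in>superjet \<A> g u x. F (x, u x, \<zeta>, A) \<le> 0) \<longleftrightarrow> sub_at u x" for x
  proof -
    have "(\<forall>(\<zeta>, A)\<in>superjet \<A> g u x. F (x, u x, \<zeta>, A) \<le> 0)
        \<longleftrightarrow> (\<forall>\<zeta> A. (\<zeta>, A) \<in> superjet \<A> g u x \<longrightarrow> F (x, u x, \<zeta>, A) \<le> 0)" by auto
    then show ?thesis unfolding superjet_iff sub_at_def by blast
  qed
  then show ?thesis by (simp add: DP_subsolution_def viscosity_subsolution_def)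
qed

lemma DP_supersolution_iff:
  assumes "elliptic_test (C2_near \<A>) (\<lambda>\<phi> x r. F (x, r, gradient \<phi> x, hessian \<A> g \<phi> x))" (is "elliptic_test _ ?G")
  shows "DP_supersolution \<A> g F \<Omega> f u \<longleftrightarrow> lsc_on (closure \<Omega>) u \<and>
    (\<forall>x\<in>\<Omega>. elliptic_test.super_at (C2_near \<A>) ?G u x) \<and> (\<forall>x\<in>frontier \<Omega>. f x \<le> u x)"
proof -
  interpret elliptic_test "C2_near \<A>" ?G by (rule assms)
  have "(\<forall>(\<zeta>, A)\<in>subjet \<A> g u x. 0 \<le> F (x, u x, \<zeta>, A)) \<longleftrightarrow> super_at u x" for x
  proof -
    have "(\<forall>(\<zeta>, A)\<in>subjet \<A> g u x. 0 \<le> F (x, u x, \<zeta>, A))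
        \<longleftrightarrow> (\<forall>\<zeta> A. (\<zeta>, A) \<in> subjet \<A> g u x \<longrightarrow> 0 \<le> F (x, u x, \<zeta>, A))" by auto
    then show ?thesis unfolding subjet_iff super_at_def by blast
  qed
  then show ?thesis by (simp add: DP_supersolution_def viscosity_supersolution_def)
qed

lemma DP_solution_exists:
  assumes complete: "complete_riemannian \<A> g" and \<Omega>: "open \<Omega>" "riem_bounded \<A> g \<Omega>"
    and F: "proper_operator \<A> F" "continuous_map (jet_topology \<A>) euclideanreal F"
    and comparison: "\<And>w v. DP_subsolution \<A> g F \<Omega> f w \<Longrightarrow> DP_supersolution \<A> g F \<Omega> f v
           \<Longrightarrow> \<forall>x\<in>closure \<Omega>. w x \<le> v x"
    and ul: "DP_subsolution \<A> g F \<Omega> f ul" and uu: "DP_supersolution \<A> g F \<Omega> f uu"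
    and bdry: "\<And>x. x \<in> frontier \<Omega> \<Longrightarrow> lower_envelope \<A> g \<Omega> ul x = ereal (f x)"
      "\<And>x. x \<in> frontier \<Omega> \<Longrightarrow> upper_envelope \<A> g \<Omega> uu x = ereal (f x)"
  shows "\<exists>U. DP_solution \<A> g F \<Omega> f U"
proof -
  note T = elliptic_test_operator[OF F]
  interpret elliptic_test "C2_near \<A>" "\<lambda>\<phi> x r. F (x, r, gradient \<phi> x, hessian \<A> g \<phi> x)" by (rule T)
  note sub = DP_subsolution_iff[OF T] and super = DP_supersolution_iff[OF T]
  have ul_bd: "\<forall>\<^sub>F y in nhds x. y \<in> \<Omega> \<longrightarrow> a < ul y" if "x \<in> frontier \<Omega>" "a < f x" for x a
    using lower_envelope_nhds[of "ereal a" \<Omega> ul x] bdry(1)[OF that(1)] that(2) by simp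
  have uu_bd: "\<forall>\<^sub>F y in nhds x. y \<in> \<Omega> \<longrightarrow> uu y < a" if "x \<in> frontier \<Omega>" "f x < a" for x a
    using upper_envelope_nhds[of \<Omega> uu x "ereal a"] bdry(2)[OF that(1)] that(2) by simp
  \<comment> \<open>Frontier points are limits of points of \<open>\<Omega>\<close>, so conditions
    on the points of \<open>\<Omega>\<close> near them are never vacuous.\<close>
  have near: "\<exists>y\<in>\<Omega>. Q y" if x: "x \<in> frontier \<Omega>" "\<forall>\<^sub>F y in nhds x. y \<in> \<Omega> \<longrightarrow> Q y" for x Q
  proof -
    obtain V where V: "open V" "x \<in> V" "\<And>y. y \<in> V \<Longrightarrow> y \<in> \<Omega> \<longrightarrow> Q y"
      using x(2) unfolding eventually_nhds by blast
    moreover have "x \<in> closure \<Omega>" using x(1) by (simp add: frontier_def)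
    ultimately show ?thesis unfolding closure_iff_nhds_not_empty by blast
  qed
  \<comment> \<open>Semicontinuity on the closure does not let \<open>ul x\<close> fall below the
    values of \<open>ul\<close> inside, which are eventually above every number less than
    \<open>f x\<close>; the inequality assumed on the frontier gives the other half, and dually for
    \<open>uu\<close>.\<close>
  have bd: "ul x = f x \<and> uu x = f x" if x: "x \<in> frontier \<Omega>" for x
  proof
    have xc: "x \<in> closure \<Omega>" using x by (simp add: frontier_def)
    have "ul x \<le> f x" using ul x by (simp add: DP_subsolution_def)
    moreover have "\<not> ul x < f x"
    proof
      assume "ul x < f x"
      then obtain a where a: "ul x < a" "a < f x" using dense by blast
      have "\<forall>\<^sub>F y in nhds x. y \<in> closure \<Omega> \<longrightarrow> ul y < a"
        using ul a(1) xc unfolding DP_subsolution_def usc_on_iff by blast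
      then have "\<forall>\<^sub>F y in nhds x. y \<in> \<Omega> \<longrightarrow> False"
        using ul_bd[OF x a(2)] by eventually_elim (use closure_subset in force)
      from near[OF x this] show False by blast
    qed
    ultimately show "ul x = f x" by simp
    have "f x \<le> uu x" using uu x by (simp add: DP_supersolution_def)
    moreover have "\<not> f x < uu x"
    proof
      assume "f x < uu x"
      then obtain a where a: "f x < a" "a < uu x" using dense by blast
      have "\<forall>\<^sub>F y in nhds x. y \<in> closure \<Omega> \<longrightarrow> - uu y < - a"
        using uu a(2) xc unfolding DP_supersolution_def lsc_on_iff usc_on_iff by (meson neg_less_iff_less)
      then have "\<forall>\<^sub>F y in nhds x. y \<in> \<Omega> \<longrightarrow> False"
        using uu_bd[OF x a(1)] by eventually_elim (use closure_subset in force)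
      from near[OF x this] show False by blast
    qed
    ultimately show "uu x = f x" by simp
  qed
  have "\<exists>U. usc_on (closure \<Omega>) U \<and> lsc_on (closure \<Omega>) U \<and>
    (\<forall>y\<in>\<Omega>. sub_at U y \<and> super_at U y) \<and> (\<forall>y\<in>frontier \<Omega>. U y = f y)"
  proof (rule perron[OF \<Omega>(1) compact_closure_bounded[OF complete \<Omega>(2)] _ _ _ _ bd ul_bd uu_bd])
    show "\<forall>x\<in>closure \<Omega>. w x \<le> v x"
      if "usc_on (closure \<Omega>) w" "\<And>y. y \<in> \<Omega> \<Longrightarrow> sub_at w y" "\<And>y. y \<in> frontier \<Omega> \<Longrightarrow> w y \<le> f y"
        "lsc_on (closure \<Omega>) v" "\<And>y. y \<in> \<Omega> \<Longrightarrow> super_at v y" "\<And>y. y \<in> frontier \<Omega> \<Longrightarrow> f y \<le> v y" for w v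
      by (rule comparison) (use that in \<open>auto simp: sub super\<close>)
  qed (use ul uu in \<open>auto simp: sub super\<close>)
  then show ?thesis by (auto simp: DP_solution_def sub super)
qed

end

theorem theorem6p2:
  fixes \<A> :: "('m::{t2_space,second_countable_topology}, 'a::euclidean_space) chart set"
    and g :: "('m, 'a) metric"
    and F :: "('m, 'a) jet \<Rightarrow> real"
    and \<Omega> :: "'m set"
    and f u_low u_up :: "'m \<Rightarrow> real"
  assumes "riemannian_manifold \<A> g"
    and "complete_riemannian \<A> g"
    and "open \<Omega>"
    and "riem_bounded \<A> g \<Omega>"
    and "proper_operator \<A> F"
    and "continuous_map (jet_topology \<A>) euclideanreal F"
    and comparison: "\<And>w v. DP_subsolution \<A> g F \<Omega> f w \<Longrightarrow> DP_supersolution \<A> g F \<Omega> f v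
           \<Longrightarrow> \<forall>x\<in>closure \<Omega>. w x \<le> v x"
    and "DP_subsolution \<A> g F \<Omega> f u_low"
    and "DP_supersolution \<A> g F \<Omega> f u_up"
    and "\<forall>x\<in>frontier \<Omega>. lower_envelope \<A> g \<Omega> u_low x = ereal (f x)
           \<and> upper_envelope \<A> g \<Omega> u_up x = ereal (f x)"
  shows "DP_solution \<A> g F \<Omega> f
    (\<lambda>x. Sup {w x |w. (\<forall>y\<in>closure \<Omega>. u_low y \<le> w y \<and> w y \<le> u_up y)
                      \<and> DP_subsolution \<A> g F \<Omega> f w})"
proof -
  interpret riemannian \<A> g by unfold_locales (rule assms(1))
  let ?S = "{w. (\<forall>y\<in>closure \<Omega>. u_low y \<le> w y \<and> w y \<le> u_up y) \<and> DP_subsolution \<A> g F \<Omega> f w}"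
  obtain U where U: "DP_subsolution \<A> g F \<Omega> f U" "DP_supersolution \<A> g F \<Omega> f U"
    using DP_solution_exists[OF assms(2-6) comparison assms(8,9)] assms(10) by (auto simp: DP_solution_def)
  \<comment> \<open>Comparison with both barriers makes \<open>U\<close> a competitor; comparison
    with \<open>U\<close> as supersolution then makes it the largest one.\<close>
  have "U \<in> ?S" using U comparison[OF assms(8) U(2)] comparison[OF U(1) assms(9)] by blast
  have W: "Sup {w x |w. (\<forall>y\<in>closure \<Omega>. u_low y \<le> w y \<and> w y \<le> u_up y) \<and> DP_subsolution \<A> g F \<Omega> f w} = U x"
    if "x \<in> closure \<Omega>" for x
  proof (rule cSup_eq_maximum)
    show "U x \<in> {w x |w. (\<forall>y\<in>closure \<Omega>. u_low y \<le> w y \<and> w y \<le> u_up y) \<and> DP_subsolution \<A> g F \<Omega> f w}"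
      using \<open>U \<in> ?S\<close> by blast
    show "r \<le> U x"
      if "r \<in> {w x |w. (\<forall>y\<in>closure \<Omega>. u_low y \<le> w y \<and> w y \<le> u_up y) \<and> DP_subsolution \<A> g F \<Omega> f w}" for r
      using that comparison[OF _ U(2)] \<open>x \<in> closure \<Omega>\<close> by blast
  qed
  show ?thesis
    unfolding DP_solution_def
    using DP_subsolution_cong[OF assms(3) W U(1)] DP_supersolution_cong[OF assms(3) W U(2)] by blast
qed

end
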